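(* Let $(W(n))_{n\ge0}$ be a Somos 4 sequence with $\tau_1\neq0$ and $W(0)\neq0$. Let $E/\mathbb{Q}$ be the associated elliptic curve and $\mathbf{P}=(P_1,P_2)\in E(\mathbb{Q})^2$ the associated rational point. Let $p$ be an odd prime, with $E$ given by a Weierstrass equation with $p$-integral coefficients, such that $P_1$ and $P_2$ modulo $p$ are nonsingular, $P_1,\ P_2,\ P_2\pm P_1\not\equiv\mathcal{O}\pmod p$, and the order of $P_1$ modulo $p$ is greater than $3$. Assume further that $\mathrm{ord}_p\left(\frac{W(1)}{W(0)}\right)\ge0$ and $\mathrm{ord}_p(W(0))\ge 0$. Then there is a power $q=p^N$ ($N\ge1$) such that for all $m\ge1$ the limit $\lim_{i\to\infty}W(mq^i)$ exists in $\mathbb{Z}_p$.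
   Context: A Somos 4 sequence is a sequence $(W(n))_{n\ge0}$ (here of rational numbers) satisfying $W(n)W(n-4)=\tau_1W(n-1)W(n-3)+\tau_2W(n-2)^2$ for all $n\ge4$, with constant parameters $\tau_1,\tau_2$. Associated curve and point. The elliptic curve $E/\mathbb{Q}$ and $\mathbf{P}=(P_1,P_2)\in E(\mathbb{Q})^2$ are associated to $(W(n))$ if they realize Hone's sigma-function solution: $P_1,P_2$ are the images of $z_1,z_2\in\mathbb{C}$ under a uniformization $\mathbb{C}/L\cong E(\mathbb{C})$, and $W(n)=\alpha^n\beta\,\Psi_n(\mathbf{P})$ for all $n\ge1$, with $\alpha=W(1)/W(0)$, $\beta=W(0)$, where $\Psi_n(\mathbf{P})=\dfrac{\sigma(nz_1+z_2)}{\sigma(z_1)^{n^2-n}\sigma(z_1+z_2)^n\sigma(z_2)^{1-n}}$ ($\sigma$ the Weierstrass sigma function of $L$) are the values of the translated division polynomials. Algebraically, for $E: y^2+a_1xy+a_3y=x^3+a_2x^2+a_4x+a_6$ and $P_i=(x_i,y_i)$ with $P_1,P_2,P_2\pm P_1\ne\mathcal{O}$, the $\Psi_n(\mathbf{P})$ are the specializations at $(E,\mathbf{P})$ of the universal expressions determined by $\Psi_{-1}=x_1-x_2$, $\Psi_0=\Psi_1=1$, $\Psi_2=2x_1+x_2-\left(\frac{y_2-y_1}{x_2-x_1}\right)^2-a_1\frac{y_2-y_1}{x_2-x_1}+a_2$ and $\Psi_{m+2}\Psi_{m-2}=\beta_1^2\Psi_{m+1}\Psi_{m-1}-\beta_2\Psi_m^2$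 ($m\in\mathbb{Z}$), $\beta_1=2y_1+a_1x_1+a_3$, $\beta_2=3x_1^4+b_2x_1^3+3b_4x_1^2+3b_6x_1+b_8$ ($b_i$ the usual Weierstrass quantities); with $a_i,x_i,y_i$ generic these lie in $\mathbb{Z}[a_1,a_2,a_3,a_4,a_6][x_1,y_1,x_2,y_2][(x_1-x_2)^{-1}]$ modulo the two Weierstrass equations. Reduction. $Q\in E(\mathbb{Q})$ is nonsingular modulo $p$ if it reduces to a nonsingular point of the reduced cubic over $\mathbb{F}_p$; its order modulo $p$ is its order in the group of nonsingular points; $Q\equiv\mathcal{O}\pmod p$ means that it reduces to $\mathcal{O}$. *)

theory Defs
  imports
    "HOL-Complex_Analysis.Complex_Analysis"
    "HOL-Number_Theory.Number_Theory"
    "HOL-Algebra.Algebraic_Closure_Type"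
    "HOL-Library.Extended_Real"
begin

hide_const (open) Divisibility.prime

definition somos4 :: "(nat \<Rightarrow> rat) \<Rightarrow> rat \<Rightarrow> rat \<Rightarrow> bool" where
  "somos4 W \<tau>\<^sub>1 \<tau>\<^sub>2 \<longleftrightarrow>
     (\<forall>n\<ge>4. W n * W (n - 4) = \<tau>\<^sub>1 * W (n - 1) * W (n - 3) + \<tau>\<^sub>2 * (W (n - 2))\<^sup>2)"


section \<open>Valuations and p-adic limits\<close>

definition pval :: "nat \<Rightarrow> rat \<Rightarrow> ereal" where
  "pval p x =
     (if x = 0 then \<infinity>
      else ereal (real (multiplicity (int p) (fst (quotient_of x))) -
                  real (multiplicity (int p) (snd (quotient_of x)))))"

text \<open>The ring of p-adic integers as the inverse limit of the rings of integers modulo powers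
  of the prime; a p-adic integer is the compatible sequence of its least nonnegative residues.\<close>

definition padic_ints :: "nat \<Rightarrow> (nat \<Rightarrow> int) set" where
  "padic_ints p = {x. \<forall>k. x k \<in> {0..<int p ^ k} \<and> x (Suc k) mod int p ^ k = x k}"

text \<open>Convergence of a sequence of rationals to a p-adic integer \<open>x\<close>. As \<open>x - x k\<close> has valuation
  at least \<open>k\<close>, the condition on \<open>a i - x k\<close> says that \<open>a i - x\<close> has valuation at least \<open>k\<close>.\<close>

definition padic_tendsto :: "nat \<Rightarrow> (nat \<Rightarrow> rat) \<Rightarrow> (nat \<Rightarrow> int) \<Rightarrow> bool" where
  "padic_tendsto p a x \<longleftrightarrow>
     (\<forall>k. \<forall>\<^sub>F i in sequentially. pval p (a i - of_int (x k)) \<ge> ereal (real k))"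


section \<open>Weierstrass curves and the group law\<close>

datatype 'a wcurve =
  WCurve (a\<^sub>1: 'a) (a\<^sub>2: 'a) (a\<^sub>3: 'a) (a\<^sub>4: 'a) (a\<^sub>6: 'a)

datatype 'a ec_point = Infinity | Affine 'a 'a

definition b\<^sub>2 :: "'a::comm_ring_1 wcurve \<Rightarrow> 'a" where
  "b\<^sub>2 E = (a\<^sub>1 E)\<^sup>2 + 4 * a\<^sub>2 E"

definition b\<^sub>4 :: "'a::comm_ring_1 wcurve \<Rightarrow> 'a" where
  "b\<^sub>4 E = 2 * a\<^sub>4 E + a\<^sub>1 E * a\<^sub>3 E"

definition b\<^sub>6 :: "'a::comm_ring_1 wcurve \<Rightarrow> 'a" where
  "b\<^sub>6 E = (a\<^sub>3 E)\<^sup>2 + 4 * a\<^sub>6 E"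

definition b\<^sub>8 :: "'a::comm_ring_1 wcurve \<Rightarrow> 'a" where
  "b\<^sub>8 E = (a\<^sub>1 E)\<^sup>2 * a\<^sub>6 E + 4 * a\<^sub>2 E * a\<^sub>6 E - a\<^sub>1 E * a\<^sub>3 E * a\<^sub>4 E
            + a\<^sub>2 E * (a\<^sub>3 E)\<^sup>2 - (a\<^sub>4 E)\<^sup>2"

definition ec_disc :: "'a::comm_ring_1 wcurve \<Rightarrow> 'a" where
  "ec_disc E = - (b\<^sub>2 E)\<^sup>2 * b\<^sub>8 E - 8 * (b\<^sub>4 E) ^ 3 - 27 * (b\<^sub>6 E)\<^sup>2
               + 9 * b\<^sub>2 E * b\<^sub>4 E * b\<^sub>6 E"

text \<open>The group law is needed over the rational and complex numbers and over the residue field,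
  which is not a type. It is therefore defined over a field in the sense of HOL-Algebra, to be
  instantiated with \<^const>\<open>ring_of_type_algebra\<close> or \<^const>\<open>residue_ring\<close>.\<close>

context
  fixes R :: "('a, 'b) ring_scheme" (structure)
begin

definition ec_points :: "'a wcurve \<Rightarrow> 'a ec_point set" where
  "ec_points E = insert Infinity
     {Affine x y | x y. x \<in> carrier R \<and> y \<in> carrier R \<and>
        y [^] (2::nat) \<oplus> a\<^sub>1 E \<otimes> x \<otimes> y \<oplus> a\<^sub>3 E \<otimes> y =
        x [^] (3::nat) \<oplus> a\<^sub>2 E \<otimes> x [^] (2::nat) \<oplus> a\<^sub>4 E \<otimes> x \<oplus> a\<^sub>6 E}"

text \<open>The partial derivatives of the difference of the two sides of the equation (in \<open>x\<close> up to
  sign).\<close>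

definition ec_dx :: "'a wcurve \<Rightarrow> 'a \<Rightarrow> 'a \<Rightarrow> 'a" where
  "ec_dx E x y = [(3::nat)] \<cdot> (x [^] (2::nat)) \<oplus> [(2::nat)] \<cdot> (a\<^sub>2 E \<otimes> x) \<oplus> a\<^sub>4 E \<ominus> a\<^sub>1 E \<otimes> y"

definition ec_dy :: "'a wcurve \<Rightarrow> 'a \<Rightarrow> 'a \<Rightarrow> 'a" where
  "ec_dy E x y = [(2::nat)] \<cdot> y \<oplus> a\<^sub>1 E \<otimes> x \<oplus> a\<^sub>3 E"

definition nonsingular :: "'a wcurve \<Rightarrow> 'a ec_point \<Rightarrow> bool" where
  "nonsingular E P \<longleftrightarrow>
     (case P of Infinity \<Rightarrow> True | Affine x y \<Rightarrow> ec_dx E x y \<noteq> \<zero> \<or> ec_dy E x y \<noteq> \<zero>)"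

definition ec_neg :: "'a wcurve \<Rightarrow> 'a ec_point \<Rightarrow> 'a ec_point" where
  "ec_neg E P =
     (case P of Infinity \<Rightarrow> Infinity | Affine x y \<Rightarrow> Affine x (\<ominus> y \<ominus> a\<^sub>1 E \<otimes> x \<ominus> a\<^sub>3 E))"

definition ec_add :: "'a wcurve \<Rightarrow> 'a ec_point \<Rightarrow> 'a ec_point \<Rightarrow> 'a ec_point" where
  "ec_add E P Q =
     (case P of Infinity \<Rightarrow> Q | Affine x\<^sub>1 y\<^sub>1 \<Rightarrow>
     (case Q of Infinity \<Rightarrow> P | Affine x\<^sub>2 y\<^sub>2 \<Rightarrow>
        if Q = ec_neg E P then Infinity
        else
          let l = (if x\<^sub>1 = x\<^sub>2 then ec_dx E x\<^sub>1 y\<^sub>1 \<otimes> m_inv R (ec_dy E x\<^sub>1 y\<^sub>1)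
                   else (y\<^sub>2 \<ominus> y\<^sub>1) \<otimes> m_inv R (x\<^sub>2 \<ominus> x\<^sub>1));
              x\<^sub>3 = l [^] (2::nat) \<oplus> a\<^sub>1 E \<otimes> l \<ominus> a\<^sub>2 E \<ominus> x\<^sub>1 \<ominus> x\<^sub>2
          in ec_neg E (Affine x\<^sub>3 (y\<^sub>1 \<oplus> l \<otimes> (x\<^sub>3 \<ominus> x\<^sub>1)))))"

definition ns_group :: "'a wcurve \<Rightarrow> 'a ec_point monoid" where
  "ns_group E = \<lparr>carrier = {P \<in> ec_points E. nonsingular E P},
                 monoid.mult = ec_add E, one = Infinity\<rparr>"

text \<open>The order of an element of infinite order is set to 0.\<close>

definition ns_order :: "'a wcurve \<Rightarrow> 'a ec_point \<Rightarrow> nat" where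
  "ns_order E P =
     (if \<exists>n::nat. n > 0 \<and> P [^]\<^bsub>ns_group E\<^esub> n = \<one>\<^bsub>ns_group E\<^esub>
      then LEAST n::nat. n > 0 \<and> P [^]\<^bsub>ns_group E\<^esub> n = \<one>\<^bsub>ns_group E\<^esub> else 0)"

end


section \<open>Reduction modulo a prime\<close>

text \<open>Meant for p-integral arguments only: the denominator is then invertible.\<close>

definition reduce :: "nat \<Rightarrow> rat \<Rightarrow> int" where
  "reduce p x =
     (let R = residue_ring (int p); (r, s) = quotient_of x
      in (r mod int p) \<otimes>\<^bsub>R\<^esub> m_inv R (s mod int p))"

text \<open>If \<open>(x, y)\<close> lies on a Weierstrass curve with p-integral coefficients and \<open>x\<close> and \<open>y\<close> are not
  both p-integral, then \<open>y\<close> has smaller valuation than \<open>x\<close> and 1, so that the projective point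
  \<open>[x : y : 1]\<close> reduces to \<open>[0 : 1 : 0]\<close>.\<close>

definition reduce_point :: "nat \<Rightarrow> rat ec_point \<Rightarrow> int ec_point" where
  "reduce_point p P =
     (if \<forall>x\<in>set_ec_point P. pval p x \<ge> 0 then map_ec_point (reduce p) P else Infinity)"


section \<open>Weierstrass functions and uniformization\<close>

definition complex_lattice :: "complex set \<Rightarrow> bool" where
  "complex_lattice L \<longleftrightarrow>
     (\<exists>\<omega>\<^sub>1 \<omega>\<^sub>2. \<omega>\<^sub>1 \<noteq> 0 \<and> \<omega>\<^sub>2 / \<omega>\<^sub>1 \<notin> \<real> \<and>
        L = {of_int m * \<omega>\<^sub>1 + of_int n * \<omega>\<^sub>2 | m n. True})"

text \<open>The product is absolutely convergent for a lattice \<open>L\<close>, so the enumeration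
  \<^const>\<open>from_nat_into\<close> of the nonzero periods is immaterial.\<close>

definition wsigma :: "complex set \<Rightarrow> complex \<Rightarrow> complex" where
  "wsigma L z = z * (\<Prod>k. weierstrass_factor 2 (z / from_nat_into (L - {0}) k))"

definition wp :: "complex set \<Rightarrow> complex \<Rightarrow> complex" where
  "wp L z = 1 / z\<^sup>2 + (\<Sum>\<^sub>\<infinity>\<omega>\<in>L - {0}. 1 / (z - \<omega>)\<^sup>2 - 1 / \<omega>\<^sup>2)"

text \<open>The inverse of the change of variables \<open>X = x + b\<^sub>2 / 12\<close>, \<open>Y = 2 y + a\<^sub>1 x + a\<^sub>3\<close>,
  which brings the curve to the form \<open>Y\<^sup>2 = 4 X\<^sup>3 - g\<^sub>2 X - g\<^sub>3\<close>.\<close>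

definition unif_map :: "complex set \<Rightarrow> complex wcurve \<Rightarrow> complex \<Rightarrow> complex ec_point" where
  "unif_map L E z =
     (if z \<in> L then Infinity
      else let x = wp L z - b\<^sub>2 E / 12; y = (deriv (wp L) z - a\<^sub>1 E * x - a\<^sub>3 E) / 2
           in Affine x y)"

text \<open>\<^const>\<open>unif_map\<close> induces a group isomorphism from the quotient by \<open>L\<close> onto the curve. As the
  coordinates are given by the Weierstrass functions of \<open>L\<close> itself, \<open>L\<close> is the period lattice of
  \<open>dx / (2 y + a\<^sub>1 x + a\<^sub>3)\<close>; this normalization matters because sigma scales with \<open>L\<close>.\<close>

definition uniformizes :: "complex set \<Rightarrow> complex wcurve \<Rightarrow> bool" where
  "uniformizes L E \<longleftrightarrow>
     complex_lattice L \<and>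
     range (unif_map L E) = ec_points ring_of_type_algebra E \<and>
     (\<forall>z w. unif_map L E z = unif_map L E w \<longleftrightarrow> z - w \<in> L) \<and>
     (\<forall>z w. unif_map L E (z + w) =
              ec_add ring_of_type_algebra E (unif_map L E z) (unif_map L E w))"

definition trans_div_poly :: "complex set \<Rightarrow> complex \<Rightarrow> complex \<Rightarrow> int \<Rightarrow> complex" where
  "trans_div_poly L z\<^sub>1 z\<^sub>2 n =
     wsigma L (of_int n * z\<^sub>1 + z\<^sub>2) /
     (wsigma L z\<^sub>1 powi (n\<^sup>2 - n) * wsigma L (z\<^sub>1 + z\<^sub>2) powi n * wsigma L z\<^sub>2 powi (1 - n))"

definition somos_associated ::
    "(nat \<Rightarrow> rat) \<Rightarrow> rat wcurve \<Rightarrow> rat ec_point \<Rightarrow> rat ec_point \<Rightarrow> bool" where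
  "somos_associated W E P\<^sub>1 P\<^sub>2 \<longleftrightarrow>
     (\<exists>L z\<^sub>1 z\<^sub>2.
        uniformizes L (map_wcurve of_rat E) \<and>
        unif_map L (map_wcurve of_rat E) z\<^sub>1 = map_ec_point of_rat P\<^sub>1 \<and>
        unif_map L (map_wcurve of_rat E) z\<^sub>2 = map_ec_point of_rat P\<^sub>2 \<and>
        (\<forall>n\<ge>1. of_rat (W n) =
                 of_rat (W 1 / W 0) ^ n * of_rat (W 0) * trans_div_poly L z\<^sub>1 z\<^sub>2 (int n)))"

end

theory Submission
  imports Defs
begin

text \<open>
The identity \<open>\<sigma>(a+b) \<sigma>(a-b) = \<sigma>(a)\<^sup>2 \<sigma>(b)\<^sup>2 (\<wp>(b) - \<wp>(a))\<close> follows from the differential equation and the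
addition law of \<open>\<wp>\<close>, both part of the uniformization: the logarithmic derivative in \<open>a\<close> of the
quotient of the two sides is constant and odd, hence zero. It makes \<open>A(n) = \<Psi>\<^sub>n(P)\<close> and
\<open>B(n) = \<sigma>(n z\<^sub>1) / \<sigma>(z\<^sub>1)\<close> to the power \<open>n\<^sup>2\<close> an elliptic net. The hypotheses at \<open>p\<close> say that the
initial values are \<open>p\<close>-integral and that \<open>B(2)\<close>, \<open>B(3)\<close>, \<open>A(-1)\<close> are units; then all values are
\<open>p\<close>-integral, and among four consecutive ones at most one is divisible by \<open>p\<close>.

If \<open>p\<^sup>k\<close> divides \<open>B(R)\<close>, the net relations yield Ward's symmetry \<open>A(n+R) \<equiv> c d\<^sup>n A(n)\<close> modulo \<open>p\<^sup>k\<close>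
with units \<open>c, d\<close>. As \<open>p\<close> divides some \<open>B(r)\<close>, and \<open>p\<^sup>k | B(R)\<close> implies \<open>p\<close> to the power \<open>k + 1\<close> divides
\<open>B(pR)\<close>, it follows that \<open>A\<close> is periodic modulo every \<open>p\<^sup>k\<close>, with a period whose part prime to \<open>p\<close>
divides a fixed \<open>S\<close>. The same holds eventually for \<open>W(n) = \<alpha>\<^sup>n \<beta> A(n)\<close>. If \<open>q\<close> is a power of \<open>p\<close> with
\<open>q \<equiv> 1\<close> modulo \<open>S\<close>, then \<open>m q\<close> to the power \<open>i + 1\<close> and \<open>m q\<^sup>i\<close> eventually differ by a multiple of that period.
\<close>

section \<open>The rationals integral at a prime\<close>

text \<open>Congruences modulo p^k can be cancelled only at indices where A is a unit, and p may
  divide values of A. This decides the form of \<open>net_relation\<close>: besides the Somos type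
  relation it keeps two relations whose right side carries the factor B(R), one comparing
  neighbouring indices and one comparing indices two apart, so that a non-unit can be jumped over.

  The passage from B(R) to B(pR) is made without formal groups. If p^k divides B(R) exactly, then
  modulo p the quotients B(lR)/B(R) are l s^(l^2 - 1) for l up to p, that is, the integers twisted
  by a quadratic exponential, and l = p gives zero.

  The sigma values are complex numbers. They turn out rational because a net is determined by a few
  initial values, and these are polynomials in the coordinates of P1, P2, 2 P1, P1 + P2 and P2 - P1.
  The same expressions translate the hypotheses on reduction into integrality and units. Periodicity
  of W is only eventual because p may divide W(1)/W(0).\<close>

locale local_ints =
  fixes p :: nat
  assumes prime_p: "prime p"
begin

text \<open>This is the localization of the integers at p, kept as a subset of \<open>rat\<close> so
  that division by a unit is ordinary division. Only the final limits leave the rationals.\<close>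

definition ints :: "rat set" where
  "ints = {x. \<exists>a b. \<not> int p dvd b \<and> x = of_int a / of_int b}"

definition punit :: "rat \<Rightarrow> bool" where
  "punit x \<longleftrightarrow> x \<noteq> 0 \<and> x \<in> ints \<and> inverse x \<in> ints"

definition multiples :: "nat \<Rightarrow> rat set" where
  "multiples k = {x. x / of_nat p ^ k \<in> ints}"

definition pcong :: "nat \<Rightarrow> rat \<Rightarrow> rat \<Rightarrow> bool" where
  "pcong k x y \<longleftrightarrow> x - y \<in> multiples k"

lemma prime_int_p: "prime (int p)"
  using prime_p by simp

lemma p_pos: "(of_nat p :: rat) \<noteq> 0" "p > 0" "p > 1"
  using prime_gt_0_nat[OF prime_p] prime_gt_1_nat[OF prime_p] by simp_all

lemma intsI: "\<not> int p dvd b \<Longrightarrow> of_int a / of_int b \<in> ints"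
  by (auto simp: ints_def)

lemma intsE:
  assumes "x \<in> ints" obtains a b where "\<not> int p dvd b" "b \<noteq> 0" "x = of_int a / of_int b"
  using assms by (auto simp: ints_def)

lemma ints_of_int [simp]: "of_int a \<in> ints"
  using intsI[of 1 a] p_pos by auto

lemma ints_of_nat [simp]: "of_nat a \<in> ints"
  using ints_of_int[of "int a"] by simp

lemma ints_0 [simp]: "0 \<in> ints" and ints_1 [simp]: "1 \<in> ints"
  and ints_numeral [simp]: "numeral w \<in> ints"
  using ints_of_int[of 0] ints_of_int[of 1] ints_of_int[of "numeral w"] by simp_all

lemma ints_add [simp]:
  assumes "x \<in> ints" "y \<in> ints" shows "x + y \<in> ints"
proof -
  from assms obtain a b c d where "\<not> int p dvd b" "b \<noteq> 0" "x = of_int a / of_int b"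
    "\<not> int p dvd d" "d \<noteq> 0" "y = of_int c / of_int d"
    by (metis intsE)
  moreover from this have "x + y = of_int (a * d + c * b) / of_int (b * d)"
    by (simp add: field_simps)
  moreover have "\<not> int p dvd b * d"
    using calculation prime_int_p by (simp add: prime_dvd_mult_iff)
  ultimately show ?thesis by (metis intsI)
qed

lemma ints_mult [simp]:
  assumes "x \<in> ints" "y \<in> ints" shows "x * y \<in> ints"
proof -
  from assms obtain a b c d where "\<not> int p dvd b" "b \<noteq> 0" "x = of_int a / of_int b"
    "\<not> int p dvd d" "d \<noteq> 0" "y = of_int c / of_int d"
    by (metis intsE)
  moreover from this have "x * y = of_int (a * c) / of_int (b * d)"
    by (simp add: field_simps)
  moreover have "\<not> int p dvd b * d"
    using calculation prime_int_p by (simp add: prime_dvd_mult_iff)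
  ultimately show ?thesis by (metis intsI)
qed

lemma ints_uminus [simp]: "x \<in> ints \<Longrightarrow> - x \<in> ints"
  using ints_mult[of "of_int (-1)" x] ints_of_int by fastforce

lemma ints_diff [simp]: "x \<in> ints \<Longrightarrow> y \<in> ints \<Longrightarrow> x - y \<in> ints"
  using ints_add[of x "-y"] by simp

lemma ints_power [simp]: "x \<in> ints \<Longrightarrow> x ^ n \<in> ints"
  by (induction n) auto

lemma ints_dvd_num:
  assumes "\<not> int p dvd b" "b \<noteq> 0" shows "of_int a / of_int b \<in> multiples 1 \<longleftrightarrow> int p dvd a"
proof
  assume "int p dvd a"
  then obtain c where "a = int p * c" ..
  with p_pos have "of_int a / of_int b / of_nat p = (of_int c / of_int b :: rat)"
    by (simp add: field_simps)
  with assms show "of_int a / of_int b \<in> multiples 1"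
    by (simp add: multiples_def intsI)
next
  assume "of_int a / of_int b \<in> multiples 1"
  then obtain c d where cd: "\<not> int p dvd d" "d \<noteq> 0" "of_int a / of_int b / of_nat p = (of_int c / of_int d :: rat)"
    by (auto simp: multiples_def elim: intsE)
  have "(of_int (a * d) :: rat) = of_int (int p * c * b)"
    using assms cd p_pos by (simp add: field_simps)
  then have "a * d = int p * c * b"
    by (simp only: of_int_eq_iff)
  then have "int p dvd a * d" by simp
  with cd show "int p dvd a"
    using prime_int_p by (simp add: prime_dvd_mult_iff)
qed

text \<open>The ring is local with maximal ideal generated by p: the numerator of a fraction with
  denominator prime to p decides.\<close>

lemma punit_iff:
  assumes "x \<in> ints" shows "punit x \<longleftrightarrow> x \<notin> multiples 1"
proof -
  obtain a b where ab: "\<not> int p dvd b" "b \<noteq> 0" "x = of_int a / of_int b"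
    using assms by (elim intsE)
  show ?thesis
  proof
    assume "punit x"
    then obtain c d where cd: "\<not> int p dvd d" "d \<noteq> 0" "inverse x = of_int c / of_int d" "x \<noteq> 0"
      by (auto simp: punit_def elim: intsE)
    have "(of_int (b * d) :: rat) = of_int (a * c)"
      using ab cd by (simp add: field_simps)
    then have "b * d = a * c" by (simp only: of_int_eq_iff)
    with ab cd prime_int_p have "\<not> int p dvd a" by (metis dvd_mult2 prime_dvd_mult_iff)
    with ab show "x \<notin> multiples 1" using ints_dvd_num by simp
  next
    assume "x \<notin> multiples 1"
    with ab have "\<not> int p dvd a" using ints_dvd_num by simp
    with ab assms show "punit x"
      by (auto simp: punit_def intro!: intsI)
  qed
qed

lemma punit_ints: "punit x \<Longrightarrow> x \<in> ints"
  by (simp add: punit_def)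

lemma punit_nonzero: "punit x \<Longrightarrow> x \<noteq> 0"
  by (simp add: punit_def)

lemma punit_1 [simp]: "punit 1"
  by (simp add: punit_def)

lemma punit_mult [simp]: "punit x \<Longrightarrow> punit y \<Longrightarrow> punit (x * y)"
  by (simp add: punit_def)

lemma punit_inverse [simp]: "punit x \<Longrightarrow> punit (inverse x)"
  by (simp add: punit_def)

lemma punit_divide [simp]: "punit x \<Longrightarrow> punit y \<Longrightarrow> punit (x / y)"
  by (simp add: divide_inverse)

lemma punit_minus [simp]: "punit (- x) \<longleftrightarrow> punit x"
  unfolding punit_def using ints_uminus[of x] ints_uminus[of "- x"]
    ints_uminus[of "inverse x"] ints_uminus[of "- inverse x"] by auto

lemma punit_power [simp]: "punit x \<Longrightarrow> punit (x ^ n)"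
  by (induction n) auto

lemma punit_prod: "(\<And>i. i \<in> S \<Longrightarrow> punit (f i)) \<Longrightarrow> punit (\<Prod>i\<in>S. f i)"
  by (induction S rule: infinite_finite_induct) auto

lemma ints_divide: "x \<in> ints \<Longrightarrow> punit y \<Longrightarrow> x / y \<in> ints"
  by (simp add: divide_inverse punit_def)

lemma ints_cancel: "punit u \<Longrightarrow> u * x \<in> ints \<Longrightarrow> x \<in> ints"
  using ints_divide[of "u * x" u] by (simp add: punit_nonzero)

lemma multiples_0 [simp]: "multiples 0 = ints"
  by (simp add: multiples_def)

lemma zero_multiples [simp]: "0 \<in> multiples k"
  by (simp add: multiples_def)

lemma multiples_add: "x \<in> multiples k \<Longrightarrow> y \<in> multiples k \<Longrightarrow> x + y \<in> multiples k"
  by (simp add: multiples_def add_divide_distrib)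

lemma multiples_uminus: "x \<in> multiples k \<Longrightarrow> - x \<in> multiples k"
  by (simp add: multiples_def flip: minus_divide_left)

lemma multiples_mult: "x \<in> ints \<Longrightarrow> y \<in> multiples k \<Longrightarrow> x * y \<in> multiples k"
  unfolding multiples_def using ints_mult[of x "y / of_nat p ^ k"] by simp

lemma multiples_mult': "x \<in> multiples k \<Longrightarrow> y \<in> ints \<Longrightarrow> x * y \<in> multiples k"
  using multiples_mult[of y x k] by (simp add: mult.commute)

lemma multiples_mult_add:
  "x \<in> multiples j \<Longrightarrow> y \<in> multiples k \<Longrightarrow> x * y \<in> multiples (j + k)"
  unfolding multiples_def
  using ints_mult[of "x / of_nat p ^ j" "y / of_nat p ^ k"] by (simp add: power_add)

lemma multiples_mono: "x \<in> multiples k \<Longrightarrow> j \<le> k \<Longrightarrow> x \<in> multiples j"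
proof -
  assume "x \<in> multiples k" "j \<le> k"
  then have "of_nat p ^ (k - j) * (x / of_nat p ^ k) \<in> ints"
    unfolding multiples_def by (intro ints_mult) auto
  moreover have "of_nat p ^ (k - j) * (x / of_nat p ^ k) = x / of_nat p ^ j"
    using \<open>j \<le> k\<close> p_pos by (simp add: field_simps flip: power_add)
  ultimately show ?thesis by (simp add: multiples_def)
qed

lemma multiples_ints: "x \<in> multiples k \<Longrightarrow> x \<in> ints"
  using multiples_mono[of x k 0] by simp

lemma multiples_cancel: "punit u \<Longrightarrow> u * x \<in> multiples k \<Longrightarrow> x \<in> multiples k"
  using multiples_mult[of "inverse u" "u * x" k] by (simp add: punit_def flip: mult.assoc)

lemma multiples_prime:
  assumes "x \<in> ints" "y \<in> ints" "x * y \<in> multiples 1"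
  shows "x \<in> multiples 1 \<or> y \<in> multiples 1"
  using assms multiples_cancel[of x y 1] punit_iff by blast

lemma multiples_p_power: "of_nat p ^ k \<in> multiples k"
  using p_pos by (simp add: multiples_def)

lemma pcong_refl [simp]: "pcong k x x"
  by (simp add: pcong_def)

lemma pcong_sym: "pcong k x y \<Longrightarrow> pcong k y x"
  unfolding pcong_def using multiples_uminus[of "x - y"] by simp

lemma pcong_trans [trans]: "pcong k x y \<Longrightarrow> pcong k y z \<Longrightarrow> pcong k x z"
  unfolding pcong_def using multiples_add[of "x - y" k "y - z"] by simp

lemma pcong_add: "pcong k x y \<Longrightarrow> pcong k x' y' \<Longrightarrow> pcong k (x + x') (y + y')"
  unfolding pcong_def using multiples_add[of "x - y" k "x' - y'"] by (simp add: algebra_simps)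

lemma pcong_uminus: "pcong k x y \<Longrightarrow> pcong k (- x) (- y)"
  unfolding pcong_def using multiples_uminus[of "x - y" k] by (simp add: algebra_simps)

lemma pcong_diff: "pcong k x y \<Longrightarrow> pcong k x' y' \<Longrightarrow> pcong k (x - x') (y - y')"
  using pcong_add[of k x y "-x'" "-y'"] pcong_uminus[of k x' y'] by simp

lemma pcong_ints: "pcong k x y \<Longrightarrow> x \<in> ints \<longleftrightarrow> y \<in> ints"
  unfolding pcong_def using multiples_ints ints_add[of "x - y" y] ints_diff[of x "x - y"] by auto

lemma pcong_mult:
  assumes "pcong k x y" "pcong k x' y'" "x \<in> ints" "y' \<in> ints"
  shows "pcong k (x * x') (y * y')"
proof -
  have "x * x' - y * y' = x * (x' - y') + (x - y) * y'"
    by (simp add: algebra_simps)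
  with assms show ?thesis
    unfolding pcong_def by (simp add: multiples_add multiples_mult multiples_mult')
qed

lemma pcong_mult_left: "pcong k x y \<Longrightarrow> z \<in> ints \<Longrightarrow> pcong k (z * x) (z * y)"
  unfolding pcong_def using multiples_mult[of z "x - y" k] by (simp add: algebra_simps)

lemma pcong_power: "pcong k x y \<Longrightarrow> x \<in> ints \<Longrightarrow> pcong k (x ^ n) (y ^ n)"
  by (induction n) (auto intro!: pcong_mult simp: pcong_ints)

lemma pcong_cancel:
  assumes "punit u" "pcong k (u * x) (u * y)" shows "pcong k x y"
  using assms multiples_cancel[of u "x - y" k] by (simp add: pcong_def algebra_simps)

lemma pcong_mono: "pcong k x y \<Longrightarrow> j \<le> k \<Longrightarrow> pcong j x y"
  unfolding pcong_def by (rule multiples_mono)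

lemma pcong_0_iff: "pcong k x 0 \<longleftrightarrow> x \<in> multiples k"
  by (simp add: pcong_def)

lemma pcong_multiples: "pcong k x y \<Longrightarrow> x \<in> multiples k \<longleftrightarrow> y \<in> multiples k"
  using pcong_0_iff pcong_sym pcong_trans by blast

lemma pcong_punit: "pcong k x y \<Longrightarrow> k > 0 \<Longrightarrow> punit x \<longleftrightarrow> punit y"
proof -
  assume *: "pcong k x y" "k > 0"
  then have "pcong 1 x y" by (auto intro: pcong_mono)
  then show ?thesis
    using punit_iff[of x] punit_iff[of y] pcong_multiples[of 1 x y] pcong_ints punit_ints
    by blast
qed

lemma pcong_of_int:
  assumes "[a = b] (mod int p ^ k)" shows "pcong k (of_int a) (of_int b)"
proof -
  from assms obtain c where "a - b = int p ^ k * c"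
    by (auto simp: cong_iff_dvd_diff)
  then have "of_int a - of_int b = (of_nat p ^ k * of_int c :: rat)"
    by (metis of_int_diff of_int_mult of_int_of_nat_eq of_int_power)
  then show ?thesis
    using multiples_mult'[OF multiples_p_power[of k], of "of_int c"] by (simp add: pcong_def)
qed

lemma of_int_multiples_iff: "of_int a \<in> multiples k \<longleftrightarrow> int p ^ k dvd a"
proof
  assume "of_int a \<in> multiples k"
  then obtain c d where cd: "\<not> int p dvd d" "d \<noteq> 0" "of_int a / of_nat p ^ k = (of_int c / of_int d :: rat)"
    by (auto simp: multiples_def elim: intsE)
  have "(of_int (a * d) :: rat) = of_int (int p ^ k * c)"
    using cd p_pos by (simp add: field_simps)
  then have "a * d = int p ^ k * c" by (simp only: of_int_eq_iff)
  then have "int p ^ k dvd a * d" by simp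
  moreover have "coprime (int p ^ k) d"
    using cd prime_int_p by (simp add: prime_imp_coprime)
  ultimately show "int p ^ k dvd a"
    using coprime_dvd_mult_left_iff by blast
next
  assume "int p ^ k dvd a"
  then have "[a = 0] (mod int p ^ k)" by (simp add: Cong.cong_0_iff)
  then have "pcong k (of_int a) (of_int 0)" by (rule pcong_of_int)
  then show "of_int a \<in> multiples k" by (simp add: pcong_0_iff)
qed

lemma of_int_pcong_iff: "pcong k (of_int a) (of_int b) \<longleftrightarrow> [a = b] (mod int p ^ k)"
  using of_int_multiples_iff[of "a - b" k] by (simp add: pcong_def cong_iff_dvd_diff)

lemma residue_exists:
  assumes "x \<in> ints"
  obtains a where "a \<in> {0..<int p ^ k}" "pcong k x (of_int a)"
proof -
  obtain c d where cd: "\<not> int p dvd d" "d \<noteq> 0" "x = of_int c / of_int d"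
    using assms by (elim intsE)
  have "coprime d (int p ^ k)"
    using cd prime_int_p by (metis coprime_commute coprime_power_left_iff prime_imp_coprime)
  then obtain e where e: "[d * e = 1] (mod int p ^ k)"
    using cong_solve_coprime_int by blast
  define a where "a = (c * e) mod int p ^ k"
  have "[d * a = c] (mod int p ^ k)"
  proof -
    have "[d * a = d * (c * e)] (mod int p ^ k)"
      by (auto simp: a_def Cong.cong_def mod_mult_right_eq)
    also have "d * (c * e) = c * (d * e)" by simp
    also have "[c * (d * e) = c * 1] (mod int p ^ k)"
      using e by (rule cong_scalar_left)
    finally show ?thesis by simp
  qed
  then have "pcong k (of_int (d * a)) (of_int c)"
    by (rule pcong_of_int)
  moreover have "of_int c = of_int d * x" using cd by simp
  ultimately have "pcong k (of_int d * of_int a) (of_int d * x)"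
    by simp
  moreover have "punit (of_int d)"
    using cd punit_iff[of "of_int d"] of_int_multiples_iff[of d 1] by simp
  ultimately have "pcong k x (of_int a)"
    using pcong_cancel pcong_sym by blast
  moreover have "a \<in> {0..<int p ^ k}"
    using p_pos by (simp add: a_def)
  ultimately show ?thesis using that by blast
qed

lemma punit_power_totient:
  assumes "punit x" shows "pcong k (x ^ totient (p ^ k)) 1"
\<comment> \<open>Modulo p^0 all integral elements are congruent, and a residue of a unit need not
  be prime to p, so Euler's theorem is applied for positive k only.\<close>
proof (cases "k = 0")
  case False
  obtain a where a: "a \<in> {0..<int p ^ k}" "pcong k x (of_int a)"
    using residue_exists punit_ints assms by blast
  then have "punit (of_int a)"
    using pcong_punit assms False by auto
  then have "\<not> int p dvd a"
    using punit_iff[of "of_int a"] of_int_multiples_iff[of a 1] by simp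
  then have "coprime (nat a) (p ^ k)"
    using a prime_p by (metis atLeastLessThan_iff coprime_commute coprime_power_left_iff int_dvd_int_iff
        int_nat_eq prime_imp_coprime)
  then have "[nat a ^ totient (p ^ k) = 1] (mod p ^ k)"
    by (rule euler_theorem)
  then have "[a ^ totient (p ^ k) = 1] (mod int p ^ k)"
    using a by (metis atLeastLessThan_iff cong_int_iff int_nat_eq of_nat_1 of_nat_power)
  then have "pcong k (of_int a ^ totient (p ^ k)) 1"
    using pcong_of_int by fastforce
  then show ?thesis
    using pcong_power[OF a(2), of "totient (p ^ k)"] assms punit_ints pcong_trans by blast
qed (auto simp: pcong_def punit_ints assms)

end

section \<open>Elliptic nets of rank one over a local ring\<close>

text \<open>All three are instances of Weierstrass's three-term relation for A(n) = sigma(n z + y)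
  and B(n) = sigma(n z), after a normalization with B(1) = 1. The first contains the Somos
  recurrence (m = 2) and the doubling formulas. Modulo a divisor of B(R) the other two compare the
  effect of the shift by R at n - 1 and n, respectively at n - 2 and n.\<close>

definition net_relation :: "(int \<Rightarrow> 'a::comm_ring_1) \<Rightarrow> (int \<Rightarrow> 'a) \<Rightarrow> bool" where
  "net_relation B A \<longleftrightarrow>
     (\<forall>n m. A (n + m) * A (n - m) = (B m)\<^sup>2 * A (n + 1) * A (n - 1) - B (m + 1) * B (m - 1) * (A n)\<^sup>2) \<and>
     (\<forall>n R. A (n + R) * A (n - 1) * B (R + 1) * B 2 - A (n - 1 + R) * A n * B (R + 2) =
              A (n + R + 1) * A (n - 2) * B R) \<and>
     (\<forall>n R. A (n + R) * A (n - 2) * B (R + 1) * B 3 - A (n - 2 + R) * A n * B (R + 3) =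
              A (n + R + 1) * A (n - 3) * B 2 * B R)"

lemma net_relationD:
  assumes "net_relation B A"
  shows "A (n + m) * A (n - m) = (B m)\<^sup>2 * A (n + 1) * A (n - 1) - B (m + 1) * B (m - 1) * (A n)\<^sup>2"
    and "A (n + R) * A (n - 1) * B (R + 1) * B 2 - A (n - 1 + R) * A n * B (R + 2) =
           A (n + R + 1) * A (n - 2) * B R"
    and "A (n + R) * A (n - 2) * B (R + 1) * B 3 - A (n - 2 + R) * A n * B (R + 3) =
           A (n + R + 1) * A (n - 3) * B 2 * B R"
  using assms unfolding net_relation_def by blast+

context local_ints
begin

definition apart :: "(int \<Rightarrow> rat) \<Rightarrow> int \<Rightarrow> bool" where
  "apart A n \<longleftrightarrow> (\<forall>i\<in>{n..n+3}. \<forall>j\<in>{n..n+3}. i \<noteq> j \<longrightarrow> A i \<notin> multiples 1 \<or> A j \<notin> multiples 1)"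

text \<open>If p divides the new value A(n+4), the relation says that p divides A(n+3) A(n+1) if and
  only if it divides A(n+2). The old window excludes that p divides A(n+2) together with one of its
  neighbours, so p divides none of the three.\<close>

lemma apart_step:
  assumes "\<And>i. i \<in> {n..n+4} \<Longrightarrow> A i \<in> ints" "punit u" "punit v"
    and "A (n + 4) * A n = u * A (n + 3) * A (n + 1) - v * (A (n + 2))\<^sup>2" "apart A n"
  shows "apart A (n + 1)"
proof -
  have ints: "A n \<in> ints" "A (n + 1) \<in> ints" "A (n + 2) \<in> ints" "A (n + 3) \<in> ints" "A (n + 4) \<in> ints"
    using assms(1) by auto
  have uv: "u \<in> ints" "v \<in> ints" using assms(2,3) by (simp_all add: punit_ints)
  have pair: "A i \<notin> multiples 1 \<or> A j \<notin> multiples 1" if "i \<in> {n..n+3}" "j \<in> {n..n+3}" "i \<noteq> j" for i j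
    using assms(5) that unfolding apart_def by blast
  have new: "A (n + j) \<notin> multiples 1" if "A (n + 4) \<in> multiples 1" "j \<in> {1,2,3}" for j
  proof -
    have "A (n + 4) * A n \<in> multiples 1"
      using that ints multiples_mult' by blast
    then have eq: "u * (A (n + 3) * A (n + 1)) - v * (A (n + 2) * A (n + 2)) \<in> multiples 1"
      using assms(4) by (simp add: power2_eq_square mult.assoc)
    have *: "A (n + 3) * A (n + 1) \<in> multiples 1 \<longleftrightarrow> A (n + 2) * A (n + 2) \<in> multiples 1"
    proof
      assume "A (n + 3) * A (n + 1) \<in> multiples 1"
      then have "u * (A (n + 3) * A (n + 1)) \<in> multiples 1" using uv multiples_mult by blast
      from multiples_add[OF this multiples_uminus[OF eq]]
      have "v * (A (n + 2) * A (n + 2)) \<in> multiples 1" by simp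
      then show "A (n + 2) * A (n + 2) \<in> multiples 1" using multiples_cancel assms(3) by blast
    next
      assume "A (n + 2) * A (n + 2) \<in> multiples 1"
      then have "v * (A (n + 2) * A (n + 2)) \<in> multiples 1" using uv multiples_mult by blast
      from multiples_add[OF eq this]
      have "u * (A (n + 3) * A (n + 1)) \<in> multiples 1" by simp
      then show "A (n + 3) * A (n + 1) \<in> multiples 1" using multiples_cancel assms(2) by blast
    qed
    have "A (n + 3) \<in> multiples 1 \<or> A (n + 1) \<in> multiples 1 \<longleftrightarrow> A (n + 2) \<in> multiples 1"
      using * multiples_prime ints multiples_mult multiples_mult' by blast
    with that pair[of "n+2" "n+3"] pair[of "n+2" "n+1"] show ?thesis by auto
  qed
  show ?thesis
    unfolding apart_def
  proof (intro ballI impI)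
    fix i j assume ij: "i \<in> {n + 1..n + 1 + 3}" "j \<in> {n + 1..n + 1 + 3}" "i \<noteq> j"
    consider "i = n + 4" | "j = n + 4" | "i \<in> {n..n+3}" "j \<in> {n..n+3}"
      using ij by force
    then show "A i \<notin> multiples 1 \<or> A j \<notin> multiples 1"
    proof cases
      case 1
      then have "j - n \<in> {1,2,3}" using ij by auto
      with new[of "j - n"] 1 show ?thesis by auto
    next
      case 2
      then have "i - n \<in> {1,2,3}" using ij by auto
      with new[of "i - n"] 2 show ?thesis by auto
    qed (use pair ij in blast)
  qed
qed

lemma apart_all:
  assumes "\<And>i. i \<ge> n0 \<Longrightarrow> A i \<in> ints" "punit u" "punit v"
    and "\<And>n. n \<ge> n0 \<Longrightarrow> A (n + 4) * A n = u * A (n + 3) * A (n + 1) - v * (A (n + 2))\<^sup>2"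
    and "apart A n0" "n \<ge> n0"
  shows "apart A n"
  using \<open>n \<ge> n0\<close>
proof (induction n rule: int_ge_induct)
  case (step n)
  then show ?case using apart_step[of n A u v] assms by auto
qed (fact assms)

lemma apartD:
  assumes "apart A n" "i \<in> {n..n+3}" "j \<in> {n..n+3}" "i \<noteq> j" "A i \<in> ints" "A j \<in> ints"
  shows "punit (A i) \<or> punit (A j)"
  using assms unfolding apart_def by (metis punit_iff)

text \<open>Modulo p^k the terms with the factor B(R) drop out, and the ratio of A(n+R) to A(n)
  gains a factor d per step of length one and d^2 per step of length two. A step cancels the value
  of A at its starting index only. Integrality is required from n0 - 1 on because the terms that
  drop out still contain A(n-2) and A(n-3).\<close>

lemma ward_symmetry:
  assumes net: "net_relation B A" "net_relation B B"
    and B: "\<And>i. B i \<in> ints" "punit (B 2)" "punit (B 3)" "B 1 = 1"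
    and R: "B R \<in> multiples k" "punit (B (R + 1))" "punit (B (R + 2))" "R \<ge> 0"
    and A: "\<And>i. i \<ge> n0 - 1 \<Longrightarrow> A i \<in> ints" "punit (A n0)"
      "\<And>i. i \<ge> n0 \<Longrightarrow> punit (A i) \<or> punit (A (i + 1))"
  shows "pcong k (A (n0 + int j + R)) (A (n0 + R) / A n0 * (B (R + 2) / (B 2 * B (R + 1))) ^ j * A (n0 + int j))"
proof -
  define d where "d = B (R + 2) / (B 2 * B (R + 1))"
  define e where "e = A (n0 + R) / A n0"
  define P where "P n \<longleftrightarrow> pcong k (A (n + R)) (e * d ^ nat (n - n0) * A n)" for n
  have ud: "punit d" unfolding d_def using B R by auto
  have e: "e \<in> ints" unfolding e_def using A R by (intro ints_divide) auto
  have uBR: "punit (B 2 * B (R + 1))" using B R by auto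
  have d1: "B (R + 2) = B 2 * B (R + 1) * d"
    unfolding d_def using punit_nonzero[OF uBR] by simp
  have nz: "A n0 \<noteq> 0" using A punit_nonzero by blast
  \<comment> \<open>The net relation of B with itself at n = 3 identifies the coefficient B(R+3) of
    the two-step relation, so that its factor is the square of the one-step factor.\<close>
  have d2: "pcong k (B (R + 3)) (d\<^sup>2 * B (R + 1) * B 3)"
  proof -
    have "pcong k (B (3 + R) * B (3 - 1) * B (R + 1) * B 2) (B (3 - 1 + R) * B 3 * B (R + 2))"
      unfolding pcong_def net_relationD(2)[OF net(2), of 3 R]
      using B R by (intro multiples_mult) auto
    then have "pcong k ((B 2 * B 2 * B (R + 1)) * B (R + 3)) ((B 2 * B 2 * B (R + 1)) * (d\<^sup>2 * B (R + 1) * B 3))"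
      by (simp add: add.commute d1 power2_eq_square mult_ac)
    then show ?thesis using pcong_cancel B R by (metis punit_mult)
  qed
  have N2: "pcong k (A (n + R) * A (n - 1)) (d * A (n - 1 + R) * A n)" if "n > n0" for n
  proof -
    have "pcong k (A (n + R) * A (n - 1) * B (R + 1) * B 2) (A (n - 1 + R) * A n * B (R + 2))"
      unfolding pcong_def net_relationD(2)[OF net(1), of n R]
      using A R that by (intro multiples_mult) auto
    then have "pcong k ((B 2 * B (R + 1)) * (A (n + R) * A (n - 1))) ((B 2 * B (R + 1)) * (d * A (n - 1 + R) * A n))"
      by (simp add: add.commute d1 power2_eq_square mult_ac)
    then show ?thesis using pcong_cancel uBR by blast
  qed
  have N3: "pcong k (A (n + R) * A (n - 2)) (d\<^sup>2 * A (n - 2 + R) * A n)" if "n > n0 + 1" for n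
  proof -
    have "pcong k (A (n + R) * A (n - 2) * B (R + 1) * B 3) (A (n - 2 + R) * A n * B (R + 3))"
      unfolding pcong_def net_relationD(3)[OF net(1), of n R]
      using A R B that by (intro multiples_mult ints_mult) auto
    also have "pcong k \<dots> (A (n - 2 + R) * A n * (d\<^sup>2 * B (R + 1) * B 3))"
      using A R that by (intro pcong_mult_left[OF d2] ints_mult) auto
    finally have "pcong k ((B 3 * B (R + 1)) * (A (n + R) * A (n - 2))) ((B 3 * B (R + 1)) * (d\<^sup>2 * A (n - 2 + R) * A n))"
      by (simp add: add.commute d1 power2_eq_square mult_ac)
    then show ?thesis using pcong_cancel B R by (metis punit_mult)
  qed
  have step1: "P (n + 1)" if "P n" "punit (A n)" "n \<ge> n0" for n
  proof -
    have "pcong k (A n * A (n + 1 + R)) (d * A (n + R) * A (n + 1))"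
      using N2[of "n + 1"] that by (simp add: mult_ac)
    also have "pcong k (d * A (n + R) * A (n + 1)) (d * (e * d ^ nat (n - n0) * A n) * A (n + 1))"
      using that A R ud e punit_ints unfolding P_def
      by (intro pcong_mult pcong_mult_left pcong_refl ints_mult) auto
    also have "\<dots> = A n * (e * d ^ nat (n + 1 - n0) * A (n + 1))"
      using that nat_add_distrib[of "n - n0" 1] by (simp add: algebra_simps)
    finally show ?thesis unfolding P_def using pcong_cancel that by blast
  qed
  have step2: "P (n + 2)" if "P n" "punit (A n)" "n \<ge> n0" for n
  proof -
    have "pcong k (A n * A (n + 2 + R)) (d\<^sup>2 * A (n + R) * A (n + 2))"
      using N3[of "n + 2"] that by (simp add: mult_ac)
    also have "pcong k (d\<^sup>2 * A (n + R) * A (n + 2)) (d\<^sup>2 * (e * d ^ nat (n - n0) * A n) * A (n + 2))"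
      using that A R ud e punit_ints unfolding P_def
      by (intro pcong_mult pcong_mult_left pcong_refl ints_mult ints_power) auto
    also have "\<dots> = A n * (e * d ^ nat (n + 2 - n0) * A (n + 2))"
      using that nat_add_distrib[of "n - n0" 2] by (simp add: algebra_simps power2_eq_square)
    finally show ?thesis unfolding P_def using pcong_cancel that by blast
  qed
  have P0: "P n0" unfolding P_def e_def using nz by simp
  \<comment> \<open>Two consecutive indices are carried along: one of A(n), A(n+1) is a unit, and
    from either of them one step leads to n + 2.\<close>
  have "P n \<and> P (n + 1)" if "n \<ge> n0" for n
    using that
  proof (induction n rule: int_ge_induct)
    case base
    show ?case using P0 step1 A by simp
  next
    case (step n)
    then have "P (n + 1 + 1)"
      using step1[of "n + 1"] step2[of n] A(3)[of n] by (auto simp: add.assoc)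
    with step show ?case by simp
  qed
  from this[of "n0 + int j"] show ?thesis
    by (simp add: P_def d_def e_def)
qed

end

section \<open>Elliptic divisibility sequences at p: units, zeros modulo p, and their
  lifting\<close>

locale elliptic_divisibility = local_ints +
  fixes B :: "int \<Rightarrow> rat"
  assumes net_B: "net_relation B B"
    and B_minus: "B (- n) = - B n"
    and B_1: "B 1 = 1"
    and B_2: "punit (B 2)"
    and B_3: "punit (B 3)"
    and B_4: "B 4 \<in> ints"
begin

lemma B_0: "B 0 = 0"
  using B_minus[of 0] by simp

text \<open>The doubling formulas reach up to index h + 2, which is below 2 h only for h at least 3;
  this makes B(4) an initial value. The even formula divides by B(2), a unit.\<close>

lemma B_ints: "B n \<in> ints"
proof -
  have nat: "B (int n) \<in> ints" for n
  proof (induction n rule: less_induct)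
    case (less n)
    have IH: "B i \<in> ints" if "0 \<le> i" "i < int n" for i
      using less[of "nat i"] that by auto
    consider "n \<le> 4" | h where "n = 2 * h" "h \<ge> 3" | h where "n = 2 * h + 1" "h \<ge> 2"
    proof (cases "n \<le> 4")
      case False
      then show thesis using that(2)[of "n div 2"] that(3)[of "n div 2"]
        by (cases "even n") (auto elim!: evenE oddE)
    qed
    then show ?case
    proof cases
      case 1
      then have "n \<in> {0, 1, 2, 3, 4}" by auto
      then show ?thesis using B_0 B_1 B_2 B_3 B_4 punit_ints by auto
    next
      case (2 h)
      have "B 2 * B (int n) = (B (int h - 1))\<^sup>2 * B (int h + 2) * B (int h) - B (int h) * B (int h - 2) * (B (int h + 1))\<^sup>2"
        using net_relationD(1)[OF net_B, of "int h + 1" "int h - 1"] 2 by (simp add: algebra_simps)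
      also have "\<dots> \<in> ints"
        using 2 by (intro ints_diff ints_mult ints_power IH) auto
      finally show ?thesis using ints_cancel B_2 by blast
    next
      case (3 h)
      have "B (int n) = (B (int h))\<^sup>2 * B (int h + 2) * B (int h) - B (int h + 1) * B (int h - 1) * (B (int h + 1))\<^sup>2"
        using net_relationD(1)[OF net_B, of "int h + 1" "int h"] 3 B_1 by (simp add: algebra_simps)
      also have "\<dots> \<in> ints"
        using 3 by (intro ints_diff ints_mult ints_power IH) auto
      finally show ?thesis .
    qed
  qed
  show ?thesis
    using nat[of "nat n"] nat[of "nat (- n)"] B_minus[of n] ints_uminus by (cases "n \<ge> 0") fastforce+
qed

lemma net_step:
  assumes "net_relation B A"
  shows "A (n + 4) * A n = (B 2)\<^sup>2 * A (n + 3) * A (n + 1) - B 3 * (A (n + 2))\<^sup>2"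
  using net_relationD(1)[OF assms, of "n + 2" 2] B_1 by (simp add: algebra_simps)

lemma apart_B: "n \<ge> 1 \<Longrightarrow> apart B n"
proof (rule apart_all[of 1 B "(B 2)\<^sup>2" "B 3"])
  have "{1..1+3} = {1, 2, 3, 4::int}" by auto
  then show "apart B 1"
    unfolding apart_def using B_1 B_2 B_3 punit_1 B_ints punit_iff[of "B 1"] punit_iff[of "B 2"]
      punit_iff[of "B 3"] by auto
qed (use net_step[OF net_B] B_ints B_2 B_3 in auto)

text \<open>Since B(1), B(2) and B(3) are units, R is at least 4, and the windows starting at R - 1
  and R - 2 still lie in the positive range covered by \<open>apart_B\<close>.\<close>

lemma punit_B_near:
  assumes "B R \<in> multiples 1" "R \<ge> 1" "i \<in> {1, 2}"
  shows "punit (B (R + i))" "punit (B (R - i))"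
proof -
  have R: "\<not> punit (B R)" using assms punit_iff B_ints by blast
  then have "R \<noteq> 1" "R \<noteq> 2" "R \<noteq> 3" using B_1 B_2 B_3 by auto
  then have "R \<ge> 4" using assms by auto
  then show "punit (B (R + i))" "punit (B (R - i))"
    using apartD[OF apart_B[of R], of R "R + i"] apartD[OF apart_B[of "R - i"], of R "R - i"]
      R assms B_ints by auto
qed

lemma punit_B_consec: "punit (B n) \<or> punit (B (n + 1))"
proof -
  have pos: "punit (B n) \<or> punit (B (n + 1))" if "n \<ge> 1" for n
    using apartD[OF apart_B[OF that], of n "n + 1"] B_ints by auto
  consider "n \<ge> 1" | "n = 0" | "n = -1" | "n \<le> -2" by linarith
  then show ?thesis
    using pos[of n] pos[of "- (n + 1)"] B_minus[of n] B_minus[of "n + 1"] B_minus[of 1] B_1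
    by cases auto
qed

text \<open>Pigeonhole on four consecutive residues modulo p. If no B(n) with positive n vanished
  modulo p, a repetition could be traced back to the index 0, where B vanishes.\<close>

lemma zero_exists: obtains r where "r \<ge> 1" "B r \<in> multiples 1"
proof (rule ccontr)
  note ex = that
  assume neg: "\<not> thesis"
  then have unit: "punit (B n)" if "n \<ge> 1" for n
    using that punit_iff B_ints ex neg by blast
  define res where "res x = (SOME a. a \<in> {0..<int p ^ 1} \<and> pcong 1 x (of_int a))" for x
  have res: "res x \<in> {0..<int p ^ 1} \<and> pcong 1 x (of_int (res x))" if "x \<in> ints" for x
    unfolding res_def by (rule someI_ex) (use residue_exists[OF that] in blast)
  define f where "f n = (res (B (int n)), res (B (int n + 1)), res (B (int n + 2)), res (B (int n + 3)))" for n
  have "range f \<subseteq> {0..<int p ^ 1} \<times> {0..<int p ^ 1} \<times> {0..<int p ^ 1} \<times> {0..<int p ^ 1}"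
    using res B_ints unfolding f_def by auto
  then have "finite (range f)"
    by (rule finite_subset) auto
  then have "\<not> inj f"
    using finite_imageD by blast
  then obtain a b where ab: "a < b" "f a = f b"
    unfolding inj_on_def by (metis linorder_neqE_nat)
  have eq: "pcong 1 (B (int a + i)) (B (int b + i))" if "i \<in> {0,1,2,3}" for i
  proof -
    have "res (B (int a + i)) = res (B (int b + i))"
      using ab that unfolding f_def by auto
    then show ?thesis
      using res[OF B_ints] by (metis pcong_sym pcong_trans)
  qed
  \<comment> \<open>The recurrence is run backwards; this divides by B(m+4), a unit by the contrary
    assumption.\<close>
  have "\<forall>i\<in>{0,1,2,3}. pcong 1 (B (int a - int j + i)) (B (int b - int j + i))" if "j \<le> a" for j
    using that
  proof (induction j)
    case 0
    then show ?case using eq by simp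
  next
    case (Suc j)
    define m n where "m = int a - int (Suc j)" and "n = int b - int (Suc j)"
    have mn: "m \<ge> 0" "n \<ge> 0" using Suc ab by (auto simp: m_def n_def)
    have IH: "pcong 1 (B (m + 1)) (B (n + 1))" "pcong 1 (B (m + 2)) (B (n + 2))"
      "pcong 1 (B (m + 3)) (B (n + 3))" "pcong 1 (B (m + 4)) (B (n + 4))"
      using Suc by (auto simp: m_def n_def algebra_simps)
    have "pcong 1 (B (m + 4) * B m) (B (n + 4) * B n)"
      unfolding net_step[OF net_B] using B_ints B_2 B_3 punit_ints
      by (intro pcong_diff pcong_mult pcong_power ints_mult ints_power IH pcong_refl) auto
    also have "pcong 1 (B (n + 4) * B n) (B (m + 4) * B n)"
      using B_ints by (intro pcong_mult pcong_sym[OF IH(4)] pcong_refl)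
    finally have "pcong 1 (B m) (B n)"
      using unit[of "m + 4"] mn pcong_cancel by simp
    with IH show ?case unfolding m_def n_def by auto
  qed
  from this[of a] have "pcong 1 (B 0) (B (int (b - a)))"
    using ab by (auto simp: of_nat_diff)
  then have "\<not> punit (B (int (b - a)))"
    using pcong_punit[of 1] B_0 punit_nonzero by fastforce
  with unit[of "int (b - a)"] ab show False by auto
qed

text \<open>Only exact divisibility by p^k needs work: then the quotient of B(pR) by B(R) must
  supply one more factor p. It does, because modulo p the quotients of B(lR) by B(R) behave like l
  up to powers of a unit.\<close>

lemma rank_lift:
  assumes "odd p" "B R \<in> multiples k" "k \<ge> 1" "R \<ge> 1"
  shows "B (int p * R) \<in> multiples (Suc k)"
proof (cases "B R \<in> multiples (Suc k)")
  case True
  have R1: "B R \<in> multiples 1" using assms multiples_mono by blast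
  \<comment> \<open>If B(R) is already divisible by p^(k+1), the symmetry carries this from l R to
    (l+1) R. The index is written as 1 plus a natural number because the symmetry starts at the unit
    B(1).\<close>
  have "B (int l * R) \<in> multiples (Suc k)" if "l \<ge> 1" for l
    using that
  proof (induction l rule: nat_induct_at_least)
    case (Suc l)
    have "pcong (Suc k) (B (1 + int (l * nat R - 1) + R))
      (B (1 + R) / B 1 * (B (R + 2) / (B 2 * B (R + 1))) ^ (l * nat R - 1) * B (1 + int (l * nat R - 1)))"
      using punit_B_near[OF R1 assms(4)] True assms B_ints B_1 B_2 B_3 punit_B_consec
      by (intro ward_symmetry net_B) auto
    moreover have lR: "1 + int (l * nat R - 1) = int l * R"
      using Suc assms by (simp add: of_nat_diff)
    moreover have "B (1 + R) / B 1 * (B (R + 2) / (B 2 * B (R + 1))) ^ (l * nat R - 1) * B (int l * R) \<in> multiples (Suc k)"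
      using Suc B_1 B_ints punit_B_near[OF R1 assms(4), of 1] punit_B_near[OF R1 assms(4), of 2] B_2
      by (intro multiples_mult ints_mult ints_power ints_divide) auto
    ultimately show ?case
      using pcong_multiples by (metis distrib_right mult_1 of_nat_Suc add.commute)
  qed (use True in simp)
  with prime_gt_0_nat[OF prime_p] show ?thesis by auto
next
  case False
  have R1: "B R \<in> multiples 1" using assms multiples_mono by blast
  have uR: "punit (B (R + 1))" "punit (B (R - 1))" "punit (B (R + 2))" "punit (B (R - 2))"
    using punit_B_near[OF R1 assms(4), of 1] punit_B_near[OF R1 assms(4), of 2] by auto
  define d where "d = B (R + 2) / (B 2 * B (R + 1))"
  define e where "e = - inverse (B (R - 1))"
  have ud: "punit d" "punit e" unfolding d_def e_def using uR B_2 by auto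
  \<comment> \<open>Starting the symmetry at 1 - R rather than at 1 gives access to the indices -1
    and -2, hence to B(R-1) and B(R-2), where the oddness of B enters.\<close>
  have ward: "pcong j (B (n + R)) (e * d ^ nat (n + R - 1) * B n)" if "B R \<in> multiples j" "n \<ge> 1 - R" for n j
  proof -
    have "punit (B (1 - R))" using uR B_minus[of "R - 1"] by simp
    then have "pcong j (B ((1 - R) + int (nat (n + R - 1)) + R))
      (B ((1 - R) + R) / B (1 - R) * (B (R + 2) / (B 2 * B (R + 1))) ^ (nat (n + R - 1)) * B ((1 - R) + int (nat (n + R - 1))))"
      using that uR assms B_ints B_1 B_2 B_3 punit_B_consec
      by (intro ward_symmetry net_B) auto
    moreover have "B (1 - R) = - B (R - 1)" using B_minus[of "R - 1"] by simp
    ultimately show ?thesis using that B_1 unfolding d_def e_def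
      by (simp add: divide_inverse)
  qed
  define r where "r = nat R"
  have r: "R = int r" "r \<ge> 4"
  proof -
    have "\<not> punit (B R)" using R1 punit_iff B_ints by blast
    then have "R \<noteq> 1" "R \<noteq> 2" "R \<noteq> 3" using B_1 B_2 B_3 by auto
    then show "R = int r" "r \<ge> 4" using assms unfolding r_def by auto
  qed
  \<comment> \<open>\<open>s\<close> is the factor of the symmetry extrapolated to n = 0: B(n+R) is
    congruent to s d^n B(n).\<close>
  define s where "s = e * d ^ (r - 1)"
  have us: "punit s" unfolding s_def using ud by simp
  have ints: "d \<in> ints" "e \<in> ints" "s \<in> ints" using ud us punit_ints by auto
  have w: "pcong 1 (B (n + R)) (e * d ^ nat (n + R - 1) * B n)" if "n \<ge> 1 - R" for n
    using ward[OF R1 that] .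
  have near: "pcong 1 (B (R + 1)) (s * d)" "pcong 1 (B (R - 1)) (- (e * d ^ (r - 2)))"
    "pcong 1 (B (R + 2)) (s * d\<^sup>2 * B 2)" "pcong 1 (B (R - 2)) (- (e * d ^ (r - 3) * B 2))"
  proof -
    have "nat (1 + R - 1) = (r - 1) + 1" "nat (-1 + R - 1) = r - 2"
      "nat (2 + R - 1) = (r - 1) + 2" "nat (-2 + R - 1) = r - 3"
      using r by auto
    note exps = this
    have "pcong 1 (B (1 + R)) (e * d ^ ((r - 1) + 1) * B 1)" "pcong 1 (B (-1 + R)) (e * d ^ (r - 2) * B (-1))"
      "pcong 1 (B (2 + R)) (e * d ^ ((r - 1) + 2) * B 2)" "pcong 1 (B (-2 + R)) (e * d ^ (r - 3) * B (-2))"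
      using w[of 1] w[of "-1"] w[of 2] w[of "-2"] r unfolding exps by auto
    then show "pcong 1 (B (R + 1)) (s * d)" "pcong 1 (B (R - 1)) (- (e * d ^ (r - 2)))"
      "pcong 1 (B (R + 2)) (s * d\<^sup>2 * B 2)" "pcong 1 (B (R - 2)) (- (e * d ^ (r - 3) * B 2))"
      unfolding power_add B_minus s_def by (simp_all add: B_1 mult_ac add.commute)
  qed
  \<comment> \<open>The symmetry at n = -1 gives B(R-1), of which \<open>e\<close> is minus the
    inverse.\<close>
  have inv: "pcong 1 (e\<^sup>2 * d ^ (r - 2)) 1"
  proof -
    have "pcong 1 (- e * B (R - 1)) (- e * - (e * d ^ (r - 2)))"
      using near(2) ints by (intro pcong_mult_left) auto
    moreover have "- e * B (R - 1) = 1"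
      unfolding e_def using uR punit_nonzero by simp
    ultimately show ?thesis
      using pcong_sym by (simp add: power2_eq_square mult_ac)
  qed
  \<comment> \<open>The two constants of the symmetry are thus related. Replacing d^r by s^2 makes
    the factor of E(l+1) over E(l) equal to s^(2(2l+1)), and these exponents add up to 2
    l^2.\<close>
  have sq: "pcong 1 (s\<^sup>2) (d ^ r)"
  proof -
    have "s\<^sup>2 = d ^ r * (e\<^sup>2 * d ^ (r - 2))"
    proof -
      have "(r - 1) * 2 = r + (r - 2)" using r by auto
      then show ?thesis by (simp add: s_def power_mult_distrib flip: power_mult power_add)
    qed
    then show ?thesis using pcong_mult_left[OF inv, of "d ^ r"] ints by simp
  qed
  \<comment> \<open>These are the products of neighbours of B(lR) that appear in the net relation
    when both arguments are multiples of R.\<close>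
  define E where "E l = B (int l * R + 1) * B (int l * R - 1)" for l
  have E: "pcong 1 (E l) (- (s ^ (2 * l\<^sup>2)))" for l
  proof (induction l)
    case 0
    then show ?case by (simp add: E_def B_1 B_minus)
  next
    case (Suc l)
    have "0 \<le> int l * R" using r by simp
    then have lr: "1 - R \<le> int l * R + 1" "1 - R \<le> int l * R - 1" using r by linarith+
    have "pcong 1 (B (int l * R + 1 + R) * B (int l * R - 1 + R))
        ((e * d ^ nat (int l * R + 1 + R - 1) * B (int l * R + 1)) * (e * d ^ nat (int l * R - 1 + R - 1) * B (int l * R - 1)))"
      using B_ints ints by (intro pcong_mult w lr ints_mult ints_power)
    also have "nat (int l * R + 1 + R - 1) = l * r + r"
      using r by (simp flip: of_nat_mult of_nat_add)
    also have "nat (int l * R - 1 + R - 1) = l * r + (r - 2)"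
      using r by (intro nat_eq_iff[THEN iffD2] disjI1) (simp add: of_nat_diff, (use mult_nonneg_nonneg[of "int l" "int r"] in linarith)?)
    also have "e * d ^ (l * r + r) * B (int l * R + 1) * (e * d ^ (l * r + (r - 2)) * B (int l * R - 1))
      = d ^ (r * (2 * l + 1)) * E l * (e\<^sup>2 * d ^ (r - 2))"
    proof -
      have "d ^ (r * (2 * l + 1)) = d ^ (l * r) * d ^ (l * r) * d ^ r"
      proof -
        have "r * (2 * l + 1) = l * r + l * r + r" by (simp add: algebra_simps)
        then show ?thesis by (simp only: power_add)
      qed
      then show ?thesis
        by (simp only: E_def power2_eq_square power_add mult_ac)
    qed
    also have "pcong 1 \<dots> (d ^ (r * (2 * l + 1)) * E l * 1)"
      using ints B_ints unfolding E_def by (intro pcong_mult_left inv ints_mult ints_power)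
    also have "\<dots> = (d ^ r) ^ (2 * l + 1) * E l"
      by (simp only: power_mult mult_1_right)
    also have "pcong 1 ((d ^ r) ^ (2 * l + 1) * E l) ((s\<^sup>2) ^ (2 * l + 1) * - (s ^ (2 * l\<^sup>2)))"
      using ints by (intro pcong_mult pcong_power pcong_sym[OF sq] Suc ints_uminus ints_power)
    also have "(s\<^sup>2) ^ (2 * l + 1) * - (s ^ (2 * l\<^sup>2)) = - (s ^ (2 * (Suc l)\<^sup>2))"
      by (simp add: power2_eq_square algebra_simps flip: power_mult power_add)
    finally show ?case
      by (simp add: E_def algebra_simps)
  qed
  have BR: "B R \<noteq> 0" using False by auto
  define D where "D l = B (int l * R) / B R" for l
  have DB: "B (int l * R) = D l * B R" for l
    unfolding D_def using BR by simp
  have unitk: "punit (B R / of_nat p ^ k)"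
  proof -
    have "B R / of_nat p ^ k \<in> ints" using assms by (simp add: multiples_def)
    moreover have "B R / of_nat p ^ k \<notin> multiples 1"
      using False p_pos by (simp add: multiples_def field_simps)
    ultimately show ?thesis using punit_iff by blast
  qed
  have D_ints: "D l \<in> ints" for l
  proof -
    have "B (int l * R) \<in> multiples k"
    proof (induction l)
      case (Suc l)
      have "pcong k (B (int l * R + R)) (e * d ^ nat (int l * R + R - 1) * B (int l * R))"
        using r assms mult_nonneg_nonneg[of "int l" R] by (intro ward; linarith)
      moreover have "e * d ^ nat (int l * R + R - 1) * B (int l * R) \<in> multiples k"
        using Suc ints by (intro multiples_mult ints_mult ints_power)
      ultimately show ?case using pcong_multiples by (simp add: algebra_simps)
    qed (simp add: B_0)
    then have "B (int l * R) / of_nat p ^ k \<in> ints" by (simp add: multiples_def)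
    from ints_divide[OF this unitk] show ?thesis
      using p_pos by (simp add: D_def)
  qed
  \<comment> \<open>The net relation at (l+1)R and R is divided by B(R)^2 over the rationals before
    it is reduced, since B(R) itself vanishes modulo p.\<close>
  have D_rec: "pcong 1 (D (l + 2) * D l) (s\<^sup>2 * (D (l + 1))\<^sup>2 - s ^ (2 * (l + 1)\<^sup>2))" for l
  proof -
    have "B (int (l + 2) * R) * B (int l * R) = (B R)\<^sup>2 * (E (l + 1) - E 1 * (B (int (l + 1) * R) / B R)\<^sup>2)"
      using net_relationD(1)[OF net_B, of "int (l + 1) * R" R] BR
      by (simp add: E_def algebra_simps power_divide)
    then have "(B R)\<^sup>2 * (D (l + 2) * D l) = (B R)\<^sup>2 * (E (l + 1) - E 1 * (D (l + 1))\<^sup>2)"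
      unfolding DB by (simp add: power2_eq_square BR)
    then have "D (l + 2) * D l = E (l + 1) - E 1 * (D (l + 1))\<^sup>2"
      using BR by simp
    also have "pcong 1 \<dots> (- (s ^ (2 * (l + 1)\<^sup>2)) - (- (s ^ (2 * 1\<^sup>2))) * (D (l + 1))\<^sup>2)"
      using B_ints D_ints unfolding E_def
      by (intro pcong_diff pcong_mult E[unfolded E_def] pcong_refl ints_mult ints_power)
    finally show ?thesis by simp
  qed
  \<comment> \<open>D(0) = 0, so the recurrence at l = 0 does not yield D(2). It comes from the net
    relation at R + 1 and R - 1, whose two terms both contain B(R) once.\<close>
  have D2: "pcong 1 (D 2) (2 * s ^ 3)"
  proof -
    have "B (int 2 * R) * B 2 = B R * ((B (R - 1))\<^sup>2 * B (R + 2) - B (R - 2) * (B (R + 1))\<^sup>2)"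
      using net_relationD(1)[OF net_B, of "R + 1" "R - 1"] by (simp add: algebra_simps)
    then have "B R * (B 2 * D 2) = B R * ((B (R - 1))\<^sup>2 * B (R + 2) - B (R - 2) * (B (R + 1))\<^sup>2)"
      unfolding DB by (simp add: mult_ac)
    then have "B 2 * D 2 = (B (R - 1))\<^sup>2 * B (R + 2) - B (R - 2) * (B (R + 1))\<^sup>2"
      using BR by (metis mult_left_cancel)
    also have "pcong 1 \<dots> ((- (e * d ^ (r - 2)))\<^sup>2 * (s * d\<^sup>2 * B 2) - (- (e * d ^ (r - 3) * B 2)) * (s * d)\<^sup>2)"
      using B_ints ints by (intro pcong_diff pcong_mult pcong_power near ints_mult ints_power ints_uminus)
    also have "(- (e * d ^ (r - 2)))\<^sup>2 * (s * d\<^sup>2 * B 2) - (- (e * d ^ (r - 3) * B 2)) * (s * d)\<^sup>2 = B 2 * (2 * s ^ 3)"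
    proof -
      have "r = (r - 3) + 3" using r(2) by simp
      then obtain t where "r = t + 3" ..
      then show ?thesis by (simp add: s_def power2_eq_square power3_eq_cube power_add algebra_simps eval_nat_numeral)
    qed
    finally show ?thesis using pcong_cancel B_2 by blast
  qed
  \<comment> \<open>At index j the exponent is j^2 - 1. The induction divides by D(l+1), a unit
    because l + 1 is less than p, and rests on (l+2)^2 - 1 = (l+1)(l+3).\<close>
  have D: "pcong 1 (D (l + 1)) (of_nat (l + 1) * s ^ (l * (l + 2)))
      \<and> pcong 1 (D (l + 2)) (of_nat (l + 2) * s ^ ((l + 1) * (l + 3)))" if "l + 2 \<le> p" for l
    using that
  proof (induction l)
    case 0
    then show ?case using D2 BR by (simp add: D_def)
  next
    case (Suc l)
    then have IH: "pcong 1 (D (l + 1)) (of_nat (l + 1) * s ^ (l * (l + 2)))"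
      "pcong 1 (D (l + 2)) (of_nat (l + 2) * s ^ ((l + 1) * (l + 3)))" by auto
    have "\<not> p dvd l + 1" using Suc by (auto dest: dvd_imp_le)
    then have ul: "punit (of_nat (l + 1))"
      using punit_iff[of "of_nat (l + 1)"] of_int_multiples_iff[of "int (l + 1)" 1]
      by (simp del: of_nat_add of_nat_Suc)
    have "pcong 1 (D (l + 3) * (of_nat (l + 1) * s ^ (l * (l + 2)))) (D (l + 3) * D (l + 1))"
      using D_ints by (intro pcong_mult_left pcong_sym[OF IH(1)])
    also have "pcong 1 (D (l + 3) * D (l + 1)) (s\<^sup>2 * (D (l + 2))\<^sup>2 - s ^ (2 * (l + 2)\<^sup>2))"
      using D_rec[of "l + 1"] by (simp add: numeral_3_eq_3)
    also have "pcong 1 \<dots> (s\<^sup>2 * (of_nat (l + 2) * s ^ ((l + 1) * (l + 3)))\<^sup>2 - s ^ (2 * (l + 2)\<^sup>2))"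
      using ints D_ints by (intro pcong_diff pcong_refl pcong_mult_left pcong_power IH ints_power)
    also have "s\<^sup>2 * (of_nat (l + 2) * s ^ ((l + 1) * (l + 3)))\<^sup>2 = of_nat (l + 2) ^ 2 * s ^ (2 * (l + 2)\<^sup>2)"
    proof -
      have "2 + (l + 1) * (l + 3) * 2 = 2 * (l + 2)\<^sup>2"
        by (simp add: power2_eq_square algebra_simps)
      moreover have "s ^ (2 + (l + 1) * (l + 3) * 2) = s\<^sup>2 * (s ^ ((l + 1) * (l + 3)))\<^sup>2"
        by (simp only: power_add power_mult)
      ultimately have "s ^ (2 * (l + 2)\<^sup>2) = s\<^sup>2 * (s ^ ((l + 1) * (l + 3)))\<^sup>2"
        by (simp only:)
      then show ?thesis by (simp only: power_mult_distrib mult_ac)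
    qed
    also have "of_nat (l + 2) ^ 2 * s ^ (2 * (l + 2)\<^sup>2) - s ^ (2 * (l + 2)\<^sup>2)
       = (of_nat (l + 1) * s ^ (l * (l + 2))) * (of_nat (l + 3) * s ^ ((l + 2) * (l + 4)))"
    proof -
      have "l * (l + 2) + (l + 2) * (l + 4) = 2 * (l + 2)\<^sup>2"
        by (simp add: power2_eq_square algebra_simps)
      then have "(of_nat (l + 1) * s ^ (l * (l + 2))) * (of_nat (l + 3) * s ^ ((l + 2) * (l + 4)))
        = of_nat (l + 1) * of_nat (l + 3) * s ^ (2 * (l + 2)\<^sup>2)"
        by (simp add: mult_ac flip: power_add)
      also have "of_nat (l + 1) * of_nat (l + 3) = (of_nat (l + 2) ^ 2 - 1 :: rat)"
        by (simp add: power2_eq_square algebra_simps)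
      finally show ?thesis by (simp add: algebra_simps)
    qed
    finally have "pcong 1 (of_nat (l + 1) * s ^ (l * (l + 2)) * D (l + 3))
      ((of_nat (l + 1) * s ^ (l * (l + 2))) * (of_nat (l + 3) * s ^ ((l + 2) * (l + 4))))"
      by (simp add: mult_ac)
    then have "pcong 1 (D (l + 3)) (of_nat (l + 3) * s ^ ((l + 2) * (l + 4)))"
      using pcong_cancel ul us punit_mult punit_power by blast
    with IH show ?case by (simp add: numeral_eq_Suc)
  qed
  have "p \<ge> 2" using prime_ge_2_nat[OF prime_p] .
  with D[of "p - 2"] have "pcong 1 (D p) (of_nat p * s ^ ((p - 1) * (p + 1)))"
    by (simp add: numeral_eq_Suc Suc_diff_Suc)
  moreover have "of_nat p * s ^ ((p - 1) * (p + 1)) \<in> multiples 1"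
    using multiples_p_power[of 1] ints by (intro multiples_mult') auto
  ultimately have "D p \<in> multiples 1"
    using pcong_multiples by blast
  from multiples_mult_add[OF this assms(2)] show ?thesis
    unfolding DB by simp
qed

lemma rank_multiples:
  assumes "odd p"
  obtains r :: nat where "r \<ge> 1" "\<And>k. B (int (r * p ^ k)) \<in> multiples (Suc k)"
proof -
  obtain R where R: "R \<ge> 1" "B R \<in> multiples 1" using zero_exists by blast
  have "B (int (nat R * p ^ k)) \<in> multiples (Suc k)" for k
  proof (induction k)
    case 0
    then show ?case using R by simp
  next
    case (Suc k)
    have "B (int p * int (nat R * p ^ k)) \<in> multiples (Suc (Suc k))"
      using Suc R p_pos mult_mono[of 1 R 1 "int p ^ k"] by (intro rank_lift assms) auto
    then show ?case by (simp add: mult_ac)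
  qed
  with R that[of "nat R"] show thesis by auto
qed

end

section \<open>Valuations, p-adic limits and eventually periodic sequences\<close>

context local_ints
begin

lemma pval_ge_iff: "pval p x \<ge> ereal (real k) \<longleftrightarrow> x \<in> multiples k"
proof (cases "x = 0")
  case False
  obtain a b where ab: "quotient_of x = (a, b)" by (rule prod.exhaust)
  note b = quotient_of_denom_pos[OF ab] and cop = quotient_of_coprime[OF ab]
    and x = quotient_of_div[OF ab]
  have a: "a \<noteq> 0" using False x by auto
  define va vb where "va = multiplicity (int p) a" and "vb = multiplicity (int p) b"
  have pv: "pval p x \<ge> ereal (real k) \<longleftrightarrow> va \<ge> vb + k"
  proof -
    have "pval p x = ereal (real va - real vb)"
      by (simp only: pval_def ab va_def vb_def False if_False fst_conv snd_conv)
    then have "pval p x \<ge> ereal (real k) \<longleftrightarrow> real k \<le> real va - real vb"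
      by (simp only: ereal_less_eq)
    then show ?thesis by linarith
  qed
  \<comment> \<open>The fraction is in lowest terms, so p divides at most one of numerator and
    denominator; a nonnegative valuation therefore leaves the denominator prime to p.\<close>
  have cop': "va = 0 \<or> vb = 0"
  proof (rule ccontr)
    assume "\<not> (va = 0 \<or> vb = 0)"
    then have "int p dvd a" "int p dvd b"
      unfolding va_def vb_def
      using not_dvd_imp_multiplicity_0[of "int p" a] not_dvd_imp_multiplicity_0[of "int p" b] by argo+
    then have "int p dvd 1" using cop by (rule_tac coprime_common_divisor)
    then show False using not_prime_unit[of "int p"] prime_int_p by simp
  qed
  show ?thesis unfolding pv
  proof
    assume le: "vb + k \<le> va"
    then have "vb = 0" using cop' by linarith
    then have nb: "\<not> int p dvd b"
      using b p_pos multiplicity_eq_zero_iff[of b "int p"]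
      unfolding vb_def by simp
    have "int p ^ k dvd a"
      using le unfolding va_def by (intro multiplicity_dvd') simp
    then have "of_int a \<in> multiples k" using of_int_multiples_iff by simp
    moreover have "punit (of_int b)"
      using nb punit_iff[of "of_int b"] of_int_multiples_iff[of b 1] by simp
    moreover have "of_int a = of_int b * x" using x b by simp
    ultimately show "x \<in> multiples k"
      using multiples_cancel[of "of_int b" x k] by simp
  next
    assume "x \<in> multiples k"
    then obtain c d where cd: "\<not> int p dvd d" "d \<noteq> 0" "x / of_nat p ^ k = of_int c / of_int d"
      unfolding multiples_def by (elim CollectE intsE)
    have "x = of_nat p ^ k * (of_int c / of_int d)"
      using cd p_pos by (simp add: divide_eq_eq mult.commute)
    then have "(of_int (a * d) :: rat) = of_int (int p ^ k * c * b)"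
      using cd(2) b unfolding x by (simp add: divide_eq_eq eq_divide_eq mult_ac)
    then have eq: "a * d = int p ^ k * c * b" by (simp only: of_int_eq_iff)
    then have c: "c \<noteq> 0" using a cd by auto
    have pe: "prime_elem (int p)" using prime_int_p by simp
    have "multiplicity (int p) (a * d) = va"
      using prime_elem_multiplicity_mult_distrib[OF pe a cd(2)] not_dvd_imp_multiplicity_0[OF cd(1)]
      by (simp add: va_def)
    moreover have "multiplicity (int p) (int p ^ k * c * b) = k + multiplicity (int p) c + vb"
      using c b p_pos prime_elem_multiplicity_mult_distrib[OF pe, of "int p ^ k * c" b]
        prime_elem_multiplicity_mult_distrib[OF pe, of "int p ^ k" c]
        multiplicity_same_power[of "int p" k] not_prime_unit[of "int p"] prime_int_p by (simp add: vb_def)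
    ultimately show "vb + k \<le> va" using eq by simp
  qed
qed (simp add: pval_def)

lemma pval_nonneg_iff: "pval p x \<ge> 0 \<longleftrightarrow> x \<in> ints"
  using pval_ge_iff[of 0 x] by (simp add: zero_ereal_def)

text \<open>The metric is ultrametric, so it is enough that consecutive differences tend to zero.
  The residues modulo p^k of the eventually constant classes form the limit.\<close>

lemma padic_limit_exists:
  assumes ints: "\<And>i. u i \<in> ints" and step: "\<And>k. \<forall>\<^sub>F i in sequentially. pcong k (u (Suc i)) (u i)"
  shows "\<exists>x\<in>padic_ints p. padic_tendsto p u x"
proof -
  have "\<exists>I. \<forall>i\<ge>I. pcong k (u (Suc i)) (u i)" for k
    using step[of k] by (simp add: eventually_sequentially)
  then obtain I where I: "\<And>k i. i \<ge> I k \<Longrightarrow> pcong k (u (Suc i)) (u i)" by metis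
  have "\<exists>a. a \<in> {0..<int p ^ k} \<and> pcong k (u (I k)) (of_int a)" for k
    using residue_exists[OF ints] by metis
  then obtain x where x: "\<And>k. x k \<in> {0..<int p ^ k}" "\<And>k. pcong k (u (I k)) (of_int (x k))" by metis
  have lim: "pcong k (u i) (of_int (x k))" if "i \<ge> I k" for i k
    using that
  proof (induction i rule: nat_induct_at_least)
    case (Suc n)
    show ?case using pcong_trans[OF I[OF Suc(1)] Suc(2)] .
  qed (rule x)
  have "x (Suc k) mod int p ^ k = x k" for k
  proof -
    define i where "i = max (I k) (I (Suc k))"
    have "pcong (Suc k) (of_int (x (Suc k))) (u i)" "pcong k (u i) (of_int (x k))"
      using lim[of k i] pcong_sym[OF lim[of "Suc k" i]] by (simp_all add: i_def)
    then have "pcong k (of_int (x (Suc k))) (of_int (x k))"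
      using pcong_trans[OF pcong_mono[of "Suc k" _ _ k]] by simp
    then have "x (Suc k) mod int p ^ k = x k mod int p ^ k"
      by (simp add: of_int_pcong_iff Cong.cong_def)
    then show ?thesis using x(1)[of k] by simp
  qed
  then have "x \<in> padic_ints p" using x by (auto simp: padic_ints_def)
  moreover have "padic_tendsto p u x"
    unfolding padic_tendsto_def eventually_sequentially pval_ge_iff
    using lim unfolding pcong_def by blast
  ultimately show ?thesis by blast
qed

lemma padic_limit_of_periodic:
  assumes ints: "\<And>n. n \<ge> 1 \<Longrightarrow> W n \<in> ints" and S: "coprime S p" "S \<ge> 1"
    and per: "\<And>k. k \<ge> 1 \<Longrightarrow> \<exists>f. \<forall>n\<ge>k. pcong k (W (n + p ^ f * S)) (W n)"
  shows "\<exists>q N. N \<ge> 1 \<and> q = p ^ N \<and> (\<forall>m\<ge>1. \<exists>x\<in>padic_ints p. padic_tendsto p (\<lambda>i. W (m * q ^ i)) x)"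
proof -
  define N where "N = totient S"
  define q where "q = p ^ N"
  have N: "N \<ge> 1" using S by (simp add: N_def Suc_le_eq)
  have "[q = 1] (mod S)"
    unfolding q_def N_def using S by (intro euler_theorem) (simp add: coprime_commute)
  have "q \<ge> p ^ 1" unfolding q_def using N p_pos by (intro power_increasing) auto
  then have q: "q \<ge> 2" using prime_ge_2_nat[OF prime_p] by simp
  have "S dvd q - 1"
    using \<open>[q = 1] (mod S)\<close> q cong_altdef_nat[of 1 q S] by simp
  have "\<exists>x\<in>padic_ints p. padic_tendsto p (\<lambda>i. W (m * q ^ i)) x" if m: "m \<ge> 1" for m
  proof (rule padic_limit_exists)
    fix i show "W (m * q ^ i) \<in> ints"
      using m q by (intro ints) (simp add: Suc_le_eq)
  next
    fix k :: nat
    \<comment> \<open>The periodicity hypothesis begins at k = 1; working modulo p^(k+1) includes k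
      = 0.\<close>
    obtain f where f: "\<And>n. n \<ge> Suc k \<Longrightarrow> pcong (Suc k) (W (n + p ^ f * S)) (W n)"
      using per[of "Suc k"] by auto
    have mult: "pcong (Suc k) (W (n + j * (p ^ f * S))) (W n)" if "n \<ge> Suc k" for n j
    proof (induction j)
      case (Suc j)
      have "pcong (Suc k) (W (n + j * (p ^ f * S) + p ^ f * S)) (W (n + j * (p ^ f * S)))"
        using that by (intro f) auto
      from pcong_trans[OF this Suc] show ?case by (simp add: algebra_simps)
    qed simp
    \<comment> \<open>The bound f makes p^f divide q^i, while S divides q - 1. The bound
      \<open>Suc k\<close> and i < q^i put m q^i into the range where periodicity holds.\<close>
    have "pcong k (W (m * q ^ Suc i)) (W (m * q ^ i))" if i: "i \<ge> max f (Suc k)" for i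
    proof -
      have qi: "i < q ^ i" using q by (intro power_gt_expt) auto
      also have "q ^ i \<le> m * q ^ i" using m by simp
      finally have large: "m * q ^ i \<ge> Suc k" using i by auto
      have "p ^ f dvd q ^ i"
        unfolding q_def power_mult[symmetric] using i mult_le_mono[of 1 N f i] N
        by (intro le_imp_power_dvd) auto
      then have "p ^ f * S dvd m * (q ^ i * (q - 1))"
        using \<open>S dvd q - 1\<close> by (intro dvd_mult mult_dvd_mono)
      then obtain j where j: "m * (q ^ i * (q - 1)) = j * (p ^ f * S)"
        by (elim dvdE) (simp only: mult.commute)
      have "m * q ^ Suc i = m * q ^ i + m * (q ^ i * (q - 1))"
        using q by (simp add: algebra_simps diff_mult_distrib2)
      with mult[OF large, of j] j have "pcong (Suc k) (W (m * q ^ Suc i)) (W (m * q ^ i))"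
        by simp
      then show ?thesis by (rule pcong_mono) simp
    qed
    then show "\<forall>\<^sub>F i in sequentially. pcong k (W (m * q ^ Suc i)) (W (m * q ^ i))"
      unfolding eventually_sequentially by blast
  qed
  with N q_def show ?thesis by blast
qed

text \<open>For a unit this is Euler's theorem. The powers of a non-unit are divisible by p^k from
  exponent k on, which is the origin of the bound on n.\<close>

lemma power_periodic:
  assumes "x \<in> ints" "n \<ge> k" "totient (p ^ k) dvd t"
  shows "pcong k (x ^ (n + t)) (x ^ n)"
proof (cases "punit x")
  case True
  obtain j where j: "t = totient (p ^ k) * j" using assms by blast
  have "pcong k ((x ^ totient (p ^ k)) ^ j) (1 ^ j)"
    using assms by (intro pcong_power punit_power_totient True) auto
  then have "pcong k (x ^ n * x ^ t) (x ^ n * 1)"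
    using assms unfolding j power_mult by (intro pcong_mult_left) auto
  then show ?thesis by (simp add: power_add)
next
  case False
  then have "x \<in> multiples 1" using assms punit_iff by blast
  have pow: "x ^ i \<in> multiples i" for i
  proof (induction i)
    case (Suc i)
    from multiples_mult_add[OF \<open>x \<in> multiples 1\<close> this] show ?case by simp
  qed simp
  have "x ^ (n + t) \<in> multiples k" "x ^ n \<in> multiples k"
    using assms multiples_mono[OF pow[of "n + t"], of k] multiples_mono[OF pow[of n], of k] by simp_all
  then have "pcong k (x ^ (n + t)) 0" "pcong k (x ^ n) 0"
    by (simp_all add: pcong_0_iff)
  then show ?thesis
    by (rule pcong_trans[OF _ pcong_sym])
qed

end

section \<open>The translated net: integrality and periodicity modulo prime powers\<close>

locale elliptic_net = elliptic_divisibility +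
  fixes A :: "int \<Rightarrow> rat"
  assumes net_A: "net_relation B A"
    and A_0: "A 0 = 1" and A_1: "A 1 = 1" and A_minus_1: "punit (A (-1))" and A_2: "A 2 \<in> ints"
begin

text \<open>Because A(0) = A(1) = 1, the doubling formulas have no denominators. At index 3 the odd
  formula is a tautology, so the Somos step starting at -1 is used, with division by the unit
  A(-1).\<close>

lemma A_ints: "n \<ge> -1 \<Longrightarrow> A n \<in> ints"
proof -
  have nat: "A (int n) \<in> ints" for n
  proof (induction n rule: less_induct)
    case (less n)
    have IH: "A i \<in> ints" if "0 \<le> i" "i < int n" for i
      using less[of "nat i"] that by auto
    consider "n \<le> 2" | "n = 3" | h where "n = 2 * h" "h \<ge> 2" | h where "n = 2 * h + 1" "h \<ge> 2"
    proof -
      have "n \<le> 2 \<or> n = 3 \<or> (n = 2 * (n div 2) \<or> n = 2 * (n div 2) + 1) \<and> n div 2 \<ge> 2"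
        by linarith
      then show thesis using that(1,2) that(3)[of "n div 2"] that(4)[of "n div 2"] by argo
    qed
    then show ?case
    proof cases
      case 1
      then consider "n = 0" | "n = 1" | "n = 2" by linarith
      then show ?thesis using A_0 A_1 A_2 by cases simp_all
    next
      case 2
      have "A (-1) * A 3 = (B 2)\<^sup>2 * A 2 * A 0 - B 3 * (A 1)\<^sup>2"
        using net_step[OF net_A, of "-1"] by (simp add: mult.commute)
      also have "\<dots> \<in> ints"
        using A_0 A_1 A_2 B_ints by (intro ints_diff ints_mult ints_power) auto
      finally show ?thesis using 2 ints_cancel[OF A_minus_1, of "A 3"] by simp
    next
      case (3 h)
      have "A (int n) = (B (int h))\<^sup>2 * A (int h + 1) * A (int h - 1) - B (int h + 1) * B (int h - 1) * (A (int h))\<^sup>2"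
        using net_relationD(1)[OF net_A, of "int h" "int h"] 3 A_0 by simp
      also have "\<dots> \<in> ints"
        using 3 B_ints by (intro ints_diff ints_mult ints_power IH) auto
      finally show ?thesis .
    next
      case (4 h)
      have "A (int n) = (B (int h))\<^sup>2 * A (int h + 2) * A (int h) - B (int h + 1) * B (int h - 1) * (A (int h + 1))\<^sup>2"
        using net_relationD(1)[OF net_A, of "int h + 1" "int h"] 4 A_1 by (simp add: algebra_simps)
      also have "\<dots> \<in> ints"
        using 4 B_ints by (intro ints_diff ints_mult ints_power IH) auto
      finally show ?thesis .
    qed
  qed
  assume "n \<ge> -1"
  then show ?thesis
    using nat[of "nat n"] punit_ints[OF A_minus_1] by (cases "n = -1") auto
qed

lemma punit_A_consec:
  assumes "n \<ge> 0" shows "punit (A n) \<or> punit (A (n + 1))"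
proof -
  have "{-1..-1+3} = {-1, 0, 1, 2::int}" by auto
  moreover have "A (-1) \<notin> multiples 1" "A 0 \<notin> multiples 1" "A 1 \<notin> multiples 1"
    using punit_iff[OF punit_ints[OF A_minus_1]] A_minus_1 punit_iff[OF ints_1] by (simp_all add: A_0 A_1)
  ultimately have "apart A (-1)"
    unfolding apart_def by auto
  have "apart A n"
  proof (rule apart_all[OF A_ints punit_power[OF B_2] B_3 net_step[OF net_A] \<open>apart A (-1)\<close>])
    show "-1 \<le> n" using assms by simp
  qed
  then show ?thesis
    using apartD[of A n n "n + 1"] assms A_ints[of n] A_ints[of "n + 1"] by simp
qed

lemma A_quasi_periodic:
  assumes "B (int R) \<in> multiples k" "k \<ge> 1" "R \<ge> 1"
  obtains c d where "punit c" "punit d" "\<And>n. pcong k (A (int (n + R))) (c * d ^ n * A (int n))"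
proof -
  have R1: "B (int R) \<in> multiples 1" using multiples_mono[OF assms(1,2)] .
  have uR: "punit (B (int R + 1))" "punit (B (int R + 2))"
    using punit_B_near(1)[OF R1] assms by simp_all
  define c d where "c = A (int R)" and "d = B (int R + 2) / (B 2 * B (int R + 1))"
  have ud: "punit d" unfolding d_def using uR B_2 by auto
  have per: "pcong k (A (int (n + R))) (c * d ^ n * A (int n))" for n
  proof -
    have "pcong k (A (0 + int n + int R)) (A (0 + int R) / A 0 * (B (int R + 2) / (B 2 * B (int R + 1))) ^ n * A (0 + int n))"
      using assms(1) uR punit_A_consec
      by (intro ward_symmetry net_A net_B B_ints B_1 B_2 B_3 A_ints) (simp_all add: A_0)
    then show ?thesis by (simp add: c_def d_def A_0)
  qed
  \<comment> \<open>If p divided A(R), the symmetry at n = 1 with A(1) = 1 would make it divide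
    A(R+1) as well, against \<open>punit_A_consec\<close>.\<close>
  have "punit c"
  proof (rule ccontr)
    assume "\<not> punit c"
    then have "punit (A (int (1 + R)))"
      using punit_A_consec[of "int R"] by (simp add: c_def add.commute)
    then have "punit (c * d ^ 1 * A (int 1))"
      using pcong_punit[OF per[of 1]] assms by simp
    then have "punit (c * d)" by (simp add: A_1)
    then have "punit (c * d / d)" using ud by (intro punit_divide)
    with \<open>\<not> punit c\<close> punit_nonzero[OF ud] show False by simp
  qed
  from that[OF this ud per] show thesis .
qed

text \<open>After t shifts by R the multiplier no longer depends on n, since d^(n t) is congruent to
  1 by Euler. The remaining constant \<open>e t\<close> is a unit, and t further rounds remove
  it.\<close>

lemma A_periodic:
  assumes "B (int R) \<in> multiples k" "k \<ge> 1" "R \<ge> 1"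
  defines "t \<equiv> totient (p ^ k)"
  shows "pcong k (A (int (n + t * (t * R)))) (A (int n))"
proof -
  obtain c d where cd: "punit c" "punit d" "\<And>n. pcong k (A (int (n + R))) (c * d ^ n * A (int n))"
    using A_quasi_periodic[OF assms(1-3)] by blast
  \<comment> \<open>The shift from n + j R to n + (j+1) R contributes c d^(n + j R);
    \<open>e\<close> collects the part independent of n.\<close>
  define e where "e i = (\<Prod>j<i. c * d ^ (j * R))" for i
  have e: "punit (e i)" for i unfolding e_def using cd by (intro punit_prod) auto
  have ints: "c \<in> ints" "d \<in> ints" "\<And>i. e i \<in> ints" using punit_ints[OF cd(1)] punit_ints[OF cd(2)] punit_ints[OF e] by simp_all
  have A: "A (int n) \<in> ints" for n by (rule A_ints) simp
  have iter: "pcong k (A (int (n + i * R))) (e i * d ^ (n * i) * A (int n))" for n i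
  proof (induction i)
    case (Suc i)
    have "pcong k (A (int (n + i * R + R))) (c * d ^ (n + i * R) * A (int (n + i * R)))"
      by (rule cd)
    also have "pcong k \<dots> (c * d ^ (n + i * R) * (e i * d ^ (n * i) * A (int n)))"
      using ints by (intro pcong_mult_left Suc) auto
    also have "\<dots> = e (Suc i) * d ^ (n * Suc i) * A (int n)"
      by (simp add: e_def power_add algebra_simps)
    finally show ?case by (simp add: algebra_simps)
  qed (simp add: e_def)
  have per: "pcong k (A (int (n + t * R))) (e t * A (int n))" for n
  proof -
    have "pcong k ((d ^ t) ^ n) (1 ^ n)"
      unfolding t_def using cd ints by (intro pcong_power punit_power_totient) auto
    then have "pcong k ((e t * A (int n)) * d ^ (n * t)) ((e t * A (int n)) * 1)"
      using ints A by (intro pcong_mult_left) (auto simp: mult.commute simp flip: power_mult)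
    then have "pcong k (e t * d ^ (n * t) * A (int n)) (e t * A (int n))"
      by (simp add: mult_ac)
    with iter[of n t] show ?thesis by (rule pcong_trans)
  qed
  have "pcong k (A (int (n + i * (t * R)))) (e t ^ i * A (int n))" for i
  proof (induction i)
    case (Suc i)
    have "pcong k (A (int (n + i * (t * R) + t * R))) (e t * A (int (n + i * (t * R))))"
      by (rule per)
    also have "pcong k \<dots> (e t * (e t ^ i * A (int n)))"
      using ints by (intro pcong_mult_left Suc)
    finally show ?case by (simp add: algebra_simps)
  qed simp
  from this[of t] have "pcong k (A (int (n + t * (t * R)))) (e t ^ t * A (int n))" .
  also have "pcong k (e t ^ t * A (int n)) (1 * A (int n))"
    using ints A e unfolding t_def by (intro pcong_mult punit_power_totient pcong_refl) auto
  finally show ?thesis by simp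
qed

lemma padic_limit:
  assumes "odd p" and W: "\<And>n. n \<ge> 1 \<Longrightarrow> W n = \<alpha> ^ n * \<beta> * A (int n)"
    and \<alpha>: "\<alpha> \<in> ints" and \<beta>: "\<beta> \<in> ints"
  shows "\<exists>q N. N \<ge> 1 \<and> q = p ^ N \<and> (\<forall>m\<ge>1. \<exists>x\<in>padic_ints p. padic_tendsto p (\<lambda>i. W (m * q ^ i)) x)"
proof -
  obtain r :: nat where r: "r \<ge> 1" "\<And>k. B (int (r * p ^ k)) \<in> multiples (Suc k)"
    using rank_multiples[OF \<open>odd p\<close>] by metis
  obtain a s where as: "r = p ^ a * s" "\<not> p dvd s"
    using r prime_p multiplicity_decompose'[of r p] not_prime_unit by (metis not_one_le_zero)
  \<comment> \<open>The period of A modulo p^k is t^2 r p^k with t = p^(k-1) (p-1). Its part prime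
    to p is this number, whatever k is.\<close>
  define S where "S = (p - 1) ^ 2 * s"
  have s: "s \<ge> 1" using r as by (cases s) auto
  have "S \<ge> 1" unfolding S_def using s p_pos by (simp add: Suc_le_eq)
  have cop: "coprime S p"
  proof -
    have "\<not> p dvd p - 1" using p_pos by (auto dest: dvd_imp_le)
    then have "coprime p (p - 1)" "coprime p s" using as prime_p prime_imp_coprime by blast+
    then show ?thesis by (simp add: S_def coprime_commute)
  qed
  show ?thesis
  proof (rule padic_limit_of_periodic[OF _ cop \<open>S \<ge> 1\<close>])
    show "W n \<in> ints" if "n \<ge> 1" for n
      unfolding W[OF that] using \<alpha> \<beta> A_ints by (intro ints_mult ints_power) auto
  next
    fix k :: nat assume k: "k \<ge> 1"
    define t where "t = totient (p ^ k)"
    define T where "T = t * (t * (r * p ^ k))"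
    have t: "t = p ^ (k - 1) * (p - 1)"
      unfolding t_def using totient_prime_power[of p k] prime_p k by simp
    have T: "T = p ^ (2 * (k - 1) + a + k) * S"
      unfolding T_def t S_def as(1) by (simp add: power_add power_mult power2_eq_square power_mult_distrib mult_ac)
    have "B (int (r * p ^ k)) \<in> multiples k" using r(2)[of k] multiples_mono by (meson le_SucI order_refl)
    then have A: "pcong k (A (int (n + T))) (A (int n))" for n
      unfolding T_def t_def using k r p_pos by (intro A_periodic) (auto simp: Suc_le_eq)
    have "pcong k (W (n + T)) (W n)" if "n \<ge> k" for n
    proof -
      have n: "n \<ge> 1" "n + T \<ge> 1" using that k by auto
      have "pcong k (\<beta> * \<alpha> ^ (n + T) * A (int (n + T))) (\<beta> * \<alpha> ^ n * A (int n))"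
        using \<alpha> \<beta> A_ints that A
        by (intro pcong_mult pcong_refl power_periodic ints_mult ints_power) (auto simp: T_def t_def)
      then show ?thesis unfolding W[OF n(1)] W[OF n(2)] by (simp add: mult_ac)
    qed
    then show "\<exists>f. \<forall>n\<ge>k. pcong k (W (n + p ^ f * S)) (W n)"
      using T by blast
  qed
qed

end

section \<open>The Weierstrass sigma function\<close>

text \<open>3/2 is half the exponent of the lattice sum below, which is split evenly between the two
  coordinates of a period; \<open>max\<close> takes care of the coordinate 0.\<close>

lemma summable_on_int_powr:
  "(\<lambda>m::int. max 1 (real_of_int \<bar>m\<bar>) powr (-3/2)) summable_on UNIV" (is "?f summable_on _")
proof -
  have nat: "(\<lambda>n::nat. ?f (int n)) summable_on UNIV"
  proof (rule norm_summable_imp_summable_on)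
    have "summable (\<lambda>n. real n powr (-3/2))"
      by (simp add: summable_real_powr_iff)
    then show "summable (\<lambda>n. norm (?f (int n)))"
      by (rule summable_comparison_test_ev[rotated])
        (use eventually_gt_at_top[of 0] in eventually_elim, simp add: max_def)
  qed
  have "?f summable_on range int"
    using nat by (subst summable_on_reindex) (auto simp: o_def inj_on_def)
  moreover have "?f summable_on range (\<lambda>n. - int n)"
    using nat by (subst summable_on_reindex) (auto simp: o_def inj_on_def)
  ultimately have "?f summable_on (range int \<union> range (\<lambda>n. - int n))"
    by (rule summable_on_union)
  moreover have "range int \<union> range (\<lambda>n. - int n) = UNIV"
  proof (intro equalityI subsetI UnCI)
    fix m :: int assume "m \<notin> range (\<lambda>n. - int n)"
    then have "m \<noteq> - int (nat (- m))" by blast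
    then have "m \<ge> 0" by linarith
    then show "m \<in> range int" using nonneg_int_cases by blast
  qed simp
  ultimately show ?thesis by simp
qed

locale lattice =
  fixes L :: "complex set"
  assumes lattice: "complex_lattice L"
begin

lemma lattice_zero [simp]: "0 \<in> L"
  and lattice_add: "z \<in> L \<Longrightarrow> w \<in> L \<Longrightarrow> z + w \<in> L"
  and lattice_uminus: "z \<in> L \<Longrightarrow> - z \<in> L"
  and countable_lattice: "countable L"
  and infinite_lattice: "infinite L"
proof -
  obtain u v where uv: "u \<noteq> 0" "v / u \<notin> \<real>" and L: "L = {of_int m * u + of_int n * v | m n. True}"
    using lattice unfolding complex_lattice_def by blast
  show "0 \<in> L" unfolding L by (intro CollectI exI[of _ 0]) simp
  show "z + w \<in> L" if "z \<in> L" "w \<in> L"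
  proof -
    from that obtain m n m' n' where "z = of_int m * u + of_int n * v" "w = of_int m' * u + of_int n' * v"
      unfolding L by blast
    then have "z + w = of_int (m + m') * u + of_int (n + n') * v" by (simp add: algebra_simps)
    then show ?thesis unfolding L by blast
  qed
  show "- z \<in> L" if "z \<in> L"
  proof -
    from that obtain m n where "z = of_int m * u + of_int n * v"
      unfolding L by blast
    then have "- z = of_int (- m) * u + of_int (- n) * v" by (simp add: algebra_simps)
    then show ?thesis unfolding L by blast
  qed
  have "L = (\<lambda>(m, n). of_int m * u + of_int n * v) ` (UNIV :: (int \<times> int) set)"
    unfolding L by auto
  then show "countable L" by (metis countable_image countableI_type)
  have "inj (\<lambda>m::int. of_int m * u)" using uv by (auto simp: inj_on_def)
  moreover have "range (\<lambda>m::int. of_int m * u) \<subseteq> L"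
  proof safe
    fix m :: int
    have "of_int m * u = of_int m * u + of_int 0 * v" by simp
    then show "of_int m * u \<in> L" unfolding L by blast
  qed
  ultimately show "infinite L"
    using infinite_super range_inj_infinite infinite_UNIV_int finite_imageD by metis
qed

lemma lattice_uminus_iff [simp]: "- z \<in> L \<longleftrightarrow> z \<in> L"
  using lattice_uminus[of z] lattice_uminus[of "- z"] by auto

text \<open>The norm of a period dominates each of its two integer coordinates, so its cube
  dominates the product of their powers with exponent 3/2. The double series is thereby bounded by a
  product of two convergent series.\<close>

lemma inverse_cube_summable: "(\<lambda>w. 1 / norm w ^ 3) summable_on (L - {0})"
proof -
  obtain u v where uv: "u \<noteq> 0" "v / u \<notin> \<real>" and L: "L = {of_int m * u + of_int n * v | m n. True}"
    using lattice unfolding complex_lattice_def by blast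
  have v: "v \<noteq> 0" using uv by auto
  have "Im (v / u) \<noteq> 0" using uv by (simp add: complex_is_Real_iff)
  moreover have "Im (u / v) \<noteq> 0"
  proof
    assume "Im (u / v) = 0"
    then have "inverse (u / v) \<in> \<real>" by (intro Reals_inverse) (simp add: complex_is_Real_iff)
    then show False using uv by (simp add: divide_inverse mult.commute)
  qed
  \<comment> \<open>After division by one generator, the imaginary part of a period sees only the
    coordinate at the other generator. This gives one lower bound for each coordinate, and
    \<open>c\<close> is the smaller constant.\<close>
  ultimately obtain c where c: "c > 0" "c \<le> norm u * \<bar>Im (v / u)\<bar>" "c \<le> norm v * \<bar>Im (u / v)\<bar>"
    using uv v that[of "min (norm u * \<bar>Im (v / u)\<bar>) (norm v * \<bar>Im (u / v)\<bar>)"] by auto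
  define g where "g = (\<lambda>(m, n). of_int m * u + of_int n * v)"
  define h where "h m = max 1 (real_of_int \<bar>m\<bar>)" for m :: int
  have bound: "c * \<bar>of_int m\<bar> \<le> norm (g (m, n))" "c * \<bar>of_int n\<bar> \<le> norm (g (m, n))" for m n
  proof -
    have "g (m, n) = u * (of_int m + of_int n * (v / u))" using uv(1) by (simp add: g_def distrib_left)
    then have "norm (g (m, n)) = norm u * norm (of_int m + of_int n * (v / u))" by (simp only: norm_mult)
    also have "\<dots> \<ge> norm u * \<bar>Im (of_int m + of_int n * (v / u))\<bar>"
      by (intro mult_left_mono abs_Im_le_cmod) auto
    also have "Im (of_int m + of_int n * (v / u)) = of_int n * Im (v / u)"
      by (simp only: plus_complex.sel times_complex.sel complex_Im_of_int complex_Re_of_int)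
    finally have "norm u * \<bar>Im (v / u)\<bar> * \<bar>of_int n\<bar> \<le> norm (g (m, n))" by (simp add: abs_mult mult_ac)
    then show "c * \<bar>of_int n\<bar> \<le> norm (g (m, n))"
      using c mult_right_mono[of c "norm u * \<bar>Im (v / u)\<bar>" "\<bar>of_int n\<bar>"] by simp
    have "g (m, n) = v * (of_int m * (u / v) + of_int n)" using v by (simp add: g_def distrib_left)
    then have "norm (g (m, n)) = norm v * norm (of_int m * (u / v) + of_int n)" by (simp only: norm_mult)
    also have "\<dots> \<ge> norm v * \<bar>Im (of_int m * (u / v) + of_int n)\<bar>"
      by (intro mult_left_mono abs_Im_le_cmod) auto
    also have "Im (of_int m * (u / v) + of_int n) = of_int m * Im (u / v)"
      by (simp only: plus_complex.sel times_complex.sel complex_Im_of_int complex_Re_of_int)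
    finally have "norm v * \<bar>Im (u / v)\<bar> * \<bar>of_int m\<bar> \<le> norm (g (m, n))" by (simp add: abs_mult mult_ac)
    then show "c * \<bar>of_int m\<bar> \<le> norm (g (m, n))"
      using c mult_right_mono[of c "norm v * \<bar>Im (u / v)\<bar>" "\<bar>of_int m\<bar>"] by simp
  qed
  define I where "I = (UNIV :: (int \<times> int) set) - {(0, 0)}"
  have hle: "c * h m \<le> norm (g (m, n))" "c * h n \<le> norm (g (m, n))" if "(m, n) \<in> I" for m n
  proof -
    have "\<bar>m\<bar> \<ge> 1 \<or> \<bar>n\<bar> \<ge> 1" using that by (auto simp: I_def)
    then have "c * 1 \<le> c * \<bar>of_int m\<bar> \<or> c * 1 \<le> c * \<bar>of_int n\<bar>"
      using c by (auto intro!: mult_left_mono)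
    then have "c \<le> norm (g (m, n))" using bound[where m=m and n=n] by linarith
    then show "c * h m \<le> norm (g (m, n))" "c * h n \<le> norm (g (m, n))"
      using bound[where m=m and n=n] by (simp_all add: h_def max_def)
  qed
  have inj: "inj_on g I"
  proof (rule inj_onI, clarify)
    fix m n m' n' assume "g (m, n) = g (m', n')"
    then have "g (m - m', n - n') = 0" by (simp add: g_def algebra_simps)
    then have "c * \<bar>of_int (m - m')\<bar> \<le> 0" "c * \<bar>of_int (n - n')\<bar> \<le> 0"
      using bound[where m = "m - m'" and n = "n - n'"] by auto
    with c show "m = m' \<and> n = n'" by (simp add: mult_le_0_iff)
  qed
  have img: "g ` I = L - {0}"
  proof (intro equalityI subsetI)
    fix w assume "w \<in> g ` I"
    then obtain m n where mn: "(m, n) \<in> I" "w = g (m, n)" by auto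
    have "0 < c * h m" using c by (auto simp: h_def)
    then have "w \<noteq> 0" using hle[OF mn(1)] mn by auto
    then show "w \<in> L - {0}" using mn unfolding L g_def by auto
  next
    fix w assume "w \<in> L - {0}"
    then obtain m n where "w = g (m, n)" "w \<noteq> 0" unfolding L g_def by auto
    moreover from this have "(m, n) \<in> I" by (auto simp: I_def g_def)
    ultimately show "w \<in> g ` I" by blast
  qed
  have "(\<lambda>(m, n). h m powr (-3/2) * h n powr (-3/2)) summable_on (UNIV \<times> UNIV)"
  proof (rule summable_on_SigmaI)
    fix m :: int
    have "(\<lambda>n. h n powr (-3/2)) summable_on UNIV"
      using summable_on_int_powr by (simp add: h_def)
    then show "((\<lambda>n. (case (m, n) of (m, n) \<Rightarrow> h m powr (-3/2) * h n powr (-3/2))) has_sum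
        (h m powr (-3/2) * (\<Sum>\<^sub>\<infinity>n. h n powr (-3/2)))) UNIV"
      by (auto intro!: has_sum_cmult_right has_sum_infsum)
  next
    show "(\<lambda>m. h m powr (-3/2) * (\<Sum>\<^sub>\<infinity>n. h n powr (-3/2))) summable_on UNIV"
      using summable_on_int_powr by (intro summable_on_cmult_left) (simp add: h_def)
  qed (auto simp: h_def)
  then have "(\<lambda>x. 1 / c ^ 3 * (case x of (m, n) \<Rightarrow> h m powr (-3/2) * h n powr (-3/2))) summable_on I"
    by (intro summable_on_cmult_right) (auto intro: summable_on_subset)
  then have "(\<lambda>x. 1 / norm (g x) ^ 3) summable_on I"
  proof (rule summable_on_comparison_test)
    fix x assume x: "x \<in> I"
    obtain m n where [simp]: "x = (m, n)" by (cases x)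
    have h1: "h m \<ge> 1" "h n \<ge> 1" by (auto simp: h_def)
    have "c ^ 3 * (h m powr (3/2) * h n powr (3/2)) = (c * h m) powr (3/2) * (c * h n) powr (3/2)"
      using c h1 by (simp add: powr_mult mult_ac flip: powr_add powr_numeral)
    also have "\<dots> \<le> norm (g x) powr (3/2) * norm (g x) powr (3/2)"
      using hle[of m n] x c h1 by (intro mult_mono powr_mono2) auto
    also have "\<dots> = norm (g x) ^ 3"
      by (cases "g x = 0") (simp_all flip: powr_add powr_numeral)
    finally have le: "c ^ 3 * (h m powr (3/2) * h n powr (3/2)) \<le> norm (g x) ^ 3" .
    have pos: "c ^ 3 * (h m powr (3/2) * h n powr (3/2)) > 0"
      using c h1 by (intro mult_pos_pos zero_less_power) auto
    define A where "A = h m powr (3/2)"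
    define B where "B = h n powr (3/2)"
    have "h m powr (-3/2) = inverse A" "h n powr (-3/2) = inverse B"
      unfolding A_def B_def powr_minus[symmetric] by simp_all
    then have "(case x of (m, n) \<Rightarrow> h m powr (-3/2) * h n powr (-3/2)) = inverse A * inverse B"
      by (simp only: \<open>x = (m, n)\<close> prod.case)
    then have "1 / c ^ 3 * (case x of (m, n) \<Rightarrow> h m powr (-3/2) * h n powr (-3/2)) = 1 / (c ^ 3 * (A * B))"
      by (simp only: divide_inverse mult_1 inverse_mult_distrib)
    moreover have "1 / norm (g x) ^ 3 \<le> 1 / (c ^ 3 * (A * B))"
      unfolding A_def B_def by (rule frac_le[OF zero_le_one order_refl pos le])
    ultimately show "1 / norm (g x) ^ 3 \<le> 1 / c ^ 3 * (case x of (m, n) \<Rightarrow> h m powr (-3/2) * h n powr (-3/2))"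
      by (simp only:)
  qed auto
  then have "((\<lambda>w. 1 / norm w ^ 3) \<circ> g) summable_on I" by (simp add: o_def)
  then show ?thesis using summable_on_reindex[OF inj] img by metis
qed

definition period :: "nat \<Rightarrow> complex" where
  "period = from_nat_into (L - {0})"

lemma bij_period: "bij_betw period UNIV (L - {0})"
  unfolding period_def using countable_lattice infinite_lattice
  by (intro bij_betw_from_nat_into) auto

lemma range_period: "range period = L - {0}"
  using bij_period by (simp add: bij_betw_def)

lemma summable_period: "summable (\<lambda>k. 1 / norm (period k) ^ 3)"
  using summable_on_reindex_bij_betw[OF bij_period, of "\<lambda>w. 1 / norm w ^ 3"] inverse_cube_summable
  by (intro summable_on_imp_summable) auto

text \<open>Convergence of the sum of inverse cubes admits factors of constant genus 2. The function
  \<open>f\<close> of this locale is the product over the nonzero periods, so that sigma is z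
  f(z).\<close>

sublocale weierstrass_product period "\<lambda>_. 2"
proof
  show nz: "period n \<noteq> 0" for n using range_period by blast
  have "(\<lambda>k. 1 / norm (period k) ^ 3) \<longlonglongrightarrow> 0"
    using summable_period by (rule summable_LIMSEQ_zero)
  note lim = this
  show "filterlim period at_infinity sequentially"
    unfolding filterlim_at_infinity[OF order_refl]
  proof (intro allI impI)
    fix r :: real assume r: "r > 0"
    have "\<forall>\<^sub>F k in sequentially. 1 / norm (period k) ^ 3 < 1 / r ^ 3"
      using order_tendstoD(2)[OF lim, of "1 / r ^ 3"] r by simp
    then show "\<forall>\<^sub>F k in sequentially. r \<le> norm (period k)"
    proof eventually_elim
      case (elim k)
      have "norm (period k) > 0" using nz by simp
      then have "r ^ 3 < norm (period k) ^ 3"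
        using elim r by (simp add: divide_less_cancel frac_less2 divide_simps split: if_splits)
      then show ?case
        using power_less_imp_less_base[of r 3 "norm (period k)"] by simp
    qed
  qed
  show "summable (\<lambda>n. (r / norm (period n)) ^ Suc 2)" for r
    using summable_mult[OF summable_period, of "r ^ 3"] by (simp add: power_divide eval_nat_numeral)
qed

lemma wsigma_eq: "wsigma L z = z * f z"
  unfolding wsigma_def f_def by (simp add: period_def)

lemma wsigma_eq_0_iff: "wsigma L z = 0 \<longleftrightarrow> z \<in> L"
  using zero[of z] range_period by (auto simp: wsigma_eq)

lemma holomorphic_wsigma [holomorphic_intros]: "wsigma L holomorphic_on A"
proof -
  have "(\<lambda>z. z * f z) holomorphic_on A" by (intro holomorphic_intros)
  then show ?thesis by (simp add: wsigma_eq[abs_def])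
qed

lemma weierstrass_factor_2: "weierstrass_factor 2 z = (1 - z) * exp (z + z\<^sup>2 / 2)"
  by (simp add: weierstrass_factor_def numeral_2_eq_2)

lemma deriv_factor:
  assumes "z \<noteq> w" "w \<noteq> 0"
  shows "deriv (\<lambda>z. weierstrass_factor 2 (z / w)) z / weierstrass_factor 2 (z / w) = 1 / (z - w) + 1 / w + z / w\<^sup>2"
proof -
  define e where "e = exp (z / w + (z / w)\<^sup>2 / 2)"
  have "((\<lambda>z. weierstrass_factor 2 (z / w)) has_field_derivative
     - (1 / w) * e + (1 - z / w) * (e * (1 / w + z / w\<^sup>2))) (at z)"
    unfolding weierstrass_factor_2 e_def using assms
    by (auto intro!: derivative_eq_intros simp: power2_eq_square)
  then have "deriv (\<lambda>z. weierstrass_factor 2 (z / w)) z = - (1 / w) * e + (1 - z / w) * (e * (1 / w + z / w\<^sup>2))"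
    by (rule DERIV_imp_deriv)
  also have "\<dots> = ((1 - z / w) * e) * (- (1 / w) / (1 - z / w) + 1 / w + z / w\<^sup>2)"
  proof -
    have "1 - z / w \<noteq> 0" using assms by simp
    then show ?thesis by (simp only: distrib_left times_divide_eq_right) (simp add: mult_ac)
  qed
  also have "- (1 / w) / (1 - z / w) = 1 / (z - w)"
    using assms by (simp add: divide_simps)
  finally show ?thesis
    using assms by (simp add: weierstrass_factor_2 e_def)
qed

lemma period_neq: "period k \<noteq> 0" "z \<notin> L \<Longrightarrow> z \<noteq> period k"
  using range_period by blast+

text \<open>An unordered infinite sum that does not converge is 0 by convention; this is what makes
  the definition of \<open>wp\<close> meaningful.\<close>

lemma wp_summand_summable:
  assumes "z \<notin> L"
  shows "(\<lambda>w. 1 / (z - w)\<^sup>2 - 1 / w\<^sup>2) summable_on (L - {0})"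
proof -
  have "summable (\<lambda>k. norm (1 / (z - period k)\<^sup>2 - 1 / (period k)\<^sup>2))"
  proof (rule summable_comparison_test_ev)
    \<comment> \<open>For |w| > 2 |z| one has |2w - z| at most 5/2 |w| and |z - w| at least |w|/2;
      the constant is 5/2 divided by 1/4.\<close>
    show "summable (\<lambda>k. 10 * norm z * (1 / norm (period k) ^ 3))"
      by (intro summable_mult summable_period)
    have "\<forall>\<^sub>F k in sequentially. norm (period k) > 2 * norm z"
      using filterlim_a by (metis filterlim_at_infinity_imp_norm_at_top filterlim_at_top_dense)
    then show "\<forall>\<^sub>F k in sequentially. norm (norm (1 / (z - period k)\<^sup>2 - 1 / (period k)\<^sup>2)) \<le> 10 * norm z * (1 / norm (period k) ^ 3)"
    proof eventually_elim
      case (elim k)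
      define w where "w = period k"
      have w: "w \<noteq> 0" "z \<noteq> w" "2 * norm z < norm w" using period_neq assms elim by (auto simp: w_def)
      have "1 / (z - w)\<^sup>2 - 1 / w\<^sup>2 = z * (2 * w - z) / ((z - w)\<^sup>2 * w\<^sup>2)"
        using w by (simp add: divide_simps) (simp add: power2_eq_square algebra_simps)
      then have "norm (1 / (z - w)\<^sup>2 - 1 / w\<^sup>2) = norm z * norm (2 * w - z) / ((norm (z - w))\<^sup>2 * (norm w)\<^sup>2)"
        by (simp add: norm_mult norm_divide norm_power)
      also have "\<dots> \<le> norm z * (5 / 2 * norm w) / ((norm w / 2)\<^sup>2 * (norm w)\<^sup>2)"
      proof (intro frac_le mult_left_mono mult_right_mono power_mono mult_pos_pos)
        show "norm (2 * w - z) \<le> 5 / 2 * norm w"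
          using norm_triangle_ineq4[of "2 * w" z] w by (simp add: norm_mult)
        show "norm w / 2 \<le> norm (z - w)"
          using norm_triangle_ineq3[of z w] w by simp
      qed (use w in auto)
      also have "\<dots> = 10 * norm z * (1 / norm w ^ 3)"
        using w by (simp add: field_simps power2_eq_square power3_eq_cube)
      finally show ?case by (simp add: w_def)
    qed
  qed
  then have "(\<lambda>k. 1 / (z - period k)\<^sup>2 - 1 / (period k)\<^sup>2) summable_on UNIV"
    by (rule norm_summable_imp_summable_on)
  then show ?thesis
    using summable_on_reindex_bij_betw[OF bij_period, of "\<lambda>w. 1 / (z - w)\<^sup>2 - 1 / w\<^sup>2"] by simp
qed

lemma wp_sums:
  assumes "z \<notin> L"
  shows "(\<lambda>k. 1 / (z - period k)\<^sup>2 - 1 / (period k)\<^sup>2) sums (wp L z - 1 / z\<^sup>2)"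
proof -
  have "((\<lambda>w. 1 / (z - w)\<^sup>2 - 1 / w\<^sup>2) has_sum (wp L z - 1 / z\<^sup>2)) (L - {0})"
    using has_sum_infsum[OF wp_summand_summable[OF assms]] by (simp add: wp_def)
  then show ?thesis
    using has_sum_reindex_bij_betw[OF bij_period, of "\<lambda>w. 1 / (z - w)\<^sup>2 - 1 / w\<^sup>2"]
    by (intro has_sum_imp_sums) simp
qed

text \<open>The right side is minus the second logarithmic derivative of \<open>f\<close>. The
  formula is exact for partial products, and locally uniform convergence of holomorphic functions
  carries over to the derivatives.\<close>

lemma wp_f:
  assumes "z \<notin> L"
  shows "wp L z - 1 / z\<^sup>2 = ((deriv f z)\<^sup>2 - f z * deriv (deriv f) z) / (f z)\<^sup>2"
proof -
  define P where "P N z = (\<Prod>n<N. weierstrass_factor 2 (z / period n))" for N z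
  have lim: "uniform_limit (ball 0 (norm z + 1)) P f sequentially"
    using uniform_limit[of "norm z + 1"] add_nonneg_pos[OF norm_ge_zero zero_less_one] unfolding P_def
    by (blast intro: uniform_limit_on_subset[OF _ ball_subset_cball])
  have hol: "P N holomorphic_on A" for N A
    unfolding P_def by (auto intro!: holomorphic_intros simp: period_neq)
  have lims: "(\<lambda>N. (deriv ^^ m) (P N) z) \<longlonglongrightarrow> (deriv ^^ m) f z" for m
    by (rule higher_deriv_complex_uniform_limit[OF lim]) (auto simp: hol)
  \<comment> \<open>The logarithmic derivative will be differentiated once more, so its expression
    as a sum is needed on a whole neighbourhood of z.\<close>
  define U where "U = {w. f w \<noteq> 0}"
  have "continuous_on UNIV f" by (intro holomorphic_on_imp_continuous_on holomorphic)
  then have U: "open U"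
    unfolding U_def by (intro open_Collect_neq) auto
  have fz: "f z \<noteq> 0" using assms range_period by (auto simp: zero)
  have nz: "w \<noteq> period k" if "w \<in> U" for w k
    using that zero unfolding U_def by auto
  have PN: "P N w \<noteq> 0" if "w \<in> U" for N w
    using nz[OF that] period_neq(1) unfolding P_def by (auto simp: field_simps)
  have log: "deriv (P N) w / P N w = (\<Sum>k<N. 1 / (w - period k) + 1 / period k + w / (period k)\<^sup>2)"
    if w: "w \<in> U" for N w
  proof -
    have "deriv (P N) w = P N w * (\<Sum>k<N. deriv (\<lambda>w. weierstrass_factor 2 (w / period k)) w / weierstrass_factor 2 (w / period k))"
    proof (rule DERIV_imp_deriv)
      have der: "((\<lambda>w. weierstrass_factor 2 (w / period k)) has_field_derivative
         deriv (\<lambda>w. weierstrass_factor 2 (w / period k)) w) (at w)" for k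
        by (rule holomorphic_derivI[of _ UNIV]) (auto intro!: holomorphic_intros simp: period_neq)
      show "(P N has_field_derivative P N w * (\<Sum>k<N. deriv (\<lambda>w. weierstrass_factor 2 (w / period k)) w / weierstrass_factor 2 (w / period k))) (at w)"
        unfolding P_def[abs_def] using nz[OF w] period_neq(1)
        by (intro has_field_derivative_prod' der) (auto simp: field_simps)
    qed
    then show ?thesis
      using PN[OF w, of N] deriv_factor[OF nz[OF w] period_neq(1)] by simp
  qed
  have sum: "(deriv (deriv (P N)) z * P N z - deriv (P N) z * deriv (P N) z) / (P N z * P N z)
     = - (\<Sum>k<N. 1 / (z - period k)\<^sup>2 - 1 / (period k)\<^sup>2)" for N
  proof (rule DERIV_unique)
    have zU: "z \<in> U" using fz by (simp add: U_def)
    have "((\<lambda>w. deriv (P N) w / P N w) has_field_derivative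
      (deriv (deriv (P N)) z * P N z - deriv (P N) z * deriv (P N) z) / (P N z * P N z)) (at z)"
      using PN[OF zU, of N] hol[of N UNIV]
      by (intro DERIV_divide holomorphic_derivI[of _ UNIV] holomorphic_deriv) auto
    then show "((\<lambda>w. \<Sum>k<N. 1 / (w - period k) + 1 / period k + w / (period k)\<^sup>2) has_field_derivative
      (deriv (deriv (P N)) z * P N z - deriv (P N) z * deriv (P N) z) / (P N z * P N z)) (at z)"
      by (rule has_field_derivative_transform_within_open[OF _ U zU]) (simp add: log)
    show "((\<lambda>w. \<Sum>k<N. 1 / (w - period k) + 1 / period k + w / (period k)\<^sup>2) has_field_derivative
      - (\<Sum>k<N. 1 / (z - period k)\<^sup>2 - 1 / (period k)\<^sup>2)) (at z)"
      unfolding sum_negf[symmetric] using nz[OF zU]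
      by (intro DERIV_sum) (auto intro!: derivative_eq_intros simp: power2_eq_square period_neq)
  qed
  have "(\<lambda>N. (deriv (deriv (P N)) z * P N z - deriv (P N) z * deriv (P N) z) / (P N z * P N z))
    \<longlonglongrightarrow> (deriv (deriv f) z * f z - deriv f z * deriv f z) / (f z * f z)"
    using lims[of 0] lims[of 1] lims[of 2] fz by (intro tendsto_intros) (auto simp: numeral_2_eq_2)
  moreover have "(\<lambda>N. - (\<Sum>k<N. 1 / (z - period k)\<^sup>2 - 1 / (period k)\<^sup>2)) \<longlonglongrightarrow> - (wp L z - 1 / z\<^sup>2)"
    using wp_sums[OF assms] unfolding sums_def by (rule tendsto_minus)
  ultimately have "(deriv (deriv f) z * f z - deriv f z * deriv f z) / (f z * f z) = - (wp L z - 1 / z\<^sup>2)"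
    unfolding sum using LIMSEQ_unique by blast
  then have "wp L z - 1 / z\<^sup>2 = - ((deriv (deriv f) z * f z - deriv f z * deriv f z) / (f z * f z))"
    by simp
  then show ?thesis
    by (simp add: power2_eq_square mult.commute minus_divide_left)
qed

lemma f_0: "f 0 = 1"
  unfolding f_def by simp

text \<open>The exponential in each factor cancels the linear term of its logarithm, so every factor
  has logarithmic derivative 0 at the origin.\<close>

lemma deriv_f_0: "deriv f 0 = 0"
proof -
  have lim: "uniform_limit (ball 0 1) (\<lambda>N z. \<Prod>n<N. weierstrass_factor 2 (z / period n)) f sequentially"
    using uniform_limit[of 1] by (rule uniform_limit_on_subset) auto
  have "(\<lambda>k. deriv (\<lambda>z. weierstrass_factor 2 (z / period k)) 0 / weierstrass_factor 2 (0 / period k)) sums (deriv f 0 / f 0)"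
    by (rule logderiv_prodinf_complex_uniform_limit[OF lim])
      (auto intro!: holomorphic_intros simp: period_neq f_0)
  moreover have "deriv (\<lambda>z. weierstrass_factor 2 (z / period k)) 0 / weierstrass_factor 2 (0 / period k) = 0" for k
    using deriv_factor[of 0 "period k"] period_neq(1)[of k] by simp
  ultimately have "(\<lambda>_. 0 :: complex) sums (deriv f 0)" by (simp only: f_0 div_by_1)
  then show ?thesis using sums_unique2 sums_zero by blast
qed

lemma wsigma_derivs:
  "deriv (wsigma L) z = f z + z * deriv f z"
  "deriv (deriv (wsigma L)) z = 2 * deriv f z + z * deriv (deriv f) z"
proof -
  have der: "(f has_field_derivative deriv f z) (at z)" "(deriv f has_field_derivative deriv (deriv f) z) (at z)" for z
    by (rule holomorphic_derivI[of _ UNIV]; auto intro!: holomorphic holomorphic_deriv)+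
  have 1: "deriv (wsigma L) z = f z + z * deriv f z" for z
    unfolding wsigma_eq[abs_def] by (rule DERIV_imp_deriv) (auto intro!: derivative_eq_intros der)
  then have "deriv (wsigma L) = (\<lambda>z. f z + z * deriv f z)" by blast
  moreover have "deriv (\<lambda>z. f z + z * deriv f z) z = 2 * deriv f z + z * deriv (deriv f) z"
    by (rule DERIV_imp_deriv) (auto intro!: derivative_eq_intros der)
  ultimately show "deriv (wsigma L) z = f z + z * deriv f z"
    "deriv (deriv (wsigma L)) z = 2 * deriv f z + z * deriv (deriv f) z" using 1 by simp_all
qed

lemma deriv_wsigma_0: "deriv (wsigma L) 0 = 1" "deriv (deriv (wsigma L)) 0 = 0"
  by (simp_all add: wsigma_derivs f_0 deriv_f_0)

text \<open>This is the classical \<wp> = - (log \<sigma>)'': the factor z of sigma contributes the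
  summand 1/z^2 that is missing in \<open>wp_f\<close>.\<close>

lemma wp_wsigma:
  assumes "z \<notin> L"
  shows "wp L z = ((deriv (wsigma L) z)\<^sup>2 - wsigma L z * deriv (deriv (wsigma L)) z) / (wsigma L z)\<^sup>2"
proof -
  have "f z \<noteq> 0" "z \<noteq> 0" using assms wsigma_eq_0_iff[of z] by (auto simp: wsigma_eq)
  then show ?thesis
    using wp_f[OF assms] unfolding wsigma_derivs wsigma_eq
    by (simp add: divide_simps) (simp add: power2_eq_square algebra_simps)
qed

end

section \<open>Weierstrass curves over a field type\<close>

lemma type_ring_simps [simp]:
  "carrier ring_of_type_algebra = UNIV"
  "x \<oplus>\<^bsub>ring_of_type_algebra\<^esub> y = x + y"
  "x \<otimes>\<^bsub>ring_of_type_algebra\<^esub> y = x * y"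
  "\<zero>\<^bsub>ring_of_type_algebra\<^esub> = 0"
  "\<one>\<^bsub>ring_of_type_algebra\<^esub> = 1"
  by (simp_all add: ring_of_type_algebra_def)

lemma type_ring_minus [simp]:
  fixes x y :: "'a::comm_ring_1"
  shows "\<ominus>\<^bsub>ring_of_type_algebra\<^esub> x = - x" "x \<ominus>\<^bsub>ring_of_type_algebra\<^esub> y = x - y"
proof -
  interpret cring "ring_of_type_algebra :: 'a ring" by (rule cring_from_type_algebra)
  show "\<ominus>\<^bsub>ring_of_type_algebra\<^esub> x = - x" using minus_equality[of "- x" x] by simp
  then show "x \<ominus>\<^bsub>ring_of_type_algebra\<^esub> y = x - y"
    by (metis a_minus_def type_ring_simps(2) diff_conv_add_uminus minus_minus
        l_neg UNIV_I type_ring_simps(1,4) add_eq_0_iff)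
qed

lemma type_ring_power [simp]:
  fixes x :: "'a::comm_ring_1" and n :: nat
  shows "x [^]\<^bsub>ring_of_type_algebra\<^esub> n = x ^ n"
  by (induction n) (simp_all add: nat_pow_def mult.commute)

lemma type_ring_add_pow [simp]:
  fixes x :: "'a::comm_ring_1" and n :: nat
  shows "[n] \<cdot>\<^bsub>ring_of_type_algebra\<^esub> x = of_nat n * x"
  by (induction n) (simp_all add: add_pow_def nat_pow_def algebra_simps)

lemma type_ring_inverse [simp]:
  fixes x :: "'a::field"
  assumes "x \<noteq> 0"
  shows "inv\<^bsub>ring_of_type_algebra\<^esub> x = inverse x"
proof -
  interpret field "ring_of_type_algebra :: 'a ring" by (rule field_from_type_algebra)
  show ?thesis using assms by (intro comm_inv_char) auto
qed

abbreviation (input) type_add :: "'a::field wcurve \<Rightarrow> 'a ec_point \<Rightarrow> 'a ec_point \<Rightarrow> 'a ec_point" where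
  "type_add \<equiv> ec_add ring_of_type_algebra"

lemma type_ec_neg: "ec_neg ring_of_type_algebra E (Affine x y) = Affine x (- y - a\<^sub>1 E * x - a\<^sub>3 E)"
  for E :: "'a::field wcurve"
  by (simp add: ec_neg_def)

lemma type_add_neg: "type_add E (Affine x y) (Affine x (- y - a\<^sub>1 E * x - a\<^sub>3 E)) = Infinity"
  by (simp add: ec_add_def type_ec_neg)

lemma type_add_eq_Infinity:
  assumes "type_add E (Affine x y) Q = Infinity"
  shows "Q = Affine x (- y - a\<^sub>1 E * x - a\<^sub>3 E)"
proof (cases Q)
  case (Affine x' y')
  then show ?thesis
    using assms by (auto simp: ec_add_def type_ec_neg Let_def split: if_splits)
qed (use assms in \<open>simp add: ec_add_def\<close>)

text \<open>Chord and tangent case of the addition law in one expression, with the slope as a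
  parameter. The slope can then be carried between fields by \<open>of_rat\<close> or by reduction
  independently of how it was obtained.\<close>

definition chord :: "'a::field wcurve \<Rightarrow> 'a \<Rightarrow> 'a \<Rightarrow> 'a \<Rightarrow> 'a \<Rightarrow> 'a ec_point" where
  "chord E l x y x' = (let x3 = l\<^sup>2 + a\<^sub>1 E * l - a\<^sub>2 E - x - x'
     in Affine x3 (- (y + l * (x3 - x)) - a\<^sub>1 E * x3 - a\<^sub>3 E))"

lemma type_add_chord:
  assumes "x \<noteq> x'"
  shows "type_add E (Affine x y) (Affine x' y') = chord E ((y' - y) / (x' - x)) x y x'"
  using assms by (simp add: ec_add_def type_ec_neg Let_def chord_def divide_inverse)

lemma type_add_double:
  assumes "2 * y + a\<^sub>1 E * x + a\<^sub>3 E \<noteq> 0"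
  shows "type_add E (Affine x y) (Affine x y) =
    chord E ((3 * x\<^sup>2 + 2 * a\<^sub>2 E * x + a\<^sub>4 E - a\<^sub>1 E * y) / (2 * y + a\<^sub>1 E * x + a\<^sub>3 E)) x y x"
proof -
  have "y \<noteq> - y - a\<^sub>1 E * x - a\<^sub>3 E" using assms by (auto simp: algebra_simps)
  then show ?thesis
    using assms by (simp add: ec_add_def type_ec_neg Let_def chord_def divide_inverse ec_dx_def ec_dy_def mult.assoc)
qed

lemma type_ec_points:
  "Affine x y \<in> ec_points ring_of_type_algebra E \<longleftrightarrow>
     y\<^sup>2 + a\<^sub>1 E * x * y + a\<^sub>3 E * y = x ^ 3 + a\<^sub>2 E * x\<^sup>2 + a\<^sub>4 E * x + a\<^sub>6 E"
  for E :: "'a::field wcurve"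
  by (simp add: ec_points_def)

section \<open>The sigma function of a uniformized curve\<close>

locale uniformization =
  fixes L :: "complex set" and E :: "complex wcurve"
  assumes unif: "uniformizes L E"
begin

sublocale lattice L
  using unif by unfold_locales (simp add: uniformizes_def)

abbreviation "\<sigma> \<equiv> wsigma L"
abbreviation "\<pp> \<equiv> wp L"
abbreviation "\<pp>' \<equiv> deriv (wp L)"

definition xc :: "complex \<Rightarrow> complex" where "xc z = \<pp> z - b\<^sub>2 E / 12"
definition yc :: "complex \<Rightarrow> complex" where "yc z = (\<pp>' z - a\<^sub>1 E * xc z - a\<^sub>3 E) / 2"
text \<open>Off the lattice this is \<wp> times \<sigma>^2. In this form it is entire, which extends
  formulas with \<wp> across the poles.\<close>

definition D :: "complex \<Rightarrow> complex" where "D z = (deriv \<sigma> z)\<^sup>2 - \<sigma> z * deriv (deriv \<sigma>) z"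

lemma unif_map_Affine: "z \<notin> L \<Longrightarrow> unif_map L E z = Affine (xc z) (yc z)"
  by (simp add: unif_map_def xc_def yc_def Let_def)

lemma unif_map_Infinity: "z \<in> L \<Longrightarrow> unif_map L E z = Infinity"
  by (simp add: unif_map_def)

lemma unif_map_eq_iff: "unif_map L E z = unif_map L E w \<longleftrightarrow> z - w \<in> L"
  and unif_map_add: "unif_map L E (z + w) = type_add E (unif_map L E z) (unif_map L E w)"
  and unif_map_in: "unif_map L E z \<in> ec_points ring_of_type_algebra E"
  using unif by (auto simp: uniformizes_def)

lemma holomorphic_\<sigma>_derivs: "deriv \<sigma> holomorphic_on A" "deriv (deriv \<sigma>) holomorphic_on A" "D holomorphic_on A"
proof -
  have *: "deriv \<sigma> holomorphic_on UNIV" "deriv (deriv \<sigma>) holomorphic_on UNIV"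
    by (intro holomorphic_deriv holomorphic_wsigma open_UNIV)+
  then show "deriv \<sigma> holomorphic_on A" "deriv (deriv \<sigma>) holomorphic_on A"
    by (auto intro: holomorphic_on_subset)
  then show "D holomorphic_on A"
    unfolding D_def[abs_def]
    by (intro holomorphic_on_diff holomorphic_on_mult holomorphic_on_power holomorphic_wsigma)
qed

lemma \<sigma>_DERIV: "(\<sigma> has_field_derivative deriv \<sigma> z) (at z)"
  "(deriv \<sigma> has_field_derivative deriv (deriv \<sigma>) z) (at z)"
  "(D has_field_derivative deriv D z) (at z)"
  by (rule holomorphic_derivI[of _ UNIV]; auto intro: holomorphic_wsigma holomorphic_\<sigma>_derivs)+

lemma wp_eq_D: "z \<notin> L \<Longrightarrow> \<pp> z = D z / (\<sigma> z)\<^sup>2"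
  by (simp add: wp_wsigma D_def)

lemma open_compl: "open (- L)"
proof -
  have "continuous_on UNIV \<sigma>" by (intro holomorphic_on_imp_continuous_on holomorphic_wsigma)
  then have "open {z. \<sigma> z \<noteq> 0}" by (intro open_Collect_neq) auto
  moreover have "{z. \<sigma> z \<noteq> 0} = - L" by (auto simp: wsigma_eq_0_iff)
  ultimately show ?thesis by simp
qed

lemma wp_holomorphic: "\<pp> holomorphic_on - L"
proof -
  have "(\<lambda>z. D z / (\<sigma> z)\<^sup>2) holomorphic_on - L"
    by (intro holomorphic_intros holomorphic_wsigma holomorphic_\<sigma>_derivs) (auto simp: wsigma_eq_0_iff)
  then show ?thesis by (rule holomorphic_transform) (simp add: wp_eq_D)
qed

lemma wp_DERIV:
  assumes "z \<notin> L"
  shows "(\<pp> has_field_derivative \<pp>' z) (at z)" "(\<pp>' has_field_derivative deriv \<pp>' z) (at z)"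
  using assms open_compl by (auto intro!: holomorphic_derivI[of _ "- L"] wp_holomorphic holomorphic_deriv)

lemma wp_deriv_eq:
  assumes "z \<notin> L"
  shows "\<pp>' z * (\<sigma> z) ^ 3 = deriv D z * \<sigma> z - 2 * D z * deriv \<sigma> z"
proof -
  have nz: "\<sigma> z \<noteq> 0" using assms wsigma_eq_0_iff by blast
  have "((\<lambda>z. D z / (\<sigma> z)\<^sup>2) has_field_derivative (deriv D z * (\<sigma> z)\<^sup>2 - D z * (2 * \<sigma> z * deriv \<sigma> z)) / ((\<sigma> z)\<^sup>2 * (\<sigma> z)\<^sup>2)) (at z)"
    using nz by (auto intro!: derivative_eq_intros \<sigma>_DERIV)
  then have "(\<pp> has_field_derivative (deriv D z * (\<sigma> z)\<^sup>2 - D z * (2 * \<sigma> z * deriv \<sigma> z)) / ((\<sigma> z)\<^sup>2 * (\<sigma> z)\<^sup>2)) (at z)"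
    by (rule has_field_derivative_transform_within_open[OF _ open_compl]) (use assms in \<open>auto simp: wp_eq_D\<close>)
  then have "\<pp>' z = (deriv D z * (\<sigma> z)\<^sup>2 - D z * (2 * \<sigma> z * deriv \<sigma> z)) / ((\<sigma> z)\<^sup>2 * (\<sigma> z)\<^sup>2)"
    by (rule DERIV_imp_deriv)
  then have "(\<pp>' z * (\<sigma> z) ^ 3) * \<sigma> z = (deriv D z * \<sigma> z - 2 * D z * deriv \<sigma> z) * \<sigma> z"
    using nz by (simp add: field_simps power2_eq_square power3_eq_cube)
  then show ?thesis using nz by simp
qed

text \<open>Parity is read off the group law: the images of z and -z add up to
  \<open>Infinity\<close>, so each is the negative of the other.\<close>

lemma uminus_point:
  assumes "z \<notin> L"
  shows "\<pp> (- z) = \<pp> z" "\<pp>' (- z) = - \<pp>' z"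
proof -
  have "type_add E (Affine (xc z) (yc z)) (Affine (xc (- z)) (yc (- z))) = Infinity"
    using unif_map_add[of z "- z"] assms by (simp add: unif_map_Affine unif_map_Infinity)
  then have "xc (- z) = xc z" "yc (- z) = - yc z - a\<^sub>1 E * xc z - a\<^sub>3 E"
    using type_add_eq_Infinity by blast+
  moreover have "\<pp>' w = 2 * yc w + a\<^sub>1 E * xc w + a\<^sub>3 E" "\<pp> w = xc w + b\<^sub>2 E / 12" for w
    by (simp_all add: xc_def yc_def)
  ultimately show "\<pp> (- z) = \<pp> z" "\<pp>' (- z) = - \<pp>' z"
    by simp_all
qed

lemma curve_equation:
  assumes "z \<notin> L"
  shows "(\<pp>' z)\<^sup>2 = 4 * (xc z) ^ 3 + b\<^sub>2 E * (xc z)\<^sup>2 + 2 * b\<^sub>4 E * xc z + b\<^sub>6 E"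
proof -
  have "Affine (xc z) (yc z) \<in> ec_points ring_of_type_algebra E"
    using unif_map_in[of z] assms by (simp add: unif_map_Affine)
  then have eq: "(yc z)\<^sup>2 + a\<^sub>1 E * xc z * yc z + a\<^sub>3 E * yc z = (xc z) ^ 3 + a\<^sub>2 E * (xc z)\<^sup>2 + a\<^sub>4 E * xc z + a\<^sub>6 E"
    by (simp add: type_ec_points)
  have "\<pp>' z = 2 * yc z + a\<^sub>1 E * xc z + a\<^sub>3 E" by (simp add: yc_def)
  then have "(\<pp>' z)\<^sup>2 = 4 * ((yc z)\<^sup>2 + a\<^sub>1 E * xc z * yc z + a\<^sub>3 E * yc z) + (a\<^sub>1 E * xc z + a\<^sub>3 E)\<^sup>2"
    by (simp add: power2_eq_square algebra_simps)
  then show ?thesis unfolding eq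
    by (simp add: b\<^sub>2_def b\<^sub>4_def b\<^sub>6_def power2_eq_square algebra_simps)
qed

text \<open>The curve equation leaves only the images of w and -w over the given abscissa, and the
  uniformization is injective modulo L.\<close>

lemma wp_eq_imp:
  assumes "z \<notin> L" "w \<notin> L" "\<pp> z = \<pp> w"
  shows "z - w \<in> L \<or> z + w \<in> L"
proof -
  have "xc z = xc w" using assms by (simp add: xc_def)
  then have "(\<pp>' z)\<^sup>2 = (\<pp>' w)\<^sup>2" using curve_equation assms by simp
  then consider "\<pp>' z = \<pp>' w" | "\<pp>' z = - \<pp>' w" using power2_eq_iff by blast
  then show ?thesis
  proof cases
    case 1
    then have "unif_map L E z = unif_map L E w"
      using assms by (simp add: unif_map_Affine xc_def yc_def)
    then show ?thesis using unif_map_eq_iff by blast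
  next
    case 2
    then have "unif_map L E z = unif_map L E (- w)"
      using assms uminus_point[of w] by (simp add: unif_map_Affine xc_def yc_def)
    then show ?thesis using unif_map_eq_iff[of z "- w"] by simp
  qed
qed

lemma wp_deriv_eq_0:
  assumes "z \<notin> L" "\<pp>' z = 0" shows "2 * z \<in> L"
proof -
  have "unif_map L E z = unif_map L E (- z)"
    using assms uminus_point[of z] by (simp add: unif_map_Affine xc_def yc_def)
  then show ?thesis using unif_map_eq_iff[of z "- z"] by simp
qed

lemma wp_addition:
  assumes "z \<notin> L" "w \<notin> L" "z + w \<notin> L" "\<pp> z \<noteq> \<pp> w"
  shows "xc (z + w) = ((\<pp>' w - \<pp>' z) / (\<pp> w - \<pp> z))\<^sup>2 / 4 - b\<^sub>2 E / 4 - xc z - xc w"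
proof -
  have "xc z \<noteq> xc w" using assms by (simp add: xc_def)
  then have "xc (z + w) = (let l = (yc w - yc z) / (xc w - xc z) in l\<^sup>2 + a\<^sub>1 E * l - a\<^sub>2 E - xc z - xc w)"
    using unif_map_add[of z w] assms by (simp add: unif_map_Affine type_add_chord chord_def Let_def)
  moreover have "(yc w - yc z) / (xc w - xc z) = ((\<pp>' w - \<pp>' z) / (\<pp> w - \<pp> z)) / 2 - a\<^sub>1 E / 2"
    using assms by (simp add: xc_def yc_def divide_simps) (simp add: algebra_simps)
  ultimately show ?thesis
    by (simp add: Let_def b\<^sub>2_def power2_eq_square algebra_simps) 
qed

text \<open>Differentiating the curve equation gives this identity multiplied by 2 \<wp>'.
  Half-periods are excluded so that \<wp>' can be cancelled.\<close>

lemma wp_deriv2: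
  assumes "z \<notin> L" "2 * z \<notin> L"
  shows "deriv \<pp>' z = 6 * (xc z)\<^sup>2 + b\<^sub>2 E * xc z + b\<^sub>4 E"
proof -
  have nz: "\<pp>' z \<noteq> 0" using wp_deriv_eq_0 assms by blast
  have 1: "((\<lambda>z. (\<pp>' z)\<^sup>2) has_field_derivative 2 * \<pp>' z * deriv \<pp>' z) (at z)"
    using assms by (auto intro!: derivative_eq_intros wp_DERIV)
  have "((\<lambda>z. 4 * (xc z) ^ 3 + b\<^sub>2 E * (xc z)\<^sup>2 + 2 * b\<^sub>4 E * xc z + b\<^sub>6 E) has_field_derivative
    2 * \<pp>' z * (6 * (xc z)\<^sup>2 + b\<^sub>2 E * xc z + b\<^sub>4 E)) (at z)"
    unfolding xc_def using assms
    by (auto intro!: derivative_eq_intros wp_DERIV simp: algebra_simps power2_eq_square)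
  then have "((\<lambda>z. (\<pp>' z)\<^sup>2) has_field_derivative 2 * \<pp>' z * (6 * (xc z)\<^sup>2 + b\<^sub>2 E * xc z + b\<^sub>4 E)) (at z)"
    by (rule has_field_derivative_transform_within_open[OF _ open_compl]) (use assms in \<open>auto simp: curve_equation\<close>)
  with 1 have "2 * \<pp>' z * deriv \<pp>' z = 2 * \<pp>' z * (6 * (xc z)\<^sup>2 + b\<^sub>2 E * xc z + b\<^sub>4 E)"
    by (rule DERIV_unique)
  then show ?thesis using nz by simp
qed

end

text \<open>Connectedness turns a vanishing derivative off the lattice, or off finitely many
  translates and halves of it, into constancy; density extends continuous identities to the whole
  plane.\<close>

lemma countable_compl_connected_dense:
  fixes S :: "complex set"
  assumes "countable S"
  shows "connected (- S)" "closure (- S) = UNIV"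
proof -
  show "connected (- S)"
    by (intro path_connected_imp_connected path_connected_complement_countable assms) simp
  have "interior S = {}"
  proof (rule ccontr)
    assume "interior S \<noteq> {}"
    then obtain z where "z \<in> interior S" by blast
    then obtain r where "r > 0" "ball z r \<subseteq> S"
      by (auto simp: mem_interior)
    then show False
      using uncountable_ball[of r z] countable_subset assms by blast
  qed
  then show "closure (- S) = UNIV" by (simp add: closure_complement)
qed

section \<open>Parity of zeta and sigma, and the addition formula of sigma\<close>

context uniformization
begin

definition \<zeta> :: "complex \<Rightarrow> complex" where "\<zeta> z = deriv \<sigma> z / \<sigma> z"

lemma \<sigma>_nz: "z \<notin> L \<Longrightarrow> \<sigma> z \<noteq> 0"
  by (simp add: wsigma_eq_0_iff)

lemma \<zeta>_DERIV:
  assumes "z \<notin> L" shows "(\<zeta> has_field_derivative - \<pp> z) (at z)"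
proof -
  have "(\<zeta> has_field_derivative (deriv (deriv \<sigma>) z * \<sigma> z - deriv \<sigma> z * deriv \<sigma> z) / (\<sigma> z * \<sigma> z)) (at z)"
    unfolding \<zeta>_def[abs_def] by (intro DERIV_divide \<sigma>_DERIV \<sigma>_nz assms)
  moreover have "(deriv (deriv \<sigma>) z * \<sigma> z - deriv \<sigma> z * deriv \<sigma> z) / (\<sigma> z * \<sigma> z) = - \<pp> z"
    using \<sigma>_nz[OF assms] by (simp add: wp_wsigma[OF assms] power2_eq_square field_simps)
  ultimately show ?thesis by simp
qed

text \<open>The sum of both values has derivative zero because \<wp> is even, hence is constant. The
  constant is found at the origin, where the poles 1/z and -1/z cancel.\<close>

lemma \<zeta>_uminus:
  assumes "z \<notin> L" shows "\<zeta> (- z) = - \<zeta> z"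
proof -
  have der: "((\<lambda>z. \<zeta> z + \<zeta> (- z)) has_field_derivative 0) (at w)" if "w \<in> - L" for w
  proof -
    have "((\<lambda>z. \<zeta> z + \<zeta> (- z)) has_field_derivative (- \<pp> w + - \<pp> (- w) * (- 1))) (at w)"
    proof (rule DERIV_add)
      show "(\<zeta> has_field_derivative - \<pp> w) (at w)" using that by (intro \<zeta>_DERIV) simp
      show "((\<lambda>z. \<zeta> (- z)) has_field_derivative - \<pp> (- w) * - 1) (at w)"
        using that by (intro DERIV_chain2[where g = uminus, OF \<zeta>_DERIV DERIV_minus[OF DERIV_ident]]) simp
    qed
    then show ?thesis using that uminus_point(1)[of w] by simp
  qed
  have "(\<lambda>z. \<zeta> z + \<zeta> (- z)) constant_on - L"
    by (intro has_field_derivative_0_imp_constant_on der open_compl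
        countable_compl_connected_dense countable_lattice)
  then obtain k where k: "\<zeta> w + \<zeta> (- w) = k" if "w \<notin> L" for w
    unfolding constant_on_def by auto
  \<comment> \<open>This is the sum with its poles removed, as zeta is 1/z plus the logarithmic
    derivative of \<open>f\<close>; it is continuous at 0 with value 0.\<close>
  define g where "g z = deriv f z / f z + deriv f (- z) / f (- z)" for z
  have cont: "isCont f z" "isCont (deriv f) z" for z
  proof -
    have "deriv f holomorphic_on UNIV" by (intro holomorphic_deriv holomorphic open_UNIV)
    then have "continuous_on UNIV f" "continuous_on UNIV (deriv f)"
      by (auto intro!: holomorphic_on_imp_continuous_on holomorphic)
    then show "isCont f z" "isCont (deriv f) z" by (auto simp: continuous_on_eq_continuous_at)
  qed
  have neg: "isCont (\<lambda>z::complex. - z) 0" by simp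
  have "isCont (\<lambda>z. deriv f z / f z) 0"
    by (rule isCont_divide[OF cont(2) cont(1)]) (simp add: f_0)
  moreover have "isCont (\<lambda>z. deriv f (- z) / f (- z)) 0"
    by (rule isCont_divide[OF isCont_o2[OF neg cont(2)] isCont_o2[OF neg cont(1)]]) (simp add: f_0)
  ultimately have "isCont g 0"
    unfolding g_def[abs_def] by (rule isCont_add)
  then have "(g \<longlongrightarrow> 0) (at 0)"
    using f_0 deriv_f_0 unfolding isCont_def g_def by simp
  moreover have "\<forall>\<^sub>F z in at 0. g z = k"
  proof -
    have "\<forall>\<^sub>F z in at 0. f z \<noteq> 0"
      using cont(1)[of 0] f_0 unfolding isCont_def by (intro tendsto_imp_eventually_ne) auto
    then show ?thesis using eventually_at_ball'[OF zero_less_one, of 0 UNIV]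
    proof eventually_elim
      case (elim z)
      then have z: "z \<notin> L" "- z \<notin> L" "z \<noteq> 0" using wsigma_eq_0_iff[of z] by (auto simp: wsigma_eq)
      then have nz: "f z \<noteq> 0" "f (- z) \<noteq> 0" using \<sigma>_nz[of z] \<sigma>_nz[of "- z"] by (auto simp: wsigma_eq)
      have "\<zeta> z + \<zeta> (- z) = g z"
      proof -
        have split: "(u + x * v) / (x * u) = 1 / x + v / u" if "x \<noteq> 0" "u \<noteq> 0" for u v x :: complex
          using that by (simp add: add_divide_distrib)
        show ?thesis
          using split[OF z(3) nz(1), of "deriv f z"] split[of "- z", OF _ nz(2), of "deriv f (- z)"] z(3)
          unfolding \<zeta>_def g_def wsigma_derivs wsigma_eq by simp
      qed
      then show ?case using k[OF z(1)] by simp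
    qed
  qed
  then have "(g \<longlongrightarrow> k) (at 0)" by (rule tendsto_eventually)
  ultimately have "k = 0" using tendsto_unique[of "at (0::complex)"] by (metis at_neq_bot)
  then show ?thesis using k[OF assms] by (simp add: add_eq_0_iff)
qed

text \<open>Since zeta is odd, the quotient of both sides is constant. Sigma vanishes at 0, so the
  constant is determined from the derivative there: the identity is first extended over the lattice
  by continuity, then differentiated, with \<sigma>'(0) = 1.\<close>

lemma \<sigma>_uminus: "\<sigma> (- z) = - \<sigma> z"
proof (cases "z \<in> L")
  case True
  then show ?thesis using wsigma_eq_0_iff[of z] wsigma_eq_0_iff[of "- z"] by simp
next
  case False
  have der: "((\<lambda>z. \<sigma> (- z) / \<sigma> z) has_field_derivative 0) (at w)" if "w \<in> - L" for w
  proof -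
    have nz: "\<sigma> w \<noteq> 0" "\<sigma> (- w) \<noteq> 0" using that \<sigma>_nz by auto
    have "((\<lambda>z. \<sigma> (- z) / \<sigma> z) has_field_derivative
        ((deriv \<sigma> (- w) * (- 1)) * \<sigma> w - \<sigma> (- w) * deriv \<sigma> w) / (\<sigma> w * \<sigma> w)) (at w)"
      by (intro DERIV_divide DERIV_chain2[OF \<sigma>_DERIV(1) DERIV_minus[OF DERIV_ident]] \<sigma>_DERIV nz)
    moreover have "deriv \<sigma> (- w) = - (deriv \<sigma> w / \<sigma> w) * \<sigma> (- w)"
      using \<zeta>_uminus[of w] that nz by (simp add: \<zeta>_def field_simps)
    then have "(deriv \<sigma> (- w) * (- 1)) * \<sigma> w - \<sigma> (- w) * deriv \<sigma> w = 0"
      using nz by simp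
    ultimately show ?thesis by simp
  qed
  have "(\<lambda>z. \<sigma> (- z) / \<sigma> z) constant_on - L"
    by (intro has_field_derivative_0_imp_constant_on der open_compl
        countable_compl_connected_dense countable_lattice)
  then obtain c where c: "\<sigma> (- w) / \<sigma> w = c" if "w \<notin> L" for w
    unfolding constant_on_def by auto
  have eq: "\<sigma> (- w) - c * \<sigma> w = 0" if "w \<in> - L" for w
    using c[of w] that \<sigma>_nz[of w] by (auto simp: field_simps)
  define h where "h w = \<sigma> (- w) - c * \<sigma> w" for w
  have dh: "(h has_field_derivative (deriv \<sigma> (- w) * (- 1) - c * deriv \<sigma> w)) (at w)" for w
    unfolding h_def[abs_def]
    by (intro DERIV_diff DERIV_cmult DERIV_chain2[OF \<sigma>_DERIV(1) DERIV_minus[OF DERIV_ident]] \<sigma>_DERIV)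
  have "continuous_on (closure (- L)) h"
    by (rule continuous_at_imp_continuous_on) (use dh DERIV_isCont in blast)
  then have "h w = 0" for w
    using countable_compl_connected_dense[OF countable_lattice] eq
    by (intro continuous_constant_on_closure[of "- L" h 0 w]) (auto simp: h_def)
  then have "h = (\<lambda>_. 0)" by blast
  then have "deriv \<sigma> (- 0) * (- 1) - c * deriv \<sigma> 0 = 0"
    using dh[of 0] DERIV_unique[OF _ DERIV_const] by metis
  then have "c = - 1" by (simp add: deriv_wsigma_0)
  then have "\<sigma> (- z) + \<sigma> z = 0" using eq[of z] False by simp
  then show ?thesis by (simp only: eq_neg_iff_add_eq_0)
qed

text \<open>The left side is the derivative in a of zeta(a+b) + zeta(a-b) - 2 zeta(a) + \<wp>'(a) /
  (\<wp>(b) - \<wp>(a)). Adding the addition laws for a + b and a - b leaves only squares of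
  derivatives, and the curve equation turns these into polynomials in the abscissae.\<close>

lemma addition_identity:
  assumes a: "a \<notin> L" "a + b \<notin> L" "a - b \<notin> L" "2 * a \<notin> L" "b \<notin> L" and ne: "\<pp> a \<noteq> \<pp> b"
  shows "- \<pp> (a + b) - \<pp> (a - b) + 2 * \<pp> a
    + (deriv \<pp>' a * (\<pp> b - \<pp> a) + (\<pp>' a)\<^sup>2) / (\<pp> b - \<pp> a)\<^sup>2 = 0"
proof -
  define x where "x = xc a"
  define y where "y = xc b"
  define s where "s = \<pp>' a"
  define t where "t = \<pp>' b"
  have px: "\<pp> z = xc z + b\<^sub>2 E / 12" for z by (simp add: xc_def)
  define d where "d = y - x"
  have d: "\<pp> b - \<pp> a = d" by (simp add: px x_def y_def d_def)
  have dnz: "d \<noteq> 0" using ne d by auto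
  have plus: "xc (a + b) = ((t - s) / d)\<^sup>2 / 4 - b\<^sub>2 E / 4 - x - y"
    using wp_addition[of a b] a ne d by (simp add: x_def y_def s_def t_def)
  have minus: "xc (a - b) = ((- t - s) / d)\<^sup>2 / 4 - b\<^sub>2 E / 4 - x - y"
    using wp_addition[of a "- b"] a ne d uminus_point[of b] xc_def[of b] xc_def[of "- b"]
    by (simp add: x_def y_def s_def t_def)
  have s2: "deriv \<pp>' a = 6 * x\<^sup>2 + b\<^sub>2 E * x + b\<^sub>4 E" using wp_deriv2 a by (simp add: x_def)
  have "s\<^sup>2 = 4 * x ^ 3 + b\<^sub>2 E * x\<^sup>2 + 2 * b\<^sub>4 E * x + b\<^sub>6 E"
    "t\<^sup>2 = 4 * y ^ 3 + b\<^sub>2 E * y\<^sup>2 + 2 * b\<^sub>4 E * y + b\<^sub>6 E"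
    using curve_equation a by (simp_all add: s_def t_def x_def y_def)
  then have "(b\<^sub>2 E + 8 * x + 4 * y) * d\<^sup>2 + (s\<^sup>2 - t\<^sup>2) + 2 * (6 * x\<^sup>2 + b\<^sub>2 E * x + b\<^sub>4 E) * d = 0"
    unfolding d_def by (simp add: power2_eq_square power3_eq_cube algebra_simps)
  moreover have "(b\<^sub>2 E / 2 + 4 * x + 2 * y) * d\<^sup>2 + (s\<^sup>2 - t\<^sup>2) / 2 + (6 * x\<^sup>2 + b\<^sub>2 E * x + b\<^sub>4 E) * d
    = ((b\<^sub>2 E + 8 * x + 4 * y) * d\<^sup>2 + (s\<^sup>2 - t\<^sup>2) + 2 * (6 * x\<^sup>2 + b\<^sub>2 E * x + b\<^sub>4 E) * d) / 2"
    by (simp add: add_divide_distrib diff_divide_distrib algebra_simps)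
  ultimately have poly: "(b\<^sub>2 E / 2 + 4 * x + 2 * y) * d\<^sup>2 + (s\<^sup>2 - t\<^sup>2) / 2 + (6 * x\<^sup>2 + b\<^sub>2 E * x + b\<^sub>4 E) * d = 0"
    by simp
  have "((t - s) / d)\<^sup>2 / 4 + ((- t - s) / d)\<^sup>2 / 4 = (s\<^sup>2 + t\<^sup>2) / (2 * d\<^sup>2)"
    using dnz by (simp add: power_divide field_simps power2_eq_square)
  then have sum: "xc (a + b) + xc (a - b) = (s\<^sup>2 + t\<^sup>2) / (2 * d\<^sup>2) - b\<^sub>2 E / 2 - 2 * x - 2 * y"
    unfolding plus minus by (simp add: algebra_simps)
  have "- \<pp> (a + b) - \<pp> (a - b) + 2 * \<pp> a = - (xc (a + b) + xc (a - b)) + 2 * x"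
    by (simp add: px x_def)
  also have "\<dots> = (b\<^sub>2 E / 2 + 4 * x + 2 * y) - (s\<^sup>2 + t\<^sup>2) / (2 * d\<^sup>2)"
    unfolding sum by (simp add: algebra_simps)
  finally have 1: "- \<pp> (a + b) - \<pp> (a - b) + 2 * \<pp> a = (b\<^sub>2 E / 2 + 4 * x + 2 * y) - (s\<^sup>2 + t\<^sup>2) / (2 * d\<^sup>2)" .
  have "(b\<^sub>2 E / 2 + 4 * x + 2 * y) - (s\<^sup>2 + t\<^sup>2) / (2 * d\<^sup>2) + ((6 * x\<^sup>2 + b\<^sub>2 E * x + b\<^sub>4 E) * d + s\<^sup>2) / d\<^sup>2
     = ((b\<^sub>2 E / 2 + 4 * x + 2 * y) * d\<^sup>2 + (s\<^sup>2 - t\<^sup>2) / 2 + (6 * x\<^sup>2 + b\<^sub>2 E * x + b\<^sub>4 E) * d) / d\<^sup>2"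
    using dnz by (simp add: add_divide_distrib diff_divide_distrib)
  then show ?thesis unfolding 1 d s2 s_def[symmetric] poly by simp
qed

text \<open>Writing the right side with \<open>D\<close> makes both sides entire in a. They can then
  be compared at a = 0, although \<wp> has a pole there.\<close>

lemma \<sigma>_addition_generic:
  assumes b: "b \<notin> L"
  shows "\<sigma> (a + b) * \<sigma> (a - b) = D b * (\<sigma> a)\<^sup>2 - D a * (\<sigma> b)\<^sup>2"
proof -
  \<comment> \<open>The exceptional set consists of the zeros of the sigma factors and of the
    half-periods, at which \<open>wp_deriv2\<close> says nothing.\<close>
  define S where "S = L \<union> (\<lambda>z. z - b) ` L \<union> (\<lambda>z. z + b) ` L \<union> (\<lambda>z. z / 2) ` L"
  have S: "a \<in> - S \<longleftrightarrow> a \<notin> L \<and> a + b \<notin> L \<and> a - b \<notin> L \<and> 2 * a \<notin> L" for a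
  proof -
    have "a \<in> (\<lambda>z. z - b) ` L \<longleftrightarrow> a + b \<in> L" "a \<in> (\<lambda>z. z + b) ` L \<longleftrightarrow> a - b \<in> L"
      by (auto simp: image_iff intro: bexI[of _ "a + b"] bexI[of _ "a - b"])
    moreover have "a \<in> (\<lambda>z. z / 2) ` L \<longleftrightarrow> 2 * a \<in> L"
    proof
      assume "2 * a \<in> L"
      then show "a \<in> (\<lambda>z. z / 2) ` L" by (rule rev_image_eqI) simp
    qed auto
    ultimately show ?thesis by (auto simp: S_def)
  qed
  have count: "countable S" unfolding S_def using countable_lattice by auto
  have conts: "continuous_on UNIV \<sigma>" "continuous_on UNIV D"
    by (intro holomorphic_on_imp_continuous_on holomorphic_wsigma holomorphic_\<sigma>_derivs)+
  have comp: "continuous_on UNIV (\<lambda>a. \<sigma> (g a))" if "continuous_on UNIV g" for g :: "complex \<Rightarrow> complex"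
    by (rule continuous_on_compose2[OF conts(1) that]) simp
  have shifts: "continuous_on UNIV (\<lambda>a. a + b)" "continuous_on UNIV (\<lambda>a. a - b)"
    "continuous_on UNIV (\<lambda>a::complex. 2 * a)" "continuous_on UNIV (\<lambda>a::complex. a)"
    by (intro continuous_intros)+
  have "open {a. \<sigma> a \<noteq> 0 \<and> \<sigma> (a + b) \<noteq> 0 \<and> \<sigma> (a - b) \<noteq> 0 \<and> \<sigma> (2 * a) \<noteq> 0}"
    by (intro open_Collect_conj open_Collect_neq continuous_on_const comp shifts)
  also have "{a. \<sigma> a \<noteq> 0 \<and> \<sigma> (a + b) \<noteq> 0 \<and> \<sigma> (a - b) \<noteq> 0 \<and> \<sigma> (2 * a) \<noteq> 0} = - S"
    unfolding wsigma_eq_0_iff using S by blast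
  finally have op: "open (- S)" .
  have conn: "connected (- S)" and dense: "closure (- S) = UNIV"
    using countable_compl_connected_dense[OF count] by auto
  have ne: "\<pp> a \<noteq> \<pp> b" if "a \<in> - S" for a
    using wp_eq_imp[of a b] that b S by blast
  \<comment> \<open>This is the logarithmic derivative of \<open>F / G\<close> for the two sides
    \<open>F\<close> and \<open>G\<close> introduced below.\<close>
  define K where "K a = \<zeta> (a + b) + \<zeta> (a - b) - 2 * \<zeta> a + \<pp>' a / (\<pp> b - \<pp> a)" for a
  have K': "(K has_field_derivative 0) (at a)" if a: "a \<in> - S" for a
  proof -
    have a': "a \<notin> L" "a + b \<notin> L" "a - b \<notin> L" "2 * a \<notin> L" using a S[of a] by blast+
    have quot: "((\<lambda>a. \<pp>' a / (\<pp> b - \<pp> a)) has_field_derivative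
       (deriv \<pp>' a * (\<pp> b - \<pp> a) - \<pp>' a * (0 - \<pp>' a)) / ((\<pp> b - \<pp> a) * (\<pp> b - \<pp> a))) (at a)"
    proof (rule DERIV_divide)
      show "(\<pp>' has_field_derivative deriv \<pp>' a) (at a)" by (rule wp_DERIV[OF a'(1)])
      show "((\<lambda>a. \<pp> b - \<pp> a) has_field_derivative 0 - \<pp>' a) (at a)"
        by (rule DERIV_diff[OF DERIV_const wp_DERIV(1)[OF a'(1)]])
      show "\<pp> b - \<pp> a \<noteq> 0" using ne[OF a] by simp
    qed
    have plus: "((\<lambda>a. \<zeta> (a + b)) has_field_derivative - \<pp> (a + b)) (at a)"
      using \<zeta>_DERIV[OF a'(2)] by (simp only: DERIV_shift)
    have minus: "((\<lambda>a. \<zeta> (a - b)) has_field_derivative - \<pp> (a - b)) (at a)"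
      using \<zeta>_DERIV[OF a'(3)] DERIV_shift[of \<zeta> "- \<pp> (a - b)" a "- b"] by simp
    have twice: "((\<lambda>a. 2 * \<zeta> a) has_field_derivative 2 * - \<pp> a) (at a)"
      by (rule DERIV_cmult[OF \<zeta>_DERIV[OF a'(1)]])
    have "(K has_field_derivative (- \<pp> (a + b) + - \<pp> (a - b) - 2 * - \<pp> a +
       (deriv \<pp>' a * (\<pp> b - \<pp> a) - \<pp>' a * (0 - \<pp>' a)) / ((\<pp> b - \<pp> a) * (\<pp> b - \<pp> a)))) (at a)"
      unfolding K_def[abs_def] by (intro DERIV_add DERIV_diff plus minus twice quot)
    moreover have "- \<pp> (a + b) + - \<pp> (a - b) - 2 * - \<pp> a +
       (deriv \<pp>' a * (\<pp> b - \<pp> a) - \<pp>' a * (0 - \<pp>' a)) / ((\<pp> b - \<pp> a) * (\<pp> b - \<pp> a)) = 0"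
    proof -
      have "- A + - B - 2 * - C + (u * d - s * (0 - s)) / (d * d) = - A - B + 2 * C + (u * d + s\<^sup>2) / d\<^sup>2"
        for A B C u d s :: complex by (simp add: power2_eq_square)
      then show ?thesis using addition_identity[OF a' b ne[OF a]] by (simp only:)
    qed
    ultimately show ?thesis by (simp only:)
  qed
  have "K constant_on - S"
    by (rule has_field_derivative_0_imp_constant_on[OF K' conn op])
  then obtain k where k: "\<And>a. a \<in> - S \<Longrightarrow> K a = k" unfolding constant_on_def by blast
  have "- S \<noteq> {}" using dense by auto
  then obtain a0 where a0: "a0 \<in> - S" by blast
  have sym: "- a \<in> - S" if "a \<in> - S" for a
  proof -
    have "- a + b = - (a - b)" "- a - b = - (a + b)" "2 * - a = - (2 * a)" by auto
    then show ?thesis using that unfolding S by (simp only: lattice_uminus_iff) simp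
  qed
  have "K (- a0) = - K a0"
  proof -
    have a': "a0 \<notin> L" "a0 + b \<notin> L" "a0 - b \<notin> L" using a0 S[of a0] by blast+
    have "\<zeta> (- a0 + b) = - \<zeta> (a0 - b)" "\<zeta> (- a0 - b) = - \<zeta> (a0 + b)"
      using \<zeta>_uminus[OF a'(2)] \<zeta>_uminus[OF a'(3)] by (simp_all add: algebra_simps)
    then show ?thesis
      using \<zeta>_uminus[OF a'(1)] uminus_point[OF a'(1)] by (simp add: K_def)
  qed
  then have "k = 0" using k[OF a0] k[OF sym[OF a0]] by (simp add: eq_neg_iff_add_eq_0)
  define F where "F a = \<sigma> (a + b) * \<sigma> (a - b)" for a
  define G where "G a = D b * (\<sigma> a)\<^sup>2 - D a * (\<sigma> b)\<^sup>2" for a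
  have G_eq: "G a = (\<sigma> a)\<^sup>2 * (\<sigma> b)\<^sup>2 * (\<pp> b - \<pp> a)" if "a \<notin> L" for a
    using that b \<sigma>_nz[OF that] \<sigma>_nz[OF b] by (simp add: G_def wp_eq_D field_simps)
  have G_nz: "G a \<noteq> 0" if "a \<in> - S" for a
  proof -
    have "a \<notin> L" using that S[of a] by blast
    then show ?thesis using ne[OF that] \<sigma>_nz[of a] \<sigma>_nz[OF b] by (simp add: G_eq)
  qed
  have F': "(F has_field_derivative F a * (\<zeta> (a + b) + \<zeta> (a - b))) (at a)" if a: "a \<in> - S" for a
  proof -
    have nz: "\<sigma> (a + b) \<noteq> 0" "\<sigma> (a - b) \<noteq> 0"
      using \<sigma>_nz[of "a + b"] \<sigma>_nz[of "a - b"] a S[of a] by blast+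
    have plus: "((\<lambda>a. \<sigma> (a + b)) has_field_derivative deriv \<sigma> (a + b)) (at a)"
      using \<sigma>_DERIV(1)[of "a + b"] by (simp only: DERIV_shift)
    have minus: "((\<lambda>a. \<sigma> (a - b)) has_field_derivative deriv \<sigma> (a - b)) (at a)"
      using \<sigma>_DERIV(1)[of "a - b"] DERIV_shift[of \<sigma> "deriv \<sigma> (a - b)" a "- b"] by simp
    have "u' * v + v' * u = u * v * (u' / u + v' / v)" if "u \<noteq> 0" "v \<noteq> 0" for u u' v v' :: complex
    proof -
      have "u * v * (u' / u + v' / v) = (u * (u' / u)) * v + (v * (v' / v)) * u"
        by (simp only: distrib_left mult_ac)
      then show ?thesis using that by simp
    qed
    from this[OF nz] show ?thesis
      using DERIV_mult[OF plus minus] unfolding F_def[abs_def] \<zeta>_def by (simp only:)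
  qed
  have G': "(G has_field_derivative G a * (2 * \<zeta> a - \<pp>' a / (\<pp> b - \<pp> a))) (at a)" if a: "a \<in> - S" for a
  proof -
    have a': "a \<notin> L" using a S[of a] by blast
    have nz: "\<sigma> a \<noteq> 0" "\<sigma> b \<noteq> 0" "\<pp> b - \<pp> a \<noteq> 0" using \<sigma>_nz[OF a'] \<sigma>_nz[OF b] ne[OF a] by simp_all
    have "((\<lambda>a. (\<sigma> a)\<^sup>2 * (\<sigma> b)\<^sup>2) has_field_derivative 2 * \<sigma> a * deriv \<sigma> a * (\<sigma> b)\<^sup>2) (at a)"
      by (auto intro!: derivative_eq_intros \<sigma>_DERIV)
    from DERIV_mult[OF this DERIV_diff[OF DERIV_const wp_DERIV(1)[OF a']], of "\<pp> b"]
    have "((\<lambda>a. (\<sigma> a)\<^sup>2 * (\<sigma> b)\<^sup>2 * (\<pp> b - \<pp> a)) has_field_derivative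
        (2 * \<sigma> a * deriv \<sigma> a * (\<sigma> b)\<^sup>2 * (\<pp> b - \<pp> a) - (\<sigma> a)\<^sup>2 * (\<sigma> b)\<^sup>2 * \<pp>' a)) (at a)"
      by (simp add: mult_ac)
    then have "(G has_field_derivative
        (2 * \<sigma> a * deriv \<sigma> a * (\<sigma> b)\<^sup>2 * (\<pp> b - \<pp> a) - (\<sigma> a)\<^sup>2 * (\<sigma> b)\<^sup>2 * \<pp>' a)) (at a)"
      by (rule has_field_derivative_transform_within_open[OF _ open_compl]) (use a' in \<open>auto simp: G_eq\<close>)
    moreover have "2 * \<sigma> a * deriv \<sigma> a * (\<sigma> b)\<^sup>2 * (\<pp> b - \<pp> a) - (\<sigma> a)\<^sup>2 * (\<sigma> b)\<^sup>2 * \<pp>' a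
       = G a * (2 * \<zeta> a - \<pp>' a / (\<pp> b - \<pp> a))"
    proof -
      have "2 * u * u' * v\<^sup>2 * d - u\<^sup>2 * v\<^sup>2 * e = u\<^sup>2 * v\<^sup>2 * d * (2 * (u' / u) - e / d)"
        if "u \<noteq> 0" "d \<noteq> 0" for u u' v d e :: complex
        using that by (simp add: field_simps power2_eq_square)
      from this[OF nz(1,3)] show ?thesis unfolding G_eq[OF a'] \<zeta>_def by (simp only:)
    qed
    ultimately show ?thesis by simp
  qed
  have "((\<lambda>a. F a / G a) has_field_derivative 0) (at a)" if a: "a \<in> - S" for a
  proof -
    have "((\<lambda>a. F a / G a) has_field_derivative
      (F a * (\<zeta> (a + b) + \<zeta> (a - b)) * G a - F a * (G a * (2 * \<zeta> a - \<pp>' a / (\<pp> b - \<pp> a)))) / (G a * G a)) (at a)"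
      by (intro DERIV_divide F' G' a G_nz)
    moreover have "F a * (\<zeta> (a + b) + \<zeta> (a - b)) * G a - F a * (G a * (2 * \<zeta> a - \<pp>' a / (\<pp> b - \<pp> a)))
      = F a * G a * K a"
      by (simp add: K_def algebra_simps)
    ultimately show ?thesis using k[OF a] \<open>k = 0\<close> by simp
  qed
  then have "(\<lambda>a. F a / G a) constant_on - S"
    by (rule has_field_derivative_0_imp_constant_on[OF _ conn op])
  then obtain q where q: "\<And>a. a \<in> - S \<Longrightarrow> F a / G a = q" unfolding constant_on_def by blast
  have cont: "continuous_on UNIV (\<lambda>a. F a - q * G a)"
    unfolding F_def G_def
    by (intro continuous_on_diff continuous_on_mult continuous_on_power continuous_on_const
        comp[OF shifts(1)] comp[OF shifts(2)] conts)
  have all: "F a - q * G a = 0" for a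
  proof (rule continuous_constant_on_closure[of "- S" "\<lambda>a. F a - q * G a"])
    show "F a - q * G a = 0" if "a \<in> - S" for a
      using q[OF that] G_nz[OF that] by (simp add: field_simps)
  qed (use cont dense in auto)
  have "\<sigma> 0 = 0" by (simp add: wsigma_eq)
  \<comment> \<open>As D(0) = 1, both sides take the same nonzero value at a = 0, which fixes the
    constant ratio.\<close>
  then have "F 0 = - (\<sigma> b)\<^sup>2" "G 0 = - (\<sigma> b)\<^sup>2"
    by (simp_all add: F_def G_def D_def \<sigma>_uminus deriv_wsigma_0 power2_eq_square)
  then have "q = 1" using all[of 0] \<sigma>_nz[OF b] by auto
  then show ?thesis using all[of a] by (simp add: F_def G_def)
qed

text \<open>Both sides are antisymmetric in a and b, so a period b can be exchanged with a
  non-period a; if both are periods, every term vanishes.\<close>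

lemma \<sigma>_addition: "\<sigma> (a + b) * \<sigma> (a - b) = D b * (\<sigma> a)\<^sup>2 - D a * (\<sigma> b)\<^sup>2"
proof (cases "b \<in> L")
  case True
  show ?thesis
  proof (cases "a \<in> L")
    case True
    with \<open>b \<in> L\<close> have "\<sigma> (a + b) = 0" "\<sigma> a = 0" "\<sigma> b = 0"
      using lattice_add by (simp_all add: wsigma_eq_0_iff)
    then show ?thesis by simp
  next
    case False
    have "\<sigma> (a - b) = - \<sigma> (b - a)" using \<sigma>_uminus[of "b - a"] by simp
    then show ?thesis
      using \<sigma>_addition_generic[OF False, of b] by (simp add: add.commute)
  qed
qed (rule \<sigma>_addition_generic)

text \<open>For a = b the addition formula reads 0 = 0. Its derivative in a at that point isolates
  \<sigma>(2z), because \<sigma>(0) = 0 and \<sigma>'(0) = 1.\<close>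

lemma \<sigma>_double:
  assumes "z \<notin> L" shows "\<sigma> (2 * z) = - \<pp>' z * (\<sigma> z) ^ 4"
proof -
  have "((\<lambda>a. \<sigma> (a + z) * \<sigma> (a - z)) has_field_derivative (deriv \<sigma> (z + z) * 1 * \<sigma> (z - z) + deriv \<sigma> (z - z) * 1 * \<sigma> (z + z))) (at z)"
  proof (rule DERIV_mult)
    show "((\<lambda>a. \<sigma> (a + z)) has_field_derivative deriv \<sigma> (z + z) * 1) (at z)"
      "((\<lambda>a. \<sigma> (a - z)) has_field_derivative deriv \<sigma> (z - z) * 1) (at z)"
      using DERIV_shift[of \<sigma> _ z z] DERIV_shift[of \<sigma> _ z "- z"] \<sigma>_DERIV(1)[of "z + z"] \<sigma>_DERIV(1)[of "z - z"]
      by simp_all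
  qed
  moreover have "((\<lambda>a. D z * (\<sigma> a)\<^sup>2 - D a * (\<sigma> z)\<^sup>2) has_field_derivative (D z * (2 * \<sigma> z * deriv \<sigma> z) - deriv D z * (\<sigma> z)\<^sup>2)) (at z)"
    by (auto intro!: derivative_eq_intros \<sigma>_DERIV)
  ultimately have "deriv \<sigma> (z + z) * 1 * \<sigma> (z - z) + deriv \<sigma> (z - z) * 1 * \<sigma> (z + z) = D z * (2 * \<sigma> z * deriv \<sigma> z) - deriv D z * (\<sigma> z)\<^sup>2"
    unfolding \<sigma>_addition by (rule DERIV_unique)
  moreover have "\<sigma> 0 = 0" by (simp add: wsigma_eq)
  then have "deriv \<sigma> (z + z) * 1 * \<sigma> (z - z) + deriv \<sigma> (z - z) * 1 * \<sigma> (z + z) = \<sigma> (2 * z)"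
    by (simp add: deriv_wsigma_0)
  moreover have "D z * (2 * \<sigma> z * deriv \<sigma> z) - deriv D z * (\<sigma> z)\<^sup>2 = - (deriv D z * \<sigma> z - 2 * D z * deriv \<sigma> z) * \<sigma> z"
    by (simp add: power2_eq_square algebra_simps)
  ultimately have "\<sigma> (2 * z) = - (deriv D z * \<sigma> z - 2 * D z * deriv \<sigma> z) * \<sigma> z"
    by simp
  also have "\<dots> = - \<pp>' z * (\<sigma> z) ^ 4"
    unfolding wp_deriv_eq[OF assms, symmetric] by (simp add: eval_nat_numeral)
  finally show ?thesis .
qed

end

section \<open>Elliptic nets from the sigma function\<close>

text \<open>The doubling formulas recover every value from smaller indices, except at -1, -2 and 3,
  where they are tautologies or circular. The first two are therefore initial values, and A(3) comes
  from the Somos step, with division by A(-1). Negative indices are included because the net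
  relation quantifies over all integers.\<close>

lemma net_in_Rats:
  fixes A B :: "int \<Rightarrow> 'a::field_char_0"
  assumes net: "net_relation B A" and B: "\<And>n. B n \<in> \<rat>"
    and A: "A 0 = 1" "A 1 = 1" "A (-1) \<in> \<rat>" "A (-1) \<noteq> 0" "A 2 \<in> \<rat>" "A (-2) \<in> \<rat>" "B 1 = 1"
  shows "A n \<in> \<rat>"
proof (induction "nat \<bar>n\<bar>" arbitrary: n rule: less_induct)
  case less
  then have IH: "A i \<in> \<rat>" if "\<bar>i\<bar> < \<bar>n\<bar>" for i using that by simp
  note N = net_relationD(1)[OF net]
  consider "n = 0" | "n = 1" | "n = 2" | "n = -1" | "n = -2" | "n = 3"
    | h where "n = 2 * h" "\<bar>h\<bar> \<ge> 2" | h where "n = 2 * h + 1" "h \<ge> 2 \<or> h \<le> -2"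
  proof -
    have "n = 0 \<or> n = 1 \<or> n = 2 \<or> n = -1 \<or> n = -2 \<or> n = 3 \<or> n = 2 * (n div 2) \<and> \<bar>n div 2\<bar> \<ge> 2
      \<or> n = 2 * (n div 2) + 1 \<and> (n div 2 \<ge> 2 \<or> n div 2 \<le> -2)"
      by presburger
    then show thesis using that(1-6) that(7)[of "n div 2"] that(8)[of "n div 2"] by blast
  qed
  then show ?case
  proof cases
    case 6
    have "A 3 = ((B 2)\<^sup>2 * A 2 * A 0 - B 3 * B 1 * (A 1)\<^sup>2) / A (-1)"
      using N[of 1 2] A by (simp add: field_simps)
    also have "\<dots> \<in> \<rat>"
      using A B by (intro Rats_divide Rats_diff Rats_mult Rats_power) auto
    finally show ?thesis using 6 by simp
  next
    case (7 h)
    have "A n = (B h)\<^sup>2 * A (h + 1) * A (h - 1) - B (h + 1) * B (h - 1) * (A h)\<^sup>2"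
      using N[of h h] A 7 by simp
    also have "\<dots> \<in> \<rat>"
      using B 7 by (intro Rats_diff Rats_mult Rats_power IH) auto
    finally show ?thesis .
  next
    case (8 h)
    have "A n = (B h)\<^sup>2 * A (h + 2) * A h - B (h + 1) * B (h - 1) * (A (h + 1))\<^sup>2"
      using N[of "h + 1" h] A 8 by (simp add: algebra_simps)
    also have "\<dots> \<in> \<rat>"
      using B 8 by (intro Rats_diff Rats_mult Rats_power IH) auto
    finally show ?thesis .
  qed (use A in auto)
qed

lemma eds_in_Rats:
  fixes B :: "int \<Rightarrow> 'a::field_char_0"
  assumes net: "net_relation B B" and odd: "\<And>n. B (- n) = - B n"
    and B: "B 1 = 1" "B 2 \<in> \<rat>" "B 2 \<noteq> 0" "B 3 \<in> \<rat>" "B 4 \<in> \<rat>"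
  shows "B n \<in> \<rat>"
proof (induction "nat \<bar>n\<bar>" arbitrary: n rule: less_induct)
  case less
  then have IH: "B i \<in> \<rat>" if "\<bar>i\<bar> < \<bar>n\<bar>" for i using that by simp
  note N = net_relationD(1)[OF net]
  have B0: "B 0 = 0" using odd[of 0] by simp
  have pos: "B m \<in> \<rat>" if m: "m \<ge> 0" "\<bar>m\<bar> = \<bar>n\<bar>" for m
  proof -
    consider "m = 0" | "m = 1" | "m = 2" | "m = 3" | "m = 4"
      | h where "m = 2 * h" "h \<ge> 3" | h where "m = 2 * h + 1" "h \<ge> 2"
    proof -
      have "m = 0 \<or> m = 1 \<or> m = 2 \<or> m = 3 \<or> m = 4 \<or> m = 2 * (m div 2) \<and> m div 2 \<ge> 3
        \<or> m = 2 * (m div 2) + 1 \<and> m div 2 \<ge> 2"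
        using m by presburger
      then show thesis using that(1-5) that(6)[of "m div 2"] that(7)[of "m div 2"] by blast
    qed
    then show ?thesis
    proof cases
      case (6 h)
      have "B m = ((B (h - 1))\<^sup>2 * B (h + 2) * B h - B h * B (h - 2) * (B (h + 1))\<^sup>2) / B 2"
        using N[of "h + 1" "h - 1"] B 6 by (simp add: field_simps)
      also have "\<dots> \<in> \<rat>"
        using B 6 m by (intro Rats_divide Rats_diff Rats_mult Rats_power IH) auto
      finally show ?thesis .
    next
      case (7 h)
      have "B m = (B h)\<^sup>2 * B (h + 2) * B h - B (h + 1) * B (h - 1) * (B (h + 1))\<^sup>2"
        using N[of "h + 1" h] B 7 by (simp add: algebra_simps)
      also have "\<dots> \<in> \<rat>"
        using 7 m by (intro Rats_diff Rats_mult Rats_power IH) auto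
      finally show ?thesis .
    qed (use B B0 in auto)
  qed
  show ?case
    using pos[of n] pos[of "- n"] odd[of n] by (cases "n \<ge> 0") auto
qed

lemma net_relation_of_rat:
  fixes A B :: "int \<Rightarrow> 'a::field_char_0"
  assumes "net_relation B A" "\<And>n. of_rat (b n) = B n" "\<And>n. of_rat (a n) = A n"
  shows "net_relation b a"
proof -
  have "(of_rat x :: 'a) = of_rat y \<Longrightarrow> x = y" for x y by simp
  then show ?thesis
    using net_relationD[OF assms(1)] unfolding net_relation_def
    by (intro conjI allI; simp only: of_rat_mult of_rat_diff of_rat_power assms(2,3))
qed

section \<open>The three-term relation and the nets of sigma values\<close>

context uniformization
begin

text \<open>By the addition formula each product \<sigma>(u+v) \<sigma>(u-v) is the 2 by 2
  determinant of the vectors (\<sigma>^2, D) at u and v. The claim is the Pluecker relation for four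
  vectors in the plane.\<close>

lemma three_term:
  "\<sigma> (u + v) * \<sigma> (u - v) * \<sigma> (w + t) * \<sigma> (w - t) + \<sigma> (v + w) * \<sigma> (v - w) * \<sigma> (u + t) * \<sigma> (u - t)
   + \<sigma> (w + u) * \<sigma> (w - u) * \<sigma> (v + t) * \<sigma> (v - t) = 0"
proof -
  have "(\<sigma> (u + v) * \<sigma> (u - v)) * (\<sigma> (w + t) * \<sigma> (w - t)) + (\<sigma> (v + w) * \<sigma> (v - w)) * (\<sigma> (u + t) * \<sigma> (u - t))
   + (\<sigma> (w + u) * \<sigma> (w - u)) * (\<sigma> (v + t) * \<sigma> (v - t)) = 0"
    unfolding \<sigma>_addition by (simp add: algebra_simps)
  then show ?thesis by (simp only: mult.assoc)
qed

lemma sigma_net: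
  fixes z y :: complex
  defines "S \<equiv> \<lambda>n::int. \<sigma> (of_int n * z + y)" and "T \<equiv> \<lambda>n::int. \<sigma> (of_int n * z)"
  shows "S (n + m) * S (n - m) * (T 1)\<^sup>2 = (T m)\<^sup>2 * S (n + 1) * S (n - 1) - T (m + 1) * T (m - 1) * (S n)\<^sup>2"
    and "S (n + R) * S (n - 1) * T (R + 1) * T 2 - S (n - 1 + R) * S n * T (R + 2) * T 1 =
           S (n + R + 1) * S (n - 2) * T R * T 1"
    and "S (n + R) * S (n - 2) * T (R + 1) * T 3 - S (n - 2 + R) * S n * T (R + 3) * T 1 =
           S (n + R + 1) * S (n - 3) * T 2 * T R"
proof -
  have neg: "\<sigma> (- (of_int n * z) - y) = - S n" "\<sigma> (- (of_int n * z)) = - T n" for n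
    using \<sigma>_uminus[of "of_int n * z + y"] \<sigma>_uminus[of "of_int n * z"] by (simp_all add: S_def T_def)
  have id: "of_int n * z + y + of_int m * z = of_int (n + m) * z + y"
    "of_int n * z + y - of_int m * z = of_int (n - m) * z + y"
    "z + (of_int n * z + y) = of_int (n + 1) * z + y" "z - (of_int n * z + y) = - (of_int (n - 1) * z) - y"
    "of_int m * z + z = of_int (m + 1) * z" "of_int m * z - z = of_int (m - 1) * z" "z = of_int 1 * z" for n m
    by (simp_all add: algebra_simps)
  have "S (n + m) * S (n - m) * T 1 * T 1 + T (m + 1) * T (m - 1) * S n * S n - S (n + 1) * S (n - 1) * T m * T m = 0"
    using three_term[of "of_int n * z + y" "of_int m * z" z 0] unfolding id(1-6) add_0_right diff_0_right neg
    by (simp add: S_def T_def)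
  then show "S (n + m) * S (n - m) * (T 1)\<^sup>2 = (T m)\<^sup>2 * S (n + 1) * S (n - 1) - T (m + 1) * T (m - 1) * (S n)\<^sup>2"
    by (simp add: power2_eq_square algebra_simps)
next
  have neg: "\<sigma> (- w) = - \<sigma> w" for w by (rule \<sigma>_uminus)
  \<comment> \<open>The four arguments solve the linear system given by the wanted values of u + v,
    u - v, w + t and w - t. They are half-integral combinations of z, while all their sums and
    differences in the relation are integral ones; the third relation is obtained in the same
    way.\<close>
  define h where "h = z / 2"
  have z: "z = 2 * h" by (simp add: h_def)
  define u v w t where "u = (2 * of_int n - 1 + of_int R) * h + y" and "v = (of_int R + 1) * h"
    and "w = (of_int R + 3) * h" and "t = (of_int R - 1) * h"
  have eqs: "u + v = of_int (n + R) * z + y" "u - v = of_int (n - 1) * z + y" "w + t = of_int (R + 1) * z" "w - t = of_int 2 * z"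
    "v + w = of_int (R + 2) * z" "v - w = - (of_int 1 * z)" "u + t = of_int (n - 1 + R) * z + y" "u - t = of_int n * z + y"
    "w + u = of_int (n + R + 1) * z + y" "w - u = - (of_int (n - 2) * z + y)" "v + t = of_int R * z" "v - t = of_int 1 * z"
    unfolding u_def v_def w_def t_def z by (simp_all add: algebra_simps)
  show "S (n + R) * S (n - 1) * T (R + 1) * T 2 - S (n - 1 + R) * S n * T (R + 2) * T 1 =
           S (n + R + 1) * S (n - 2) * T R * T 1"
  proof -
    have "S (n + R) * S (n - 1) * T (R + 1) * T 2 + T (R + 2) * - T 1 * S (n - 1 + R) * S n
      + S (n + R + 1) * - S (n - 2) * T R * T 1 = 0"
      using three_term[of u v w t] unfolding eqs neg S_def T_def .
    then show ?thesis by (simp add: algebra_simps)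
  qed
next
  have neg: "\<sigma> (- w) = - \<sigma> w" for w by (rule \<sigma>_uminus)
  define h where "h = z / 2"
  have z: "z = 2 * h" by (simp add: h_def)
  define u v w t where "u = (2 * of_int n - 2 + of_int R) * h + y" and "v = (of_int R + 2) * h"
    and "w = (of_int R + 4) * h" and "t = (of_int R - 2) * h"
  have eqs: "u + v = of_int (n + R) * z + y" "u - v = of_int (n - 2) * z + y" "w + t = of_int (R + 1) * z" "w - t = of_int 3 * z"
    "v + w = of_int (R + 3) * z" "v - w = - (of_int 1 * z)" "u + t = of_int (n - 2 + R) * z + y" "u - t = of_int n * z + y"
    "w + u = of_int (n + R + 1) * z + y" "w - u = - (of_int (n - 3) * z + y)" "v + t = of_int R * z" "v - t = of_int 2 * z"
    unfolding u_def v_def w_def t_def z by (simp_all add: algebra_simps)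
  show "S (n + R) * S (n - 2) * T (R + 1) * T 3 - S (n - 2 + R) * S n * T (R + 3) * T 1 =
           S (n + R + 1) * S (n - 3) * T 2 * T R"
  proof -
    have "S (n + R) * S (n - 2) * T (R + 1) * T 3 + T (R + 3) * - T 1 * S (n - 2 + R) * S n
      + S (n + R + 1) * - S (n - 3) * T R * T 2 = 0"
      using three_term[of u v w t] unfolding eqs neg S_def T_def .
    then show ?thesis by (simp add: algebra_simps)
  qed
qed

text \<open>The normalizing factors are written as exponentials so that the exponents, quadratic in the
  index, can be compared by ring arithmetic.\<close>

lemma sigma_net_relation:
  fixes z y \<kappa> l g :: complex
  assumes g: "exp g = \<sigma> z"
  defines "B \<equiv> \<lambda>n::int. exp (- (of_int n)\<^sup>2 * g) * \<sigma> (of_int n * z)"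
    and "A \<equiv> \<lambda>n::int. \<kappa> * exp (of_int n * l - (of_int n)\<^sup>2 * g) * \<sigma> (of_int n * z + y)"
  shows "net_relation B A" "B 1 = 1"
proof -
  define S T where "S = (\<lambda>n::int. \<sigma> (of_int n * z + y))" and "T = (\<lambda>n::int. \<sigma> (of_int n * z))"
  define q r where "q n = exp (of_int n * l - (of_int n)\<^sup>2 * g)" and "r n = exp (- (of_int n)\<^sup>2 * g)" for n :: int
  have A: "A n = \<kappa> * q n * S n" and B: "B n = r n * T n" for n
    by (simp_all add: A_def B_def q_def r_def S_def T_def)
  have T1: "T 1 = exp g" using g by (simp add: T_def)
  show B1: "B 1 = 1" by (simp add: B r_def T1 flip: exp_add)
  show "net_relation B A"
    unfolding net_relation_def
  proof (intro conjI allI)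
    fix n m :: int
    define C where "C = q (n + m) * q (n - m) * exp (- 2 * g)"
    have c: "(r m)\<^sup>2 * q (n + 1) * q (n - 1) = C" "r (m + 1) * r (m - 1) * (q n)\<^sup>2 = C"
      unfolding C_def q_def r_def by (simp_all add: power2_eq_square algebra_simps flip: exp_add)
    have e: "q (n + m) * q (n - m) = C * (T 1)\<^sup>2"
      unfolding C_def T1 by (simp add: power2_eq_square mult.assoc flip: exp_add)
    have "A (n + m) * A (n - m) = \<kappa>\<^sup>2 * (q (n + m) * q (n - m)) * (S (n + m) * S (n - m))"
      unfolding A by (simp add: power2_eq_square mult_ac)
    also have "\<dots> = \<kappa>\<^sup>2 * C * (S (n + m) * S (n - m) * (T 1)\<^sup>2)"
      unfolding e by (simp only: mult_ac)
    also have "S (n + m) * S (n - m) * (T 1)\<^sup>2 = (T m)\<^sup>2 * S (n + 1) * S (n - 1) - T (m + 1) * T (m - 1) * (S n)\<^sup>2"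
      unfolding S_def T_def by (rule sigma_net)
    also have "\<kappa>\<^sup>2 * C * \<dots> = \<kappa>\<^sup>2 * ((r m)\<^sup>2 * q (n + 1) * q (n - 1)) * ((T m)\<^sup>2 * S (n + 1) * S (n - 1))
      - \<kappa>\<^sup>2 * (r (m + 1) * r (m - 1) * (q n)\<^sup>2) * (T (m + 1) * T (m - 1) * (S n)\<^sup>2)"
      unfolding c by (simp only: right_diff_distrib)
    also have "\<dots> = (B m)\<^sup>2 * A (n + 1) * A (n - 1) - B (m + 1) * B (m - 1) * (A n)\<^sup>2"
      unfolding A B by (simp only: power_mult_distrib power2_eq_square mult_ac)
    finally show "A (n + m) * A (n - m) = (B m)\<^sup>2 * A (n + 1) * A (n - 1) - B (m + 1) * B (m - 1) * (A n)\<^sup>2" .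
  next
    fix n R :: int
    define C where "C = q (n + R) * q (n - 1) * r (R + 1) * r 2"
    have c: "q (n - 1 + R) * q n * r (R + 2) * r 1 = C" "q (n + R + 1) * q (n - 2) * r R * r 1 = C"
      unfolding C_def q_def r_def by (simp_all add: power2_eq_square algebra_simps flip: exp_add)
    have "A (n + R) * A (n - 1) * B (R + 1) * B 2 - A (n - 1 + R) * A n * B (R + 2) * B 1
      = \<kappa>\<^sup>2 * C * (S (n + R) * S (n - 1) * T (R + 1) * T 2)
        - \<kappa>\<^sup>2 * (q (n - 1 + R) * q n * r (R + 2) * r 1) * (S (n - 1 + R) * S n * T (R + 2) * T 1)"
      unfolding A B C_def by (simp only: power2_eq_square mult_ac)
    also have "\<dots> = \<kappa>\<^sup>2 * C * (S (n + R) * S (n - 1) * T (R + 1) * T 2 - S (n - 1 + R) * S n * T (R + 2) * T 1)"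
      unfolding c by (simp only: right_diff_distrib)
    also have "\<dots> = \<kappa>\<^sup>2 * C * (S (n + R + 1) * S (n - 2) * T R * T 1)"
      unfolding S_def T_def by (simp only: sigma_net(2))
    also have "\<dots> = A (n + R + 1) * A (n - 2) * B R * B 1"
      unfolding A B c(2)[symmetric] by (simp only: power2_eq_square mult_ac)
    finally show "A (n + R) * A (n - 1) * B (R + 1) * B 2 - A (n - 1 + R) * A n * B (R + 2) = A (n + R + 1) * A (n - 2) * B R"
      by (simp add: B1)
  next
    fix n R :: int
    define C where "C = q (n + R) * q (n - 2) * r (R + 1) * r 3"
    have c: "q (n - 2 + R) * q n * r (R + 3) * r 1 = C" "q (n + R + 1) * q (n - 3) * r 2 * r R = C"
      unfolding C_def q_def r_def by (simp_all add: power2_eq_square algebra_simps flip: exp_add)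
    have "A (n + R) * A (n - 2) * B (R + 1) * B 3 - A (n - 2 + R) * A n * B (R + 3) * B 1
      = \<kappa>\<^sup>2 * C * (S (n + R) * S (n - 2) * T (R + 1) * T 3)
        - \<kappa>\<^sup>2 * (q (n - 2 + R) * q n * r (R + 3) * r 1) * (S (n - 2 + R) * S n * T (R + 3) * T 1)"
      unfolding A B C_def by (simp only: power2_eq_square mult_ac)
    also have "\<dots> = \<kappa>\<^sup>2 * C * (S (n + R) * S (n - 2) * T (R + 1) * T 3 - S (n - 2 + R) * S n * T (R + 3) * T 1)"
      unfolding c by (simp only: right_diff_distrib)
    also have "\<dots> = \<kappa>\<^sup>2 * C * (S (n + R + 1) * S (n - 3) * T 2 * T R)"
      unfolding S_def T_def by (simp only: sigma_net(3))
    also have "\<dots> = A (n + R + 1) * A (n - 3) * B 2 * B R"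
      unfolding A B c(2)[symmetric] by (simp only: power2_eq_square mult_ac)
    finally show "A (n + R) * A (n - 2) * B (R + 1) * B 3 - A (n - 2 + R) * A n * B (R + 3) = A (n + R + 1) * A (n - 3) * B 2 * B R"
      by (simp add: B1)
  qed
qed

text \<open>Up to sign these are the values of the classical division polynomials at the image of
  z.\<close>

definition division_values :: "complex \<Rightarrow> int \<Rightarrow> complex" where
  "division_values z n = \<sigma> (of_int n * z) / \<sigma> z powi (n\<^sup>2)"

lemma net_trans_div_poly:
  assumes "z \<notin> L" "y \<notin> L" "z + y \<notin> L"
  shows "net_relation (division_values z) (trans_div_poly L z y)"
    and "net_relation (division_values z) (division_values z)" and "division_values z 1 = 1"
    and "division_values z (- n) = - division_values z n"
proof -
  have nz: "\<sigma> z \<noteq> 0" "\<sigma> y \<noteq> 0" "\<sigma> (z + y) \<noteq> 0" using assms \<sigma>_nz by blast+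
  \<comment> \<open>Any choice of logarithms will do, since they occur only in exponents with
    integer coefficients.\<close>
  obtain g h k where ghk: "exp g = \<sigma> z" "exp h = \<sigma> (z + y)" "exp k = \<sigma> y"
    using nz by (metis exp_Ln)
  have B: "division_values z = (\<lambda>n. exp (- (of_int n)\<^sup>2 * g) * \<sigma> (of_int n * z))"
  proof
    fix n
    have "\<sigma> z powi (n\<^sup>2) = exp ((of_int n)\<^sup>2 * g)"
      unfolding ghk(1)[symmetric] exp_power_int by simp
    then show "division_values z n = exp (- (of_int n)\<^sup>2 * g) * \<sigma> (of_int n * z)"
      by (simp add: division_values_def exp_minus divide_inverse)
  qed
  have A: "trans_div_poly L z y = (\<lambda>n. exp (- k) * exp (of_int n * (g - h + k) - (of_int n)\<^sup>2 * g) * \<sigma> (of_int n * z + y))"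
  proof
    fix n
    define x where "x = of_int n * (g - h + k) - (of_int n)\<^sup>2 * g"
    have "\<sigma> z powi (n\<^sup>2 - n) * \<sigma> (z + y) powi n * \<sigma> y powi (1 - n) = exp (k - x)"
      unfolding ghk[symmetric] exp_power_int exp_add[symmetric] x_def by (simp add: algebra_simps)
    then show "trans_div_poly L z y n = exp (- k) * exp (of_int n * (g - h + k) - (of_int n)\<^sup>2 * g) * \<sigma> (of_int n * z + y)"
      unfolding trans_div_poly_def x_def[symmetric] by (simp add: exp_diff exp_minus divide_inverse)
  qed
  show "net_relation (division_values z) (trans_div_poly L z y)" "division_values z 1 = 1"
    unfolding A B using sigma_net_relation[OF ghk(1)] by blast+
  show "net_relation (division_values z) (division_values z)"
    using sigma_net_relation(1)[OF ghk(1), of 1 0 0] unfolding B by simp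
  show "division_values z (- n) = - division_values z n"
    unfolding B using \<sigma>_uminus[of "of_int n * z"] by simp
qed

lemma \<sigma>_addition_wp:
  assumes "a \<notin> L" "b \<notin> L"
  shows "\<sigma> (a + b) * \<sigma> (a - b) = (\<sigma> a)\<^sup>2 * (\<sigma> b)\<^sup>2 * (\<pp> b - \<pp> a)"
  using assms \<sigma>_nz[OF assms(1)] \<sigma>_nz[OF assms(2)] unfolding \<sigma>_addition
  by (simp add: wp_eq_D right_diff_distrib)

text \<open>Expressing these through the images of z and 2z, rather than as polynomials in the image
  of z, lets the hypothesis on the order modulo p decide that they are integral and which are
  units.\<close>

lemma division_values_small:
  assumes z: "z \<notin> L"
  shows "division_values z 2 = - \<pp>' z"
    and "2 * z \<notin> L \<Longrightarrow> division_values z 3 = (\<pp> z - \<pp> (2 * z)) * (\<pp>' z)\<^sup>2"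
    and "2 * z \<notin> L \<Longrightarrow> division_values z 4 = - \<pp>' (2 * z) * (\<pp>' z) ^ 4"
proof -
  have nz: "\<sigma> z \<noteq> 0" using \<sigma>_nz z by blast
  show "division_values z 2 = - \<pp>' z"
    using nz by (simp add: division_values_def \<sigma>_double[OF z])
  assume z2: "2 * z \<notin> L"
  have "\<sigma> (3 * z) * \<sigma> z = (\<sigma> (2 * z))\<^sup>2 * (\<sigma> z)\<^sup>2 * (\<pp> z - \<pp> (2 * z))"
    using \<sigma>_addition_wp[OF z2 z] by (simp add: algebra_simps)
  also have "\<dots> = ((\<pp> z - \<pp> (2 * z)) * (\<pp>' z)\<^sup>2 * (\<sigma> z) ^ 9) * \<sigma> z"
    unfolding \<sigma>_double[OF z] by (simp add: power2_eq_square eval_nat_numeral)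
  finally have "\<sigma> (3 * z) = (\<pp> z - \<pp> (2 * z)) * (\<pp>' z)\<^sup>2 * (\<sigma> z) ^ 9"
    using nz by simp
  then show "division_values z 3 = (\<pp> z - \<pp> (2 * z)) * (\<pp>' z)\<^sup>2"
    using nz by (simp add: division_values_def)
  have "\<sigma> (4 * z) = - \<pp>' (2 * z) * (- \<pp>' z * (\<sigma> z) ^ 4) ^ 4"
    using \<sigma>_double[OF z2] unfolding \<sigma>_double[OF z] by simp
  also have "\<dots> = - \<pp>' (2 * z) * (\<pp>' z) ^ 4 * (\<sigma> z) ^ 16"
    by (simp add: power_mult_distrib flip: power_mult)
  finally show "division_values z 4 = - \<pp>' (2 * z) * (\<pp>' z) ^ 4"
    using nz by (simp add: division_values_def)
qed

text \<open>The addition formula with second argument z, applied at y, z + y and y - z, gives the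
  values at -1, 2 and -2 as products of differences of abscissae.\<close>

lemma trans_div_poly_small:
  assumes z: "z \<notin> L" and y: "y \<notin> L" and zy: "z + y \<notin> L"
  shows "trans_div_poly L z y 0 = 1" "trans_div_poly L z y 1 = 1"
    and "trans_div_poly L z y (-1) = \<pp> z - \<pp> y"
    and "trans_div_poly L z y 2 = \<pp> z - \<pp> (z + y)"
    and "y - z \<notin> L \<Longrightarrow> trans_div_poly L z y (-2) = (\<pp> z - \<pp> (y - z)) * (\<pp> z - \<pp> y)\<^sup>2"
proof -
  define g h k where "g = \<sigma> z" and "h = \<sigma> (z + y)" and "k = \<sigma> y"
  have nz: "g \<noteq> 0" "k \<noteq> 0" "h \<noteq> 0" using \<sigma>_nz assms unfolding g_def h_def k_def by blast+
  show "trans_div_poly L z y 0 = 1" "trans_div_poly L z y 1 = 1"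
    using nz by (simp_all add: trans_div_poly_def g_def h_def k_def)
  have m: "h * \<sigma> (y - z) = k\<^sup>2 * g\<^sup>2 * (\<pp> z - \<pp> y)"
    using \<sigma>_addition_wp[OF y z] by (simp add: g_def h_def k_def add.commute)
  have "trans_div_poly L z y (-1) = h * \<sigma> (y - z) / (g\<^sup>2 * k\<^sup>2)"
    using nz unfolding trans_div_poly_def g_def[symmetric] h_def[symmetric] k_def[symmetric]
    by (simp add: power_int_minus divide_inverse mult_ac)
  then show m1: "trans_div_poly L z y (-1) = \<pp> z - \<pp> y"
    unfolding m using nz by simp
  have "\<sigma> (2 * z + y) * k = h\<^sup>2 * g\<^sup>2 * (\<pp> z - \<pp> (z + y))"
    using \<sigma>_addition_wp[OF zy z] by (simp add: g_def h_def k_def algebra_simps)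
  moreover have "trans_div_poly L z y 2 = \<sigma> (2 * z + y) * k / (g\<^sup>2 * h\<^sup>2)"
    using nz unfolding trans_div_poly_def g_def[symmetric] h_def[symmetric] k_def[symmetric]
    by (simp add: power_int_minus divide_inverse mult_ac)
  ultimately show "trans_div_poly L z y 2 = \<pp> z - \<pp> (z + y)"
    using nz by simp
  assume yz: "y - z \<notin> L"
  have "k * \<sigma> (y - 2 * z) = (\<sigma> (y - z))\<^sup>2 * g\<^sup>2 * (\<pp> z - \<pp> (y - z))"
    using \<sigma>_addition_wp[OF yz z] by (simp add: g_def k_def algebra_simps)
  then have "k * \<sigma> (y - 2 * z) * h\<^sup>2 = (h * \<sigma> (y - z))\<^sup>2 * g\<^sup>2 * (\<pp> z - \<pp> (y - z))"
    by (simp add: power_mult_distrib)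
  also have "\<dots> = (k ^ 4 * g ^ 6) * ((\<pp> z - \<pp> (y - z)) * (\<pp> z - \<pp> y)\<^sup>2)"
    unfolding m by (simp add: power_mult_distrib flip: power_mult power_add)
  finally have e: "k * \<sigma> (y - 2 * z) * h\<^sup>2 = (k ^ 4 * g ^ 6) * ((\<pp> z - \<pp> (y - z)) * (\<pp> z - \<pp> y)\<^sup>2)" .
  have "trans_div_poly L z y (-2) = k * \<sigma> (y - 2 * z) * h\<^sup>2 / (k ^ 4 * g ^ 6)"
    using nz unfolding trans_div_poly_def g_def[symmetric] h_def[symmetric] k_def[symmetric]
    by (simp add: power_int_minus divide_inverse mult_ac power_eq_if)
  then show "trans_div_poly L z y (-2) = (\<pp> z - \<pp> (y - z)) * (\<pp> z - \<pp> y)\<^sup>2"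
    unfolding e using nz by simp
qed

end

section \<open>Reduction modulo the prime\<close>

lemma map_wcurve_sel:
  "a\<^sub>1 (map_wcurve f E) = f (a\<^sub>1 E)" "a\<^sub>2 (map_wcurve f E) = f (a\<^sub>2 E)" "a\<^sub>3 (map_wcurve f E) = f (a\<^sub>3 E)"
  "a\<^sub>4 (map_wcurve f E) = f (a\<^sub>4 E)" "a\<^sub>6 (map_wcurve f E) = f (a\<^sub>6 E)"
  by (cases E; simp)+

context local_ints
begin

abbreviation "F \<equiv> residue_ring (int p)"

interpretation F: residues_prime p F
  by (unfold_locales; (rule prime_p | simp))

lemma reduce_properties:
  assumes "x \<in> ints"
  shows "reduce p x \<in> {0..<int p}" "pcong 1 x (of_int (reduce p x))"
proof -
  obtain r s where rs: "quotient_of x = (r, s)" by (rule prod.exhaust)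
  note s = quotient_of_denom_pos[OF rs] and cop = quotient_of_coprime[OF rs] and x = quotient_of_div[OF rs]
  have sx: "of_int s * x = of_int r" using s x by simp
  \<comment> \<open>\<open>reduce\<close> inverts the denominator of the fraction in lowest terms;
    were it divisible by p, integrality of x would force p to divide the numerator too.\<close>
  have nd: "\<not> int p dvd s"
  proof
    assume dvd: "int p dvd s"
    then have "of_int s \<in> multiples 1" using of_int_multiples_iff[of s 1] by simp
    then have "of_int r \<in> multiples 1" using multiples_mult'[OF _ assms] sx by metis
    then have "int p dvd r" using of_int_multiples_iff[of r 1] by simp
    with dvd cop have "int p dvd 1" by (meson coprime_common_divisor)
    then show False using p_pos by simp
  qed
  define i where "i = inv\<^bsub>F\<^esub> (s mod int p)"
  have "s mod int p \<in> carrier F" "s mod int p \<noteq> \<zero>\<^bsub>F\<^esub>"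
    using nd p_pos by (auto simp: F.res_carrier_eq F.res_zero_eq dvd_eq_mod_eq_0)
  then have "s mod int p \<in> Units F"
    using field.field_Units[OF F.is_field] by blast
  then have i: "i \<in> carrier F" "(s mod int p) \<otimes>\<^bsub>F\<^esub> i = \<one>\<^bsub>F\<^esub>"
    unfolding i_def using F.Units_inv_closed F.Units_r_inv by blast+
  have red: "reduce p x = (r mod int p * i) mod int p"
    unfolding reduce_def rs i_def by (simp add: Let_def F.res_mult_eq)
  then show "reduce p x \<in> {0..<int p}" using p_pos by simp
  have "(s mod int p * i) mod int p = 1" using i by (simp add: F.res_mult_eq F.res_one_eq)
  then have one: "[s * i = 1] (mod int p ^ 1)"
    using p_pos by (simp add: Cong.cong_def mod_mult_left_eq)
  have "[s * reduce p x = s * (r * i)] (mod int p ^ 1)"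
    unfolding red Cong.cong_def by (simp add: mod_mult_right_eq mod_mult_left_eq)
  also have "s * (r * i) = r * (s * i)" by simp
  also have "[r * (s * i) = r * 1] (mod int p ^ 1)" using one by (rule cong_scalar_left)
  finally have "pcong 1 (of_int (s * reduce p x)) (of_int (r * 1))" by (rule pcong_of_int)
  then have "pcong 1 (of_int s * of_int (reduce p x)) (of_int s * x)" by (simp add: sx)
  moreover have "punit (of_int s)"
    using nd punit_iff[of "of_int s"] of_int_multiples_iff[of s 1] by simp
  ultimately have "pcong 1 (of_int (reduce p x)) x" by (rule pcong_cancel[rotated])
  then show "pcong 1 x (of_int (reduce p x))" by (rule pcong_sym)
qed

lemma reduce_eqI:
  assumes "x \<in> ints" "a \<in> {0..<int p}" "pcong 1 x (of_int a)"
  shows "reduce p x = a"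
proof -
  have "pcong 1 (of_int (reduce p x)) (of_int a)"
    using pcong_trans[OF pcong_sym[OF reduce_properties(2)[OF assms(1)]] assms(3)] .
  then have "[reduce p x = a] (mod int p)" using of_int_pcong_iff[of 1] by simp
  then show ?thesis
    using reduce_properties(1)[OF assms(1)] assms(2) by (auto simp: Cong.cong_def)
qed

lemma reduce_eq_iff:
  assumes "x \<in> ints" "y \<in> ints"
  shows "reduce p x = reduce p y \<longleftrightarrow> pcong 1 x y"
proof
  assume "reduce p x = reduce p y"
  then show "pcong 1 x y"
    using reduce_properties(2)[OF assms(1)] pcong_sym[OF reduce_properties(2)[OF assms(2)]]
    by (simp only:) (rule pcong_trans)
next
  assume "pcong 1 x y"
  from pcong_trans[OF this reduce_properties(2)[OF assms(2)]]
  show "reduce p x = reduce p y"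
    by (intro reduce_eqI assms reduce_properties)
qed

lemma reduce_0: "reduce p 0 = 0" and reduce_1: "reduce p 1 = 1"
  using p_pos by (auto intro!: reduce_eqI)

lemma reduce_carrier: "x \<in> ints \<Longrightarrow> reduce p x \<in> carrier F"
  using reduce_properties(1)[of x] by (simp add: F.res_carrier_eq)

lemma pcong_mod: "pcong 1 (of_int (a mod int p)) (of_int a)"
  by (rule pcong_of_int) (simp add: Cong.cong_def)

lemma reduce_add: "x \<in> ints \<Longrightarrow> y \<in> ints \<Longrightarrow> reduce p x \<oplus>\<^bsub>F\<^esub> reduce p y = reduce p (x + y)"
proof (rule sym, rule reduce_eqI)
  assume xy: "x \<in> ints" "y \<in> ints"
  show "pcong 1 (x + y) (of_int (reduce p x \<oplus>\<^bsub>F\<^esub> reduce p y))"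
    unfolding F.res_add_eq
    using pcong_trans[OF pcong_add[OF reduce_properties(2)[OF xy(1)] reduce_properties(2)[OF xy(2)]]
        pcong_sym[OF pcong_mod[of "reduce p x + reduce p y", unfolded of_int_add]]] .
qed (use p_pos in \<open>auto simp: F.res_add_eq\<close>)

lemma reduce_mult: "x \<in> ints \<Longrightarrow> y \<in> ints \<Longrightarrow> reduce p x \<otimes>\<^bsub>F\<^esub> reduce p y = reduce p (x * y)"
proof (rule sym, rule reduce_eqI)
  assume xy: "x \<in> ints" "y \<in> ints"
  show "pcong 1 (x * y) (of_int (reduce p x \<otimes>\<^bsub>F\<^esub> reduce p y))"
    unfolding F.res_mult_eq
    using pcong_trans[OF pcong_mult[OF reduce_properties(2)[OF xy(1)] reduce_properties(2)[OF xy(2)] xy(1) ints_of_int]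
        pcong_sym[OF pcong_mod[of "reduce p x * reduce p y", unfolded of_int_mult]]] .
qed (use p_pos in \<open>auto simp: F.res_mult_eq\<close>)

lemma reduce_uminus: "x \<in> ints \<Longrightarrow> \<ominus>\<^bsub>F\<^esub> reduce p x = reduce p (- x)"
  using F.minus_equality[of "reduce p (- x)" "reduce p x"] reduce_add[of "- x" x]
  by (simp add: reduce_carrier reduce_0 F.res_zero_eq)

lemma reduce_minus: "x \<in> ints \<Longrightarrow> y \<in> ints \<Longrightarrow> reduce p x \<ominus>\<^bsub>F\<^esub> reduce p y = reduce p (x - y)"
  by (simp add: a_minus_def reduce_uminus reduce_add)

lemma reduce_power: "x \<in> ints \<Longrightarrow> reduce p x [^]\<^bsub>F\<^esub> (n::nat) = reduce p (x ^ n)"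
  by (induction n) (simp_all add: F.res_one_eq reduce_1 reduce_mult mult.commute)

lemma reduce_add_pow: "x \<in> ints \<Longrightarrow> [(n::nat)] \<cdot>\<^bsub>F\<^esub> reduce p x = reduce p (of_nat n * x)"
  by (induction n) (simp_all add: add_pow_def nat_pow_def F.res_zero_eq reduce_0 reduce_add algebra_simps)

lemma reduce_inverse:
  assumes "punit x" shows "inv\<^bsub>F\<^esub> reduce p x = reduce p (inverse x)"
proof -
  have x: "x \<in> ints" "inverse x \<in> ints" using assms by (auto simp: punit_def)
  have "reduce p x \<otimes>\<^bsub>F\<^esub> reduce p (inverse x) = \<one>\<^bsub>F\<^esub>"
    using x punit_nonzero[OF assms] by (simp add: reduce_mult F.res_one_eq reduce_1)
  then show ?thesis using x by (intro F.comm_inv_char reduce_carrier)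
qed

lemmas reduce_simps = reduce_add reduce_mult reduce_uminus reduce_minus reduce_power reduce_add_pow

lemma reduce_point_affine:
  assumes "reduce_point p (Affine x y) \<noteq> Infinity"
  shows "x \<in> ints" "y \<in> ints" "reduce_point p (Affine x y) = Affine (reduce p x) (reduce p y)"
  using assms by (auto simp: reduce_point_def pval_nonneg_iff split: if_splits)

text \<open>A slope k with p in its denominator produces a non-integral abscissa: the inverse slope
  e is a multiple of p, and 1 = (k^2 + a k) e^2 - a e would then be one as well.\<close>

lemma steep_chord:
  assumes "punit u" "m \<in> multiples 1" "m \<noteq> 0" "a \<in> ints"
  shows "(u / m)\<^sup>2 + a * (u / m) \<notin> ints"
proof
  define e where "e = m / u"
  assume c: "(u / m)\<^sup>2 + a * (u / m) \<in> ints"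
  have u: "u \<noteq> 0" using punit_nonzero assms by blast
  have e: "e \<in> multiples 1"
    unfolding e_def divide_inverse using assms by (intro multiples_mult') (auto simp: punit_def)
  have "1 = ((u / m)\<^sup>2 + a * (u / m)) * e * e - a * e"
  proof -
    define k where "k = u / m"
    have ke: "k * e = 1" using u assms by (simp add: e_def k_def)
    have "(k\<^sup>2 + a * k) * e * e - a * e = (k * e) * (k * e) + a * (k * e) * e - a * e"
      by (simp add: power2_eq_square algebra_simps)
    also have "\<dots> = 1" unfolding ke by simp
    finally show ?thesis unfolding k_def by simp
  qed
  also have "\<dots> = ((u / m)\<^sup>2 + a * (u / m)) * e * e + - (a * e)" by simp
  also have "\<dots> \<in> multiples 1"
    using c e assms multiples_ints[OF e]
    by (intro multiples_add multiples_uminus multiples_mult ints_mult) auto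
  finally show False using punit_iff[OF ints_1] by simp
qed

section \<open>Points of a curve with p-integral coefficients and their reductions\<close>

context
  fixes E :: "rat wcurve"
  assumes E: "a\<^sub>1 E \<in> ints" "a\<^sub>2 E \<in> ints" "a\<^sub>3 E \<in> ints" "a\<^sub>4 E \<in> ints" "a\<^sub>6 E \<in> ints"
begin

abbreviation "Ep \<equiv> map_wcurve (reduce p) E"

lemma reduce_neg:
  "x \<in> ints \<Longrightarrow> y \<in> ints \<Longrightarrow> ec_neg F Ep (Affine (reduce p x) (reduce p y)) = Affine (reduce p x) (reduce p (- y - a\<^sub>1 E * x - a\<^sub>3 E))"
  by (simp add: ec_neg_def map_wcurve_sel reduce_simps E)

text \<open>Besides negation, this is the only compatibility of reduction with the group law that is
  used for the order hypothesis. It is elementary because the tangent slope has a unit in its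
  denominator.\<close>

lemma reduce_double:
  assumes xy: "x \<in> ints" "y \<in> ints" and unit: "punit (2 * y + a\<^sub>1 E * x + a\<^sub>3 E)"
  defines "l \<equiv> (3 * x\<^sup>2 + 2 * a\<^sub>2 E * x + a\<^sub>4 E - a\<^sub>1 E * y) / (2 * y + a\<^sub>1 E * x + a\<^sub>3 E)"
  shows "ec_add F Ep (Affine (reduce p x) (reduce p y)) (Affine (reduce p x) (reduce p y))
    = map_ec_point (reduce p) (chord E l x y x)"
proof -
  define b where "b = 2 * y + a\<^sub>1 E * x + a\<^sub>3 E"
  define n where "n = 3 * x\<^sup>2 + 2 * a\<^sub>2 E * x + a\<^sub>4 E - a\<^sub>1 E * y"
  have ints: "b \<in> ints" "n \<in> ints" "inverse b \<in> ints" "l \<in> ints"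
    using xy E unit by (auto simp: b_def n_def l_def punit_def divide_inverse)
  have diff: "y - (- y - a\<^sub>1 E * x - a\<^sub>3 E) = b" by (simp add: b_def)
  have "punit b" unfolding b_def by (rule unit)
  then have "\<not> pcong 1 y (- y - a\<^sub>1 E * x - a\<^sub>3 E)"
    unfolding pcong_def diff using punit_iff[OF ints(1)] by simp
  then have ne: "reduce p y \<noteq> reduce p (- y - a\<^sub>1 E * x - a\<^sub>3 E)"
    using reduce_eq_iff xy E by simp
  have dy: "ec_dy F Ep (reduce p x) (reduce p y) = reduce p b"
    using xy E by (simp add: ec_dy_def map_wcurve_sel reduce_simps b_def)
  have dx: "ec_dx F Ep (reduce p x) (reduce p y) = reduce p n"
    using xy E by (simp add: ec_dx_def map_wcurve_sel reduce_simps n_def mult.assoc)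
  have l: "reduce p n \<otimes>\<^bsub>F\<^esub> inv\<^bsub>F\<^esub> reduce p b = reduce p l"
    using ints unit by (simp add: reduce_inverse reduce_mult l_def n_def b_def divide_inverse)
  show ?thesis
    using ne xy E ints unfolding ec_add_def
    by (simp add: reduce_neg dx dy l Let_def chord_def map_wcurve_sel reduce_simps)
qed

lemma ns_order_le:
  assumes "n > 0" "P [^]\<^bsub>ns_group F Ep\<^esub> (n::nat) = Infinity"
  shows "ns_order F Ep P \<le> n"
proof -
  have "\<exists>n::nat. n > 0 \<and> P [^]\<^bsub>ns_group F Ep\<^esub> n = \<one>\<^bsub>ns_group F Ep\<^esub>"
    using assms by (auto simp: ns_group_def)
  moreover have "(LEAST n::nat. n > 0 \<and> P [^]\<^bsub>ns_group F Ep\<^esub> n = \<one>\<^bsub>ns_group F Ep\<^esub>) \<le> n"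
    using assms by (intro Least_le) (simp add: ns_group_def)
  ultimately show ?thesis unfolding ns_order_def by (simp only: if_True)
qed

lemma ns_group_power:
  "P [^]\<^bsub>ns_group F Ep\<^esub> (2::nat) = ec_add F Ep P P"
  "P [^]\<^bsub>ns_group F Ep\<^esub> (3::nat) = ec_add F Ep (ec_add F Ep P P) P"
proof -
  have "ec_add F Ep Infinity P = P" by (simp add: ec_add_def)
  then show "P [^]\<^bsub>ns_group F Ep\<^esub> (2::nat) = ec_add F Ep P P"
    "P [^]\<^bsub>ns_group F Ep\<^esub> (3::nat) = ec_add F Ep (ec_add F Ep P P) P"
    by (simp_all add: nat_pow_def ns_group_def numeral_2_eq_2 numeral_3_eq_3)
qed

lemma add_neg_F: "ec_add F Ep (Affine x y) (ec_neg F Ep (Affine x y)) = Infinity"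
  by (simp add: ec_add_def ec_neg_def)

text \<open>If p divided 2 y + a1 x + a3, the reduced point would be its own negative and killed by
  2. If P and 2P had congruent abscissae, the double of the reduced point would be its negative, and
  the point would be killed by 3.\<close>

lemma order_gt_3:
  assumes xy: "x \<in> ints" "y \<in> ints" and order: "ns_order F Ep (Affine (reduce p x) (reduce p y)) > 3"
  shows "punit (2 * y + a\<^sub>1 E * x + a\<^sub>3 E)"
    and "chord E ((3 * x\<^sup>2 + 2 * a\<^sub>2 E * x + a\<^sub>4 E - a\<^sub>1 E * y) / (2 * y + a\<^sub>1 E * x + a\<^sub>3 E)) x y x = Affine x3 y3
      \<Longrightarrow> x3 \<in> ints \<and> y3 \<in> ints \<and> punit (x - x3)"
proof -
  let ?P = "Affine (reduce p x) (reduce p y)"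
  define b where "b = 2 * y + a\<^sub>1 E * x + a\<^sub>3 E"
  have b_ints: "b \<in> ints" using xy E by (simp add: b_def)
  have unit: "punit b"
  proof (rule ccontr)
    assume "\<not> punit b"
    then have "b \<in> multiples 1" using punit_iff[OF b_ints] by simp
    moreover have "y - (- y - a\<^sub>1 E * x - a\<^sub>3 E) = b" by (simp add: b_def)
    ultimately have "reduce p (- y - a\<^sub>1 E * x - a\<^sub>3 E) = reduce p y"
      using xy E reduce_eq_iff[of y "- y - a\<^sub>1 E * x - a\<^sub>3 E"] by (simp add: pcong_def)
    then have "ec_neg F Ep ?P = ?P" using reduce_neg[OF xy] by simp
    then have "?P [^]\<^bsub>ns_group F Ep\<^esub> (2::nat) = Infinity"
      using add_neg_F[of "reduce p x" "reduce p y"] by (simp add: ns_group_power)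
    then show False using ns_order_le[of 2 ?P] order by simp
  qed
  then show unit': "punit (2 * y + a\<^sub>1 E * x + a\<^sub>3 E)" by (simp add: b_def)
  define n where "n = 3 * x\<^sup>2 + 2 * a\<^sub>2 E * x + a\<^sub>4 E - a\<^sub>1 E * y"
  have "n \<in> ints" using xy E by (simp add: n_def)
  then have l: "n / b \<in> ints" using ints_divide unit by blast
  assume ch: "chord E ((3 * x\<^sup>2 + 2 * a\<^sub>2 E * x + a\<^sub>4 E - a\<^sub>1 E * y) / (2 * y + a\<^sub>1 E * x + a\<^sub>3 E)) x y x = Affine x3 y3"
  then have ch': "chord E (n / b) x y x = Affine x3 y3" by (simp add: n_def b_def)
  then have x3: "x3 = (n / b)\<^sup>2 + a\<^sub>1 E * (n / b) - a\<^sub>2 E - x - x"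
    and y3: "y3 = - (y + n / b * (x3 - x)) - a\<^sub>1 E * x3 - a\<^sub>3 E"
    by (auto simp: chord_def Let_def)
  have x3_ints: "x3 \<in> ints" unfolding x3 using xy E l by (intro ints_diff ints_add ints_mult ints_power)
  have y3_ints: "y3 \<in> ints" unfolding y3 using xy E l x3_ints by (intro ints_diff ints_add ints_mult ints_uminus)
  have "punit (x - x3)"
  proof (rule ccontr)
    assume "\<not> punit (x - x3)"
    then have cx: "pcong 1 x x3" using punit_iff[of "x - x3"] xy x3_ints by (simp add: pcong_def)
    \<comment> \<open>The points -2P and P lie on the tangent at P. Congruent abscissae on this line
      of integral slope give congruent ordinates, so 2P reduces to the negative of P.\<close>
    have "y3 - (- y - a\<^sub>1 E * x - a\<^sub>3 E) = (n / b + a\<^sub>1 E) * (x - x3)"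
    proof -
      have "- (y + k * (x3 - x)) - a\<^sub>1 E * x3 - a\<^sub>3 E - (- y - a\<^sub>1 E * x - a\<^sub>3 E) = (k + a\<^sub>1 E) * (x - x3)" for k
        by (simp add: algebra_simps)
      then show ?thesis unfolding y3 .
    qed
    then have "pcong 1 y3 (- y - a\<^sub>1 E * x - a\<^sub>3 E)"
      using cx multiples_mult[of "n / b + a\<^sub>1 E" "x - x3" 1] l E by (simp add: pcong_def)
    then have "reduce p x3 = reduce p x" "reduce p y3 = reduce p (- y - a\<^sub>1 E * x - a\<^sub>3 E)"
      using reduce_eq_iff x3_ints y3_ints xy E pcong_sym[OF cx] by simp_all
    then have dbl: "ec_add F Ep ?P ?P = ec_neg F Ep ?P"
      using reduce_double[OF xy unit'] ch reduce_neg[OF xy] by simp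
    have "ec_neg F Ep (ec_neg F Ep ?P) = ?P"
      using xy E by (simp add: reduce_neg)
    then have "?P [^]\<^bsub>ns_group F Ep\<^esub> (3::nat) = Infinity"
      unfolding ns_group_power dbl using add_neg_F reduce_neg[OF xy] by metis
    then show False using ns_order_le[of 3 ?P] order by simp
  qed
  with x3_ints y3_ints show "x3 \<in> ints \<and> y3 \<in> ints \<and> punit (x - x3)" by blast
qed

text \<open>Reduction is not known here to be a homomorphism, so the argument takes place over the
  rationals. Subtracting the curve equations, the product of the slope numerators for P2 + P1 and P2
  - P1 is a multiple of x1 - x2, while their difference is the given unit. If p divided x1 - x2, one
  numerator would be a unit and that sum would reduce to \<open>Infinity\<close>; for x1 = x2 one of
  the two sums is \<open>Infinity\<close> itself.\<close>

lemma abscissae_apart: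
  assumes P: "Affine x1 y1 \<in> ec_points ring_of_type_algebra E" "Affine x2 y2 \<in> ec_points ring_of_type_algebra E"
    and ints: "x1 \<in> ints" "y1 \<in> ints" "x2 \<in> ints" "y2 \<in> ints"
    and unit: "punit (2 * y1 + a\<^sub>1 E * x1 + a\<^sub>3 E)"
    and plus: "reduce_point p (type_add E (Affine x2 y2) (Affine x1 y1)) \<noteq> Infinity"
    and minus: "reduce_point p (type_add E (Affine x2 y2) (Affine x1 (- y1 - a\<^sub>1 E * x1 - a\<^sub>3 E))) \<noteq> Infinity"
  shows "punit (x1 - x2)"
proof (rule ccontr)
  assume "\<not> punit (x1 - x2)"
  then have m: "x1 - x2 \<in> multiples 1" using punit_iff[of "x1 - x2"] ints by simp
  have inf: "reduce_point p Infinity = Infinity" by (simp add: reduce_point_def)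
  define A where "A = y1 - y2"
  define B where "B = - y1 - a\<^sub>1 E * x1 - a\<^sub>3 E - y2"
  define C where "C = x1\<^sup>2 + x1 * x2 + x2\<^sup>2 + a\<^sub>2 E * (x1 + x2) + a\<^sub>4 E - a\<^sub>1 E * y2"
  have AB_ints: "A \<in> ints" "B \<in> ints" "C \<in> ints" using ints E by (simp_all add: A_def B_def C_def)
  have AB: "A * B = - ((x1 - x2) * C)"
  proof -
    have "y1\<^sup>2 + a\<^sub>1 E * x1 * y1 + a\<^sub>3 E * y1 = x1 ^ 3 + a\<^sub>2 E * x1\<^sup>2 + a\<^sub>4 E * x1 + a\<^sub>6 E"
      "y2\<^sup>2 + a\<^sub>1 E * x2 * y2 + a\<^sub>3 E * y2 = x2 ^ 3 + a\<^sub>2 E * x2\<^sup>2 + a\<^sub>4 E * x2 + a\<^sub>6 E"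
      using P by (simp_all add: type_ec_points)
    note eqs = this
    have "A * B = - (y1\<^sup>2 + a\<^sub>1 E * x1 * y1 + a\<^sub>3 E * y1) + (y2\<^sup>2 + a\<^sub>1 E * x2 * y2 + a\<^sub>3 E * y2) + a\<^sub>1 E * (x1 - x2) * y2"
      by (simp add: A_def B_def power2_eq_square algebra_simps)
    also have "\<dots> = - ((x1 - x2) * C)"
      unfolding eqs by (simp add: C_def power2_eq_square power3_eq_cube algebra_simps)
    finally show ?thesis .
  qed
  have "A - B = 2 * y1 + a\<^sub>1 E * x1 + a\<^sub>3 E" by (simp add: A_def B_def)
  then have "A - B \<notin> multiples 1" using unit punit_iff[OF punit_ints[OF unit]] by simp
  then have notboth: "A \<notin> multiples 1 \<or> B \<notin> multiples 1"
    using multiples_add[of A 1 "- B"] multiples_uminus[of B 1] by auto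
  show False
  proof (cases "x1 = x2")
    case True
    then have "A = 0 \<or> B = 0" using AB by simp
    then show False
    proof
      assume "A = 0"
      then show False
        using minus type_add_neg[of E x2 y2] True inf by (simp add: A_def)
    next
      assume "B = 0"
      then have "y1 = - y2 - a\<^sub>1 E * x2 - a\<^sub>3 E" using True by (simp add: B_def)
      then show False
        using plus type_add_neg[of E x2 y2] True inf by simp
    qed
  next
    case False
    have steep: "punit u \<Longrightarrow> reduce_point p (chord E (u / (x1 - x2)) x2 y2 x1) = Infinity" for u
    proof -
      assume u: "punit u"
      define c where "c = (u / (x1 - x2))\<^sup>2 + a\<^sub>1 E * (u / (x1 - x2))"
      have nc: "c \<notin> ints" unfolding c_def using u m False E by (intro steep_chord) auto
      have "c - a\<^sub>2 E - x2 - x1 \<notin> ints"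
      proof
        assume "c - a\<^sub>2 E - x2 - x1 \<in> ints"
        then have "c - a\<^sub>2 E - x2 - x1 + (a\<^sub>2 E + x2 + x1) \<in> ints" using E ints by (intro ints_add)
        then show False using nc by simp
      qed
      then show ?thesis
        by (auto simp: chord_def Let_def reduce_point_def pval_nonneg_iff c_def)
    qed
    have "A * B \<in> multiples 1"
      unfolding AB using m AB_ints by (intro multiples_uminus multiples_mult')
    then have "A \<in> multiples 1 \<or> B \<in> multiples 1" using multiples_prime AB_ints by blast
    then have "punit A \<or> punit B" using notboth punit_iff AB_ints by blast
    then show False
    proof
      assume "punit A"
      then show False
        using steep[of A] plus type_add_chord[of x2 x1 E y2 y1] False by (simp add: A_def)
    next
      assume "punit B"
      then show False
        using steep[of B] minus type_add_chord[of x2 x1 E y2 "- y1 - a\<^sub>1 E * x1 - a\<^sub>3 E"] False by (simp add: B_def)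
    qed
  qed
qed

end

end

section \<open>Convergence\<close>

lemma chord_of_rat:
  "chord (map_wcurve of_rat E) (of_rat l) (of_rat x) (of_rat y) (of_rat x')
    = map_ec_point (of_rat :: rat \<Rightarrow> 'a::field_char_0) (chord E l x y x')"
  by (simp add: chord_def Let_def map_wcurve_sel of_rat_add of_rat_diff of_rat_mult of_rat_power of_rat_minus)

lemma set_wcurve_eq: "set_wcurve E = {a\<^sub>1 E, a\<^sub>2 E, a\<^sub>3 E, a\<^sub>4 E, a\<^sub>6 E}"
  by (cases E) auto

theorem theorem1p4:
  fixes W :: "nat \<Rightarrow> rat" and \<tau>\<^sub>1 \<tau>\<^sub>2 :: rat
    and E :: "rat wcurve" and P\<^sub>1 P\<^sub>2 :: "rat ec_point" and p :: nat
  assumes "somos4 W \<tau>\<^sub>1 \<tau>\<^sub>2" and "\<tau>\<^sub>1 \<noteq> 0" and "W 0 \<noteq> 0"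
    and "ec_disc E \<noteq> 0"
    and "P\<^sub>1 \<in> ec_points ring_of_type_algebra E"
    and "P\<^sub>2 \<in> ec_points ring_of_type_algebra E"
    and "somos_associated W E P\<^sub>1 P\<^sub>2"
    and "prime p" and "odd p"
    and "\<forall>a\<in>set_wcurve E. pval p a \<ge> 0"
    and "nonsingular (residue_ring (int p)) (map_wcurve (reduce p) E) (reduce_point p P\<^sub>1)"
    and "nonsingular (residue_ring (int p)) (map_wcurve (reduce p) E) (reduce_point p P\<^sub>2)"
    and "reduce_point p P\<^sub>1 \<noteq> Infinity"
    and "reduce_point p P\<^sub>2 \<noteq> Infinity"
    and "reduce_point p (ec_add ring_of_type_algebra E P\<^sub>2 P\<^sub>1) \<noteq> Infinity"
    and "reduce_point p (ec_add ring_of_type_algebra E P\<^sub>2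
           (ec_neg ring_of_type_algebra E P\<^sub>1)) \<noteq> Infinity"
    and "ns_order (residue_ring (int p)) (map_wcurve (reduce p) E) (reduce_point p P\<^sub>1) > 3"
    and "pval p (W 1 / W 0) \<ge> 0" and "pval p (W 0) \<ge> 0"
  shows "\<exists>q N. N \<ge> 1 \<and> q = p ^ N \<and>
           (\<forall>m\<ge>1. \<exists>x\<in>padic_ints p. padic_tendsto p (\<lambda>i. W (m * q ^ i)) x)"
proof -
  interpret local_ints p by unfold_locales fact
  let ?r = "of_rat :: rat \<Rightarrow> complex"
  define EC where "EC = map_wcurve ?r E"
  have "reduce_point p Infinity = Infinity" by (simp add: reduce_point_def)
  then obtain x1 y1 x2 y2 where P1: "P\<^sub>1 = Affine x1 y1" and P2: "P\<^sub>2 = Affine x2 y2"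
    using assms(13,14) by (cases P\<^sub>1; cases P\<^sub>2) auto
  have E: "a\<^sub>1 E \<in> ints" "a\<^sub>2 E \<in> ints" "a\<^sub>3 E \<in> ints" "a\<^sub>4 E \<in> ints" "a\<^sub>6 E \<in> ints"
    using assms(10) by (simp_all add: set_wcurve_eq pval_nonneg_iff)
  note ints1 = reduce_point_affine[OF assms(13)[unfolded P1]]
  note ints2 = reduce_point_affine[OF assms(14)[unfolded P2]]
  have order: "ns_order F (map_wcurve (reduce p) E) (Affine (reduce p x1) (reduce p y1)) > 3"
    using assms(17) unfolding P1 ints1(3) .
  define b where "b = 2 * y1 + a\<^sub>1 E * x1 + a\<^sub>3 E"
  have ub: "punit b" unfolding b_def by (rule order_gt_3(1)[OF E ints1(1,2) order])
  define l where "l = (3 * x1\<^sup>2 + 2 * a\<^sub>2 E * x1 + a\<^sub>4 E - a\<^sub>1 E * y1) / b"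
  obtain x3 y3 where dbl: "chord E l x1 y1 x1 = Affine x3 y3" by (auto simp: chord_def Let_def)
  have x3: "x3 \<in> ints" "y3 \<in> ints" "punit (x1 - x3)"
    using order_gt_3(2)[OF E ints1(1,2) order dbl[unfolded l_def b_def]] by simp_all
  have u12: "punit (x1 - x2)"
    using abscissae_apart[OF E, of x1 y1 x2 y2] assms(5,6,15,16) ints1(1,2) ints2(1,2) ub
    by (simp add: P1 P2 type_ec_neg b_def)
  then have ne: "x2 \<noteq> x1" using punit_nonzero[OF u12] by auto
  obtain xs ys where sum: "chord E ((y1 - y2) / (x1 - x2)) x2 y2 x1 = Affine xs ys"
    by (auto simp: chord_def Let_def)
  \<comment> \<open>The coordinates of P2 - P1 enter only through A(-2), for which rationality is
    enough.\<close>
  obtain xd yd where diff: "chord E ((- y1 - a\<^sub>1 E * x1 - a\<^sub>3 E - y2) / (x1 - x2)) x2 y2 x1 = Affine xd yd"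
    by (auto simp: chord_def Let_def)
  \<comment> \<open>The sum P2 + P1 does not reduce to \<open>Infinity\<close>, so its abscissa is
    integral; this becomes the integrality of A(2).\<close>
  have xs: "xs \<in> ints"
    using assms(15) reduce_point_affine(1)[of xs ys] by (simp add: P1 P2 type_add_chord[OF ne] sum)
  obtain L z1 z2 where unif: "uniformizes L EC"
    and z1: "unif_map L EC z1 = Affine (?r x1) (?r y1)" and z2: "unif_map L EC z2 = Affine (?r x2) (?r y2)"
    and W: "\<And>n. n \<ge> 1 \<Longrightarrow> ?r (W n) = ?r (W 1 / W 0) ^ n * ?r (W 0) * trans_div_poly L z1 z2 (int n)"
    using assms(7) unfolding somos_associated_def P1 P2 EC_def by auto
  interpret uniformization L EC by unfold_locales fact
  have sel: "a\<^sub>1 EC = ?r (a\<^sub>1 E)" "a\<^sub>2 EC = ?r (a\<^sub>2 E)" "a\<^sub>3 EC = ?r (a\<^sub>3 E)" "a\<^sub>4 EC = ?r (a\<^sub>4 E)"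
    by (simp_all add: EC_def map_wcurve_sel)
  have coords: "z \<notin> L" "xc z = ?r x" "\<pp>' z = ?r (2 * y + a\<^sub>1 E * x + a\<^sub>3 E)"
    if "unif_map L EC z = Affine (?r x) (?r y)" for z x y
  proof -
    show z: "z \<notin> L" using that unif_map_Infinity by force
    then have "xc z = ?r x" "yc z = ?r y" using that unif_map_Affine by simp_all
    moreover have "\<pp>' z = 2 * yc z + a\<^sub>1 EC * xc z + a\<^sub>3 EC" by (simp add: yc_def)
    ultimately show "xc z = ?r x" "\<pp>' z = ?r (2 * y + a\<^sub>1 E * x + a\<^sub>3 E)"
      by (simp_all add: sel of_rat_add of_rat_mult)
  qed
  have pp: "\<pp> z - \<pp> w = xc z - xc w" for z w by (simp add: xc_def)
  have rne: "?r x2 \<noteq> ?r x1" using ne by simp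
  have nz: "?r b \<noteq> 0" using punit_nonzero[OF ub] by simp
  have den: "2 * ?r y1 + a\<^sub>1 EC * ?r x1 + a\<^sub>3 EC = ?r b"
    by (simp add: sel b_def of_rat_add of_rat_mult)
  have num: "3 * (?r x1)\<^sup>2 + 2 * a\<^sub>2 EC * ?r x1 + a\<^sub>4 EC - a\<^sub>1 EC * ?r y1 = ?r (l * b)"
    using punit_nonzero[OF ub] by (simp add: sel l_def of_rat_add of_rat_mult of_rat_diff of_rat_power)
  have "unif_map L EC (z1 + z1) = chord EC (?r (l * b) / ?r b) (?r x1) (?r y1) (?r x1)"
    unfolding unif_map_add z1 by (rule type_add_double[of "?r y1" EC "?r x1", unfolded den num, OF nz])
  also have "?r (l * b) / ?r b = ?r l" by (simp only: of_rat_mult nonzero_mult_div_cancel_right[OF nz])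
  finally have "unif_map L EC (z1 + z1) = chord EC (?r l) (?r x1) (?r y1) (?r x1)" .
  then have "unif_map L EC (2 * z1) = Affine (?r x3) (?r y3)"
    unfolding EC_def chord_of_rat dbl by (simp only: mult_2 ec_point.map)
  note c3 = coords[OF this]
  have "unif_map L EC (z2 + z1) = chord EC (?r ((y1 - y2) / (x1 - x2))) (?r x2) (?r y2) (?r x1)"
    unfolding unif_map_add z1 z2 type_add_chord[OF rne] by (simp only: of_rat_divide of_rat_diff)
  then have "unif_map L EC (z1 + z2) = Affine (?r xs) (?r ys)"
    unfolding EC_def chord_of_rat sum by (simp add: add.commute)
  note cs = coords[OF this]
  note c1 = coords[OF z1] and c2 = coords[OF z2]
  have "unif_map L EC (- z1) = Affine (?r x1) (?r (- y1 - a\<^sub>1 E * x1 - a\<^sub>3 E))"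
  proof -
    have y: "yc z1 = ?r y1" using z1 unif_map_Affine[OF c1(1)] by simp
    have x: "xc (- z1) = xc z1" by (simp add: xc_def uminus_point(1)[OF c1(1)])
    have pd: "\<pp>' w = 2 * yc w + a\<^sub>1 EC * xc w + a\<^sub>3 EC" for w by (simp add: yc_def)
    define u where "u = a\<^sub>1 EC * xc z1 + a\<^sub>3 EC"
    have eq: "2 * yc (- z1) + u = - (2 * yc z1 + u)"
      using uminus_point(2)[OF c1(1)] unfolding pd x u_def by (simp only: add.assoc)
    have "2 * yc (- z1) = (2 * yc (- z1) + u) - u" by simp
    also have "\<dots> = 2 * (- yc z1 - u)" unfolding eq by (simp add: algebra_simps)
    finally have "yc (- z1) = - yc z1 - u" by (simp only: mult_cancel_left) simp
    then have "yc (- z1) = - ?r y1 - (a\<^sub>1 EC * xc z1 + a\<^sub>3 EC)"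
      by (simp only: u_def y)
    then have "yc (- z1) = - ?r y1 - a\<^sub>1 EC * xc z1 - a\<^sub>3 EC" by simp
    then show ?thesis
      using unif_map_Affine[of "- z1"] c1 uminus_point[OF c1(1)]
      by (simp add: xc_def sel of_rat_diff of_rat_mult of_rat_minus)
  qed
  then have "unif_map L EC (z2 + - z1) = chord EC (?r ((- y1 - a\<^sub>1 E * x1 - a\<^sub>3 E - y2) / (x1 - x2))) (?r x2) (?r y2) (?r x1)"
    unfolding unif_map_add z2 by (simp only: type_add_chord[OF rne] of_rat_divide of_rat_diff)
  then have "unif_map L EC (z2 - z1) = Affine (?r xd) (?r yd)"
    unfolding EC_def chord_of_rat diff by simp
  note cd = coords[OF this]
  define BC where "BC = division_values z1"
  define AC where "AC = trans_div_poly L z1 z2"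
  note net = net_trans_div_poly[OF c1(1) c2(1) cs(1), folded BC_def AC_def]
  define b3 where "b3 = 2 * y3 + a\<^sub>1 E * x3 + a\<^sub>3 E"
  have BC: "BC 2 = ?r (- b)" "BC 3 = ?r ((x1 - x3) * b\<^sup>2)"
    "BC 4 = ?r (- b3 * b ^ 4)"
    using division_values_small[OF c1(1)] c3 c1
    by (simp_all add: BC_def pp b_def[symmetric] b3_def[symmetric] of_rat_minus of_rat_mult of_rat_power of_rat_diff)
  have AC: "AC 0 = ?r 1" "AC 1 = ?r 1" "AC (-1) = ?r (x1 - x2)" "AC 2 = ?r (x1 - xs)"
    "AC (-2) = ?r ((x1 - xd) * (x1 - x2)\<^sup>2)"
    using trans_div_poly_small[OF c1(1) c2(1) cs(1)] c1 c2 cs cd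
    by (simp_all add: AC_def pp of_rat_mult of_rat_power of_rat_diff)
  have b0: "b \<noteq> 0" and d0: "x1 - x2 \<noteq> 0" using punit_nonzero ub u12 by blast+
  \<comment> \<open>Rationality at all integer indices comes first; the net relations can then be
    pulled back along \<open>of_rat\<close> to sequences in \<open>rat\<close>, on which valuations
    make sense.\<close>
  have BQ: "BC n \<in> \<rat>" for n
    by (rule eds_in_Rats) (use net(2-4) b0 in \<open>simp_all add: BC\<close>)
  have AQ: "AC n \<in> \<rat>" for n
  proof (rule net_in_Rats[OF net(1) BQ])
    show "AC 0 = 1" "AC 1 = 1" using AC(1,2) by (simp_all only: of_rat_1)
    show "AC (-1) \<noteq> 0" unfolding AC(3) of_rat_eq_0_iff by (rule d0)
    show "AC (-1) \<in> \<rat>" "AC 2 \<in> \<rat>" "AC (-2) \<in> \<rat>" unfolding AC by (rule Rats_of_rat)+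
    show "BC 1 = 1" by (rule net(3))
  qed
  have "\<forall>n. \<exists>x. BC n = ?r x" "\<forall>n. \<exists>x. AC n = ?r x"
    using BQ AQ by (simp_all add: Rats_def image_iff)
  then obtain B A where "\<forall>n. BC n = ?r (B n)" "\<forall>n. AC n = ?r (A n)"
    by (elim choice[THEN exE])
  then have B: "?r (B n) = BC n" and A: "?r (A n) = AC n" for n by (simp_all only:)
  have rat_eq: "?r x = ?r y \<Longrightarrow> x = y" for x y by simp
  interpret elliptic_net p B A
  proof unfold_locales
    show "net_relation B B" using net_relation_of_rat[OF net(2) B B] .
    show "net_relation B A" using net_relation_of_rat[OF net(1) B A] .
    show "B (- n) = - B n" for n using net(4)[of n] by (intro rat_eq) (simp add: B of_rat_minus)
    show "B 1 = 1" using net(3) by (intro rat_eq) (simp add: B)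
    have "B 2 = - b" "B 3 = (x1 - x3) * b\<^sup>2" and B4: "B 4 = - b3 * b ^ 4"
      using BC by (auto intro!: rat_eq simp: B)
    then show "punit (B 2)" "punit (B 3)" using ub x3 by simp_all
    show "B 4 \<in> ints" unfolding B4 b3_def using x3 E punit_ints[OF ub]
      by (intro ints_mult ints_uminus ints_add ints_power ints_numeral)
    have "A 0 = 1" "A 1 = 1" "A (-1) = x1 - x2" "A 2 = x1 - xs"
      using AC by (auto intro!: rat_eq simp: A)
    then show "A 0 = 1" "A 1 = 1" "punit (A (-1))" "A 2 \<in> ints"
      using u12 xs ints1 by simp_all
  qed
  show ?thesis
  proof (rule padic_limit[OF \<open>odd p\<close>])
    show "W n = (W 1 / W 0) ^ n * W 0 * A (int n)" if "n \<ge> 1" for n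
      using W[OF that] by (intro rat_eq) (simp only: of_rat_mult of_rat_power A AC_def)
  qed (use assms(18,19) in \<open>simp_all add: pval_nonneg_iff\<close>)
qed

end
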